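(* Let $F$ and $Q$ be smooth functions in their respective domains, with $F$ uniformly convex, and let $g$ be piecewise smooth. Suppose $u(x,t)$ is a weak solution of $$u_t+(F(u))_x=Q(u,x,t),\qquad u(x,0)=g(x),$$ with an isolated shock at position $x^*(t)$ with left state $u_L(t)$ and right state $u_R(t)$. If at time $t$ the parametric curve $\langle x(s,t),u(s,t)\rangle$ given by solving the characteristic equations $\dot x=F'(u)$, $\dot u=Q(u,x,t)$ is an equal-area curve about $x^*(t)$, then the modified equal-area principle predicts the shock position at time $t+\Delta t$ with second order accuracy in time; that is, the predicted position agrees with the true shock position $x^*(t+\Delta t)$ given by the Rankine–Hugoniot condition up to an error $\mathcal{O}(\Delta t^2)$.
   Context: Characteristic curve: $\langle x(s,t),u(s,t)\rangle$ solves $\dot x=F'(u)$, $\dot u=Q(u,x,t)$ for each parameter value $s$, starting from the initial curve $\langle s,g(s)\rangle$. Equal-area curve about $x^*(t)$: there are parameters $s_1(t),s_2(t)$ with $x(s_1(t),t)=x(s_2(t),t)=x^*(t)$ and $\int_{s_1(t)}^{s_2(t)}u(s,t)x_s(s,t)\,ds=0$, the end heights being the shock states, $u(s_1(t),t)=u_L(t)$ and $u(s_2(t),t)=u_R(t)$. Modified equal-area principle: the height of each particle is fixed at its value $u(s,t)$ at time $t$, but the particle is still moved with the correct horizontal motion given by solving the full characteristic system for time $\Delta t$, so that $x(s,t+\Delta t)=x(s,t)+\int_t^{t+\Delta t}F'(u(s,\tau))\,d\tau$. One then searches for $s_1(t+\Delta t)$ and $s_2(t+\Delta t)$ such that $$\int_{s_1(t+\Delta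 t)}^{s_2(t+\Delta t)}u(s,t)\,\frac{\partial}{\partial s}\left(x(s,t)+\int_t^{t+\Delta t}F'(u(s,\tau))\,d\tau\right)ds=0,$$ $$x(s_1(t+\Delta t),t+\Delta t)=x(s_2(t+\Delta t),t+\Delta t).$$ The predicted shock position at time $t+\Delta t$ is $x(s_1(t+\Delta t),t+\Delta t)$. Rankine–Hugoniot condition: $\frac{d}{dt}x^*(t)=\frac{F(u_L(t))-F(u_R(t))}{u_L(t)-u_R(t)}$. *)

theory Defs
  imports "HOL-Analysis.Analysis" "HOL-Library.Landau_Symbols"
begin

text \<open>
  Scalar balance laws \<open>u\<^sub>t + (F(u))\<^sub>x = Q(u, x, t)\<close>. Throughout, \<open>U\<close> is the domain of the flux \<open>F\<close>,
  \<open>D\<close> is the domain of the source \<open>Q\<close>, whose argument is the triple \<open>(u, x, t)\<close>, and \<open>T\<close> is a time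
  horizon. \<open>D\<close> is an open set, so that smoothness up to \<open>t = 0\<close> means that \<open>Q\<close> extends
  smoothly to slightly negative times.
\<close>


subsection \<open>Smoothness\<close>

fun Ck_on :: "nat \<Rightarrow> 'a set \<Rightarrow> ('a::real_normed_vector \<Rightarrow> 'b::real_normed_vector) \<Rightarrow> bool" where
  "Ck_on 0 S f \<longleftrightarrow> continuous_on S f"
| "Ck_on (Suc n) S f \<longleftrightarrow>
     (\<forall>p\<in>S. f differentiable (at p)) \<and> (\<forall>h. Ck_on n S (\<lambda>p. frechet_derivative f (at p) h))"

text \<open>Intended for open \<open>S\<close>.\<close>

definition smooth_on :: "'a set \<Rightarrow> ('a::real_normed_vector \<Rightarrow> 'b::real_normed_vector) \<Rightarrow> bool" where
  "smooth_on S f \<longleftrightarrow> (\<forall>n. Ck_on n S f)"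

definition uniformly_convex_on :: "real set \<Rightarrow> (real \<Rightarrow> real) \<Rightarrow> bool" where
  "uniformly_convex_on U F \<longleftrightarrow> (\<exists>c>0. \<forall>w\<in>U. deriv (deriv F) w \<ge> c)"

text \<open>
  The breakpoints form a locally finite set \<open>P\<close>, and on every piece the function is smooth up to
  the end points of the piece, that is, it is the restriction of a smooth function on the line. Jumps
  are allowed; the values at the breakpoints are arbitrary.
\<close>

definition piecewise_smooth :: "(real \<Rightarrow> real) \<Rightarrow> bool" where
  "piecewise_smooth g \<longleftrightarrow>
     (\<exists>P. (\<forall>a b. finite (P \<inter> {a..b})) \<and>
          (\<forall>a b. a < b \<and> {a<..<b} \<inter> P = {} \<longrightarrow>
             (\<exists>h. smooth_on UNIV h \<and> (\<forall>y\<in>{a<..<b}. g y = h y))))"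


subsection \<open>Weak solutions and shocks\<close>

text \<open>
  A compactly supported \<open>C\<^sup>1\<close> test function on \<open>\<real> \<times> [0, T)\<close>, given as a function on the plane together
  with its two partial derivatives. It need not vanish at \<open>t = 0\<close>.
\<close>

definition test_function ::
  "real \<Rightarrow> (real \<times> real \<Rightarrow> real) \<Rightarrow> (real \<times> real \<Rightarrow> real) \<Rightarrow> (real \<times> real \<Rightarrow> real) \<Rightarrow> bool" where
  "test_function T \<phi> \<phi>x \<phi>t \<longleftrightarrow>
     (\<forall>p. (\<phi> has_derivative (\<lambda>(h, k). \<phi>x p * h + \<phi>t p * k)) (at p)) \<and>
     continuous_on UNIV \<phi>x \<and> continuous_on UNIV \<phi>t \<and>
     (\<exists>K. compact K \<and> K \<subseteq> UNIV \<times> {..<T} \<and> (\<forall>p. p \<notin> K \<longrightarrow> \<phi> p = 0))"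

definition weak_solution ::
  "real set \<Rightarrow> (real \<Rightarrow> real) \<Rightarrow> (real \<times> real \<times> real) set \<Rightarrow> (real \<times> real \<times> real \<Rightarrow> real)
    \<Rightarrow> (real \<Rightarrow> real) \<Rightarrow> real \<Rightarrow> (real \<Rightarrow> real \<Rightarrow> real) \<Rightarrow> bool" where
  "weak_solution U F D Q g T u \<longleftrightarrow>
     (\<forall>y. \<forall>\<tau>\<in>{0..<T}. u y \<tau> \<in> U \<and> (u y \<tau>, y, \<tau>) \<in> D) \<and>
     (\<forall>K. compact K \<and> K \<subseteq> UNIV \<times> {0..<T} \<longrightarrow>
        set_integrable lborel K (\<lambda>(y, \<tau>). u y \<tau>) \<and>
        set_integrable lborel K (\<lambda>(y, \<tau>). F (u y \<tau>)) \<and>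
        set_integrable lborel K (\<lambda>(y, \<tau>). Q (u y \<tau>, y, \<tau>))) \<and>
     (\<forall>\<phi> \<phi>x \<phi>t. test_function T \<phi> \<phi>x \<phi>t \<longrightarrow>
        (LINT p:UNIV \<times> {0..<T}|lborel. (case p of (y, \<tau>) \<Rightarrow>
            u y \<tau> * \<phi>t (y, \<tau>) + F (u y \<tau>) * \<phi>x (y, \<tau>) + Q (u y \<tau>, y, \<tau>) * \<phi> (y, \<tau>)))
        + (LINT y|lborel. g y * \<phi> (y, 0)) = 0)"

text \<open>
  On the time interval \<open>I\<close> the function \<open>u\<close> has a jump along the \<open>C\<^sup>1\<close> curve \<open>xs\<close>, from the left state
  \<open>uL\<close> to the right state \<open>uR\<close>, and \<open>u\<close> has no further discontinuity near that curve: it is Lipschitz on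
  either side of it. Lipschitz, rather than smooth, because a kink of the piecewise smooth initial
  data travels along its characteristic and may run into the shock. No entropy condition
  (\<open>uL > uR\<close>) is imposed.
\<close>

definition isolated_shock ::
  "real set \<Rightarrow> (real \<Rightarrow> real \<Rightarrow> real) \<Rightarrow> real set
    \<Rightarrow> (real \<Rightarrow> real) \<Rightarrow> (real \<Rightarrow> real) \<Rightarrow> (real \<Rightarrow> real) \<Rightarrow> bool" where
  "isolated_shock U u I xs uL uR \<longleftrightarrow>
     (\<exists>xs'. continuous_on I xs' \<and> (\<forall>\<tau>\<in>I. (xs has_real_derivative xs' \<tau>) (at \<tau> within I))) \<and>
     (\<forall>\<tau>\<in>I. uL \<tau> \<in> U \<and> uR \<tau> \<in> U \<and> uL \<tau> \<noteq> uR \<tau> \<and>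
        ((\<lambda>y. u y \<tau>) \<longlongrightarrow> uL \<tau>) (at_left (xs \<tau>)) \<and>
        ((\<lambda>y. u y \<tau>) \<longlongrightarrow> uR \<tau>) (at_right (xs \<tau>))) \<and>
     (\<forall>\<tau>0\<in>I. \<exists>r>0. \<exists>L.
        L-lipschitz_on {(y, \<tau>). \<tau> \<in> I \<and> \<bar>\<tau> - \<tau>0\<bar> < r \<and> xs \<tau> - r < y \<and> y < xs \<tau>} (\<lambda>(y, \<tau>). u y \<tau>) \<and>
        L-lipschitz_on {(y, \<tau>). \<tau> \<in> I \<and> \<bar>\<tau> - \<tau>0\<bar> < r \<and> xs \<tau> < y \<and> y < xs \<tau> + r} (\<lambda>(y, \<tau>). u y \<tau>))"

definition rankine_hugoniot ::
  "(real \<Rightarrow> real) \<Rightarrow> real set \<Rightarrow> (real \<Rightarrow> real) \<Rightarrow> (real \<Rightarrow> real) \<Rightarrow> (real \<Rightarrow> real) \<Rightarrow> bool" where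
  "rankine_hugoniot F I xs uL uR \<longleftrightarrow>
     (\<forall>\<tau>\<in>I. (xs has_real_derivative (F (uL \<tau>) - F (uR \<tau>)) / (uL \<tau> - uR \<tau>)) (at \<tau> within I))"


subsection \<open>The characteristic curve\<close>

text \<open>
  The initial curve is the graph of \<open>g\<close>, with vertical segments filled in at the jumps of \<open>g\<close>, because
  integrals along the curve would otherwise miss the jumps. A curve \<open>\<langle>\<xi>(s), \<gamma>(s)\<rangle>\<close> with vertical
  segments cannot have \<open>\<xi>(s) = s\<close>, so the parametrisation is left free. If \<open>g\<close> is continuous, then
  \<open>\<xi>(s) = s\<close>, \<open>\<gamma>(s) = g(s)\<close> is admissible, and every admissible curve has \<open>\<gamma>(s) = g(\<xi>(s))\<close>.
\<close>

definition initial_curve :: "(real \<Rightarrow> real) \<Rightarrow> (real \<Rightarrow> real) \<Rightarrow> (real \<Rightarrow> real) \<Rightarrow> bool" where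
  "initial_curve g \<xi> \<gamma> \<longleftrightarrow>
     continuous_on UNIV \<xi> \<and> piecewise_smooth \<xi> \<and> mono \<xi> \<and> surj \<xi> \<and>
     continuous_on UNIV \<gamma> \<and> piecewise_smooth \<gamma> \<and>
     (\<forall>s. \<gamma> s \<in> closed_segment (Lim (at_left (\<xi> s)) g) (Lim (at_right (\<xi> s)) g))"

text \<open>The point with parameter \<open>s\<close> is at \<open>(x s \<tau>, v s \<tau>)\<close> at time \<open>\<tau>\<close>; its height is called \<open>v\<close>, to
  distinguish it from the weak solution \<open>u\<close>.\<close>

definition characteristic_curve ::
  "real set \<Rightarrow> (real \<Rightarrow> real) \<Rightarrow> (real \<times> real \<times> real) set \<Rightarrow> (real \<times> real \<times> real \<Rightarrow> real)
    \<Rightarrow> (real \<Rightarrow> real) \<Rightarrow> real \<Rightarrow> (real \<Rightarrow> real \<Rightarrow> real) \<Rightarrow> (real \<Rightarrow> real \<Rightarrow> real) \<Rightarrow> bool" where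
  "characteristic_curve U F D Q g T x v \<longleftrightarrow>
     initial_curve g (\<lambda>s. x s 0) (\<lambda>s. v s 0) \<and>
     (\<forall>s. \<forall>\<tau>\<in>{0..<T}. v s \<tau> \<in> U \<and> (v s \<tau>, x s \<tau>, \<tau>) \<in> D \<and>
        (x s has_real_derivative deriv F (v s \<tau>)) (at \<tau> within {0..<T}) \<and>
        (v s has_real_derivative Q (v s \<tau>, x s \<tau>, \<tau>)) (at \<tau> within {0..<T}))"


subsection \<open>Equal-area principles\<close>

text \<open>In the integrals over \<open>s\<close> below, the \<open>s\<close>-derivative may fail to exist at the finitely many
  parameters of breakpoints; \<open>deriv\<close> is then an arbitrary value on a null set.\<close>

definition equal_area_curve_about ::
  "(real \<Rightarrow> real \<Rightarrow> real) \<Rightarrow> (real \<Rightarrow> real \<Rightarrow> real) \<Rightarrow> real \<Rightarrow> real \<Rightarrow> real \<Rightarrow> real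
    \<Rightarrow> real \<Rightarrow> real \<Rightarrow> bool" where
  "equal_area_curve_about x v t X wL wR s1 s2 \<longleftrightarrow>
     s1 < s2 \<and> x s1 t = X \<and> x s2 t = X \<and> v s1 t = wL \<and> v s2 t = wR \<and>
     ((\<lambda>s. v s t * deriv (\<lambda>s'. x s' t) s) has_integral 0) {s1..s2}"

text \<open>The parameters \<open>a < b\<close> solve the equations of the modified equal-area principle for a step of
  length \<open>\<delta>\<close> from time \<open>t\<close>; the shock position predicted for time \<open>t + \<delta>\<close> is then \<open>x a (t + \<delta>)\<close>. The
  strict inequality excludes the trivial solutions \<open>a = b\<close>.\<close>

definition modified_equal_area ::
  "(real \<Rightarrow> real) \<Rightarrow> (real \<Rightarrow> real \<Rightarrow> real) \<Rightarrow> (real \<Rightarrow> real \<Rightarrow> real) \<Rightarrow> real \<Rightarrow> real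
    \<Rightarrow> real \<Rightarrow> real \<Rightarrow> bool" where
  "modified_equal_area F x v t \<delta> a b \<longleftrightarrow>
     a < b \<and> x a (t + \<delta>) = x b (t + \<delta>) \<and>
     ((\<lambda>s. v s t * deriv (\<lambda>s'. x s' t + integral {t..t+\<delta>} (\<lambda>\<tau>. deriv F (v s' \<tau>))) s)
        has_integral 0) {a..b}"

text \<open>\<open>x\<^sub>s(\<cdot>, t)\<close> is bounded away from 0 near \<open>s\<close>, formulated with difference quotients because \<open>s\<close> may
  be the parameter of a breakpoint.\<close>

definition transversal_at :: "(real \<Rightarrow> real \<Rightarrow> real) \<Rightarrow> real \<Rightarrow> real \<Rightarrow> bool" where
  "transversal_at x t s \<longleftrightarrow>
     (\<exists>c>0. \<exists>r>0. \<forall>a\<in>ball s r. \<forall>b\<in>ball s r. c * \<bar>a - b\<bar> \<le> \<bar>x a t - x b t\<bar>)"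

end

theory Submission
  imports Defs
begin

text \<open>
  Write \<open>v\<^sub>0(s) = v(s, t)\<close> and \<open>X\<^sub>\<delta>(s) = x(s, t + \<delta>)\<close>. The frozen heights are integrated against
  the moved positions, so for parameters \<open>a\<close>, \<open>b\<close> with \<open>X\<^sub>\<delta>(a) = X\<^sub>\<delta>(b) = Y\<close> an integration by
  parts turns the modified area into \<open>- \<integral> (X\<^sub>\<delta> - Y) v\<^sub>0' ds\<close> over \<open>[a, b]\<close>. This form no longer
  contains a derivative of the moved curve, and the uniform expansion
  \<open>X\<^sub>\<delta> = X\<^sub>0 + \<delta> F'(v\<^sub>0) + O(\<delta>\<^sup>2)\<close> of the characteristics can be inserted. The first term
  contributes the area at time \<open>t\<close>, which vanishes between \<open>s1\<close> and \<open>s2\<close>; moving the end points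
  changes it only quadratically, because \<open>X\<^sub>0 - x\<^sup>*\<close> vanishes at them. The second term integrates
  to \<open>\<delta> (F(v\<^sub>0(b)) - F(v\<^sub>0(a)))\<close>. Hence for a vanishing area
  \<open>(Y - x\<^sup>*) (v\<^sub>0(b) - v\<^sub>0(a)) = \<delta> (F(v\<^sub>0(b)) - F(v\<^sub>0(a))) + O(\<delta>\<^sup>2 + (a - s1)\<^sup>2 + (b - s2)\<^sup>2)\<close>,
  which is \<open>equal_area_step.J_expansion\<close>. If \<open>a - s1\<close> and \<open>b - s2\<close> are \<open>O(\<delta>)\<close>, then \<open>Y\<close> moves with
  the Rankine-Hugoniot speed of the jump up to \<open>O(\<delta>\<^sup>2)\<close> (\<open>predicted_position\<close>). Differentiable
  parameters satisfy this by definition. At transversal ends it follows from the expansion itself,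
  which bounds \<open>Y - x\<^sup>*\<close> by \<open>O(\<delta>)\<close> (\<open>solutions_near_ends\<close>), and solutions exist by the
  intermediate value theorem in \<open>Y\<close>: moving \<open>Y\<close> across the predicted position changes the sign of
  the area (\<open>solution_exists\<close>).

  The true shock path has the same expansion, because the weak formulation, tested with functions
  that concentrate at the shock, forces the Rankine-Hugoniot speed
  (\<open>weak_solution_imp_rankine_hugoniot\<close>), and this speed changes at most linearly in time since
  the shock states inherit the Lipschitz bounds of the solution next to the shock
  (\<open>shock_path_expansion\<close>).

  The regularity used above has to be derived from the characteristic system. Its solutions depend
  on the parameter in a Lipschitz way, uniformly in time, and differentiably away from the
  breakpoints of the initial curve. Both follow from Gronwall's inequality, applied to differences
  of trajectories and to differences of difference quotients.
\<close>


section \<open>Continuously differentiable maps\<close>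

text \<open>
  Continuity of the derivative is required direction by direction, which matches the definition of
  \<open>Ck_on\<close>; in finite dimension it amounts to continuity in the operator norm.
\<close>

definition C1_on :: "'a set \<Rightarrow> ('a::real_normed_vector \<Rightarrow> 'b::real_normed_vector) \<Rightarrow> ('a \<Rightarrow> 'a \<Rightarrow> 'b) \<Rightarrow> bool"
  where "C1_on W \<Phi> \<Phi>' \<longleftrightarrow>
     (\<forall>p\<in>W. (\<Phi> has_derivative \<Phi>' p) (at p)) \<and> (\<forall>e. continuous_on W (\<lambda>p. \<Phi>' p e))"

lemma smooth_on_imp_C1_on:
  assumes "smooth_on S f"
  shows "C1_on S f (\<lambda>p. frechet_derivative f (at p))"
proof -
  have "Ck_on (Suc 0) S f"
    using assms unfolding smooth_on_def by blast
  then show ?thesis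
    by (auto simp: C1_on_def frechet_derivative_works)
qed

text \<open>
  Passes from iterated Frechet derivatives to \<open>deriv\<close>: the flux enters the characteristic system
  through \<open>deriv F\<close>, which coincides with the Frechet derivative in direction 1 only on \<open>U\<close>.
\<close>

lemma smooth_on_real_derivatives:
  fixes F :: "real \<Rightarrow> real"
  assumes "open U" "smooth_on U F"
  obtains F'' where "\<And>w. w \<in> U \<Longrightarrow> (F has_real_derivative deriv F w) (at w)"
    "\<And>w. w \<in> U \<Longrightarrow> (deriv F has_real_derivative F'' w) (at w)" "continuous_on U F''"
proof -
  define f where "f = (\<lambda>p. frechet_derivative F (at p) 1)"
  have "Ck_on (Suc (Suc 0)) U F"
    using assms unfolding smooth_on_def by blast
  then have F: "\<And>p. p \<in> U \<Longrightarrow> F differentiable (at p)"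
    and f: "\<And>p. p \<in> U \<Longrightarrow> f differentiable (at p)"
    and cont: "continuous_on U (\<lambda>p. frechet_derivative f (at p) 1)"
    by (auto simp: f_def)
  have dF: "(F has_real_derivative deriv F w) (at w)" if "w \<in> U" for w
    using F[OF that] DERIV_deriv_iff_real_differentiable by blast
  have f_eq: "f w = deriv F w" if "w \<in> U" for w
  proof -
    have "frechet_derivative F (at w) = (\<lambda>h. deriv F w * h)"
      using frechet_derivative_at[OF dF[OF that, unfolded has_field_derivative_def]] by simp
    then show ?thesis by (simp add: f_def)
  qed
  have df: "(deriv F has_real_derivative frechet_derivative f (at w) 1) (at w)" if w: "w \<in> U" for w
  proof -
    obtain d where d: "(f has_real_derivative d) (at w)"
      using f[OF w] real_differentiable_def by blast
    then have "frechet_derivative f (at w) = (\<lambda>h. d * h)"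
      using frechet_derivative_at[of f "(*) d" w] by (simp add: has_field_derivative_def)
    moreover have "(deriv F has_real_derivative d) (at w)"
      using DERIV_cong_ev[OF refl _ refl, of f "deriv F" w d] d
        eventually_nhds_in_open[OF \<open>open U\<close> w] f_eq
      by (smt (verit, best) eventually_mono)
    ultimately show ?thesis by simp
  qed
  show ?thesis
    by (rule that[OF dF df cont])
qed

lemma onorm_diff_le_sum_Basis:
  fixes f g :: "'a::euclidean_space \<Rightarrow> 'b::real_normed_vector"
  assumes "bounded_linear f" "bounded_linear g"
  shows "onorm (\<lambda>h. f h - g h) \<le> (\<Sum>e\<in>Basis. norm (f e - g e))"
proof (rule onorm_le)
  fix h :: 'a
  have lin: "linear (\<lambda>h. f h - g h)"
    using assms by (intro linear_compose_sub bounded_linear.linear)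
  have "f h - g h = (\<Sum>e\<in>Basis. (h \<bullet> e) *\<^sub>R (f e - g e))"
    using linear_sum[OF lin, of "\<lambda>e. (h \<bullet> e) *\<^sub>R e" Basis] linear_scale[OF lin]
    by (simp add: euclidean_representation)
  also have "norm \<dots> \<le> (\<Sum>e\<in>Basis. \<bar>h \<bullet> e\<bar> * norm (f e - g e))"
    by (rule order_trans[OF norm_sum]) simp
  also have "\<dots> \<le> (\<Sum>e\<in>Basis. norm h * norm (f e - g e))"
    by (intro sum_mono mult_right_mono) (auto simp: Basis_le_norm)
  finally show "norm (f h - g h) \<le> (\<Sum>e\<in>Basis. norm (f e - g e)) * norm h"
    by (simp add: sum_distrib_left mult.commute)
qed

lemma C1_on_derivative_bounded:
  fixes \<Phi> :: "'a::euclidean_space \<Rightarrow> 'b::real_normed_vector"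
  assumes "C1_on W \<Phi> \<Phi>'" "compact K" "K \<subseteq> W"
  obtains M where "M \<ge> 0" "\<And>k h. k \<in> K \<Longrightarrow> norm (\<Phi>' k h) \<le> M * norm h"
proof -
  have "\<exists>B. \<forall>k\<in>K. norm (\<Phi>' k e) \<le> B" for e
  proof -
    have "continuous_on K (\<lambda>p. \<Phi>' p e)"
      using assms continuous_on_subset unfolding C1_on_def by blast
    then have "bounded ((\<lambda>p. \<Phi>' p e) ` K)"
      using \<open>compact K\<close> compact_continuous_image compact_imp_bounded by blast
    then show ?thesis by (auto simp: bounded_iff)
  qed
  then obtain B where B: "\<And>e k. k \<in> K \<Longrightarrow> norm (\<Phi>' k e) \<le> B e" by metis
  have *: "norm (\<Phi>' k h) \<le> (\<Sum>e\<in>Basis. \<bar>B e\<bar>) * norm h" if "k \<in> K" for k h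
  proof -
    have bl: "bounded_linear (\<Phi>' k)"
      using assms that has_derivative_bounded_linear unfolding C1_on_def by blast
    have "norm (\<Phi>' k h) \<le> onorm (\<Phi>' k) * norm h"
      using onorm[OF bl] .
    also have "onorm (\<Phi>' k) \<le> (\<Sum>e\<in>Basis. norm (\<Phi>' k e))"
      using onorm_diff_le_sum_Basis[OF bl bounded_linear_zero] by simp
    also have "\<dots> \<le> (\<Sum>e\<in>Basis. \<bar>B e\<bar>)"
      using B[OF that] by (intro sum_mono) (meson abs_ge_self order_trans)
    finally show ?thesis by (simp add: mult_right_mono)
  qed
  show ?thesis
    by (rule that[OF _ *]) (auto intro: sum_nonneg)
qed

text \<open>
  The linear approximation of a \<open>C\<^sup>1\<close> map is uniform along a compact set, and also strict, that
  is, it compares two arbitrary nearby points. With a bound for the derivative this is a Lipschitz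
  estimate in a whole tube around a trajectory; with small \<open>\<epsilon>\<close> it linearises the flow there.
\<close>

lemma C1_on_uniform_strict_derivative:
  fixes \<Phi> :: "'a::euclidean_space \<Rightarrow> 'b::real_normed_vector"
  assumes C1: "C1_on W \<Phi> \<Phi>'" and "open W" and "compact K" "K \<subseteq> W" and "\<epsilon> > 0"
  obtains \<delta> where "\<delta> > 0" "\<And>k. k \<in> K \<Longrightarrow> cball k \<delta> \<subseteq> W"
    "\<And>k p q. k \<in> K \<Longrightarrow> p \<in> cball k \<delta> \<Longrightarrow> q \<in> cball k \<delta> \<Longrightarrow>
       norm (\<Phi> p - \<Phi> q - \<Phi>' k (p - q)) \<le> \<epsilon> * norm (p - q)"
proof -
  obtain r where "r > 0" and r: "(\<Union>x\<in>K. ball x r) \<subseteq> W"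
    using compact_subset_open_imp_ball_epsilon_subset assms by metis
  \<comment> \<open>a compact tube around \<open>K\<close>, on which the directional derivatives are uniformly continuous\<close>
  define K' where "K' = {x + y |x y. x \<in> K \<and> y \<in> cball 0 (r/2)}"
  have "compact K'"
    unfolding K'_def by (intro compact_sums \<open>compact K\<close> compact_cball)
  have inK': "p \<in> K'" if "k \<in> K" "p \<in> cball k (r/2)" for k p
    unfolding K'_def using that
    by (intro CollectI exI[of _ k] exI[of _ "p - k"]) (auto simp: dist_norm norm_minus_commute)
  have "K' \<subseteq> W"
    using r \<open>r > 0\<close> unfolding K'_def by (force simp: dist_norm)
  define \<eta> where "\<eta> = \<epsilon> / DIM('a)"
  have "\<eta> > 0" using \<open>\<epsilon> > 0\<close> by (simp add: \<eta>_def)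
  have "\<exists>d>0. \<forall>p\<in>K'. \<forall>q\<in>K'. dist q p < d \<longrightarrow> dist (\<Phi>' q e) (\<Phi>' p e) < \<eta>" for e
  proof -
    have "continuous_on K' (\<lambda>p. \<Phi>' p e)"
      using C1 \<open>K' \<subseteq> W\<close> continuous_on_subset unfolding C1_on_def by blast
    from compact_uniformly_continuous[OF this \<open>compact K'\<close>] show ?thesis
      using \<open>\<eta> > 0\<close> unfolding uniformly_continuous_on_def by blast
  qed
  then obtain d where d0: "\<And>e. d e > 0"
    and d: "\<And>e p q. p \<in> K' \<Longrightarrow> q \<in> K' \<Longrightarrow> dist q p < d e \<Longrightarrow> dist (\<Phi>' q e) (\<Phi>' p e) < \<eta>"
    by metis
  define \<delta> where "\<delta> = Min (insert r (d ` Basis)) / 2"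
  have \<delta>: "\<delta> > 0" "\<delta> \<le> r/2" "\<And>e. e \<in> Basis \<Longrightarrow> \<delta> < d e"
  proof -
    have "Min (insert r (d ` Basis)) > 0" using \<open>r > 0\<close> d0 by auto
    moreover have "Min (insert r (d ` Basis)) \<le> r" by simp
    moreover have "e \<in> Basis \<Longrightarrow> Min (insert r (d ` Basis)) \<le> d e" for e
      by (intro Min_le) auto
    ultimately show "\<delta> > 0" "\<delta> \<le> r/2" "\<And>e. e \<in> Basis \<Longrightarrow> \<delta> < d e"
      unfolding \<delta>_def by (auto, smt (verit) field_sum_of_halves)
  qed
  show ?thesis
  proof (rule that[OF \<open>\<delta> > 0\<close>])
    fix k assume "k \<in> K"
    show "cball k \<delta> \<subseteq> W"
      using inK'[OF \<open>k \<in> K\<close>] \<delta>(2) \<open>K' \<subseteq> W\<close> by (force simp: mem_cball)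
  next
    fix k p q assume k: "k \<in> K" and p: "p \<in> cball k \<delta>" and q: "q \<in> cball k \<delta>"
    have sub: "y \<in> K'" if "y \<in> cball k \<delta>" for y
      using inK'[OF k] \<delta>(2) that by (simp add: mem_cball)
    have kK': "k \<in> K'" using sub \<delta>(1) by simp
    have bl: "bounded_linear (\<Phi>' y)" if "y \<in> K'" for y
      using C1 \<open>K' \<subseteq> W\<close> that has_derivative_bounded_linear unfolding C1_on_def by blast
    have "norm (\<Phi> p - \<Phi> q - \<Phi>' k (p - q)) \<le> norm (p - q) * \<epsilon>"
    proof (rule differentiable_bound_linearization[where S = "cball k \<delta>" and f' = \<Phi>'])
      show "q + t *\<^sub>R (p - q) \<in> cball k \<delta>" if "t \<in> {0..1}" for t
      proof -
        have "(1 - t) *\<^sub>R q + t *\<^sub>R p \<in> cball k \<delta>"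
          using convexD_alt[OF convex_cball q p, of t] that by auto
        then show ?thesis by (simp add: algebra_simps)
      qed
      show "(\<Phi> has_derivative \<Phi>' y) (at y within cball k \<delta>)" if "y \<in> cball k \<delta>" for y
        using C1 sub[OF that] \<open>K' \<subseteq> W\<close> has_derivative_at_withinI unfolding C1_on_def by blast
      show "onorm (\<Phi>' y - \<Phi>' k) \<le> \<epsilon>" if "y \<in> cball k \<delta>" for y
      proof -
        have "onorm (\<Phi>' y - \<Phi>' k) \<le> (\<Sum>e\<in>Basis. norm (\<Phi>' y e - \<Phi>' k e))"
          unfolding fun_diff_def by (intro onorm_diff_le_sum_Basis bl sub that kK')
        also have "\<dots> \<le> (\<Sum>e\<in>(Basis::'a set). \<eta>)"
        proof (intro sum_mono)
          fix e :: 'a assume "e \<in> Basis"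
          then have "dist y k < d e"
            using that \<delta>(3)[of e] by (simp add: dist_commute)
          from d[OF kK' sub[OF that] this] show "norm (\<Phi>' y e - \<Phi>' k e) \<le> \<eta>"
            by (simp add: dist_norm)
        qed
        also have "\<dots> = \<epsilon>" by (simp add: \<eta>_def)
        finally show ?thesis .
      qed
      show "k \<in> cball k \<delta>" using \<delta>(1) by simp
    qed
    then show "norm (\<Phi> p - \<Phi> q - \<Phi>' k (p - q)) \<le> \<epsilon> * norm (p - q)"
      by (simp add: mult.commute)
  qed
qed

section \<open>Gronwall's inequality and Lipschitz bounds\<close>

text \<open>
  The squared norm is differentiable and satisfies the scalar inequality
  \<open>(|w|\<^sup>2)' \<le> (2 L + 1) |w|\<^sup>2 + \<epsilon>\<^sup>2\<close>, so the exponentially weighted quantity \<open>|w|\<^sup>2 + \<epsilon>\<^sup>2\<close> cannot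
  grow.
\<close>

lemma gronwall_norm_bound:
  fixes w :: "real \<Rightarrow> 'a::real_inner"
  assumes der: "\<And>\<tau>. \<tau> \<in> {0..T} \<Longrightarrow> (w has_vector_derivative w' \<tau>) (at \<tau> within {0..T})"
    and bound: "\<And>\<tau>. \<tau> \<in> {0..T} \<Longrightarrow> norm (w' \<tau>) \<le> L * norm (w \<tau>) + \<epsilon>"
    and "L \<ge> 0" "\<epsilon> \<ge> 0" "\<tau> \<in> {0..T}"
  shows "norm (w \<tau>) \<le> exp ((L + 1) * T) * (norm (w 0) + \<epsilon>)"
proof -
  define c where "c = 2 * L + 1"
  define \<phi> where "\<phi> = (\<lambda>\<tau>. exp (- c * \<tau>) * (w \<tau> \<bullet> w \<tau> + \<epsilon>\<^sup>2))"
  have "0 \<le> \<tau>" "\<tau> \<le> T" using assms by auto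
  have d\<phi>: "(\<phi> has_real_derivative
      exp (- c * \<sigma>) * (2 * (w \<sigma> \<bullet> w' \<sigma>)) - c * exp (- c * \<sigma>) * (w \<sigma> \<bullet> w \<sigma> + \<epsilon>\<^sup>2)) (at \<sigma> within {0..T})"
    if "\<sigma> \<in> {0..T}" for \<sigma>
  proof -
    have "((\<lambda>\<tau>. w \<tau> \<bullet> w \<tau>) has_real_derivative 2 * (w \<sigma> \<bullet> w' \<sigma>)) (at \<sigma> within {0..T})"
      using has_derivative_inner[OF der[OF that, unfolded has_vector_derivative_def] 
           der[OF that, unfolded has_vector_derivative_def]]
      unfolding has_field_derivative_def
      by (rule has_derivative_eq_rhs) (auto simp: fun_eq_iff inner_commute algebra_simps)
    then show ?thesis
      unfolding \<phi>_def by (auto intro!: derivative_eq_intros)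
  qed
  have "\<exists>\<sigma>\<in>{0..\<tau>}. \<phi> \<tau> - \<phi> 0 =
      (exp (- c * \<sigma>) * (2 * (w \<sigma> \<bullet> w' \<sigma>)) - c * exp (- c * \<sigma>) * (w \<sigma> \<bullet> w \<sigma> + \<epsilon>\<^sup>2)) * (\<tau> - 0)"
    using \<open>0 \<le> \<tau>\<close> \<open>\<tau> \<le> T\<close>
    by (intro mvt_very_simple has_derivative_subset[OF d\<phi>[unfolded has_field_derivative_def]]) auto
  then obtain \<sigma> where \<sigma>: "0 \<le> \<sigma>" "\<sigma> \<le> \<tau>" and eq: "\<phi> \<tau> - \<phi> 0 =
      exp (- c * \<sigma>) * (2 * (w \<sigma> \<bullet> w' \<sigma>) - c * (w \<sigma> \<bullet> w \<sigma> + \<epsilon>\<^sup>2)) * \<tau>"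
    by (auto simp: algebra_simps)
  have "2 * (w \<sigma> \<bullet> w' \<sigma>) \<le> 2 * (norm (w \<sigma>) * (L * norm (w \<sigma>) + \<epsilon>))"
    using norm_cauchy_schwarz[of "w \<sigma>" "w' \<sigma>"]
      mult_left_mono[OF bound[of \<sigma>] norm_ge_zero[of "w \<sigma>"]] \<sigma> \<open>\<tau> \<le> T\<close> by auto
  also have "\<dots> \<le> c * ((norm (w \<sigma>))\<^sup>2 + \<epsilon>\<^sup>2)"
    using sum_squares_bound[of "norm (w \<sigma>)" \<epsilon>] mult_nonneg_nonneg[OF \<open>L \<ge> 0\<close> zero_le_power2[of \<epsilon>]]
    unfolding c_def by (simp add: algebra_simps power2_eq_square)
  finally have "2 * (w \<sigma> \<bullet> w' \<sigma>) - c * (w \<sigma> \<bullet> w \<sigma> + \<epsilon>\<^sup>2) \<le> 0"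
    by (simp add: power2_norm_eq_inner)
  then have "\<phi> \<tau> \<le> \<phi> 0"
    using eq \<open>0 \<le> \<tau>\<close> by (smt (verit) exp_gt_zero mult_nonneg_nonneg mult_nonneg_nonpos mult_nonpos_nonneg)
  then have "exp (c * \<tau>) * \<phi> \<tau> \<le> exp (c * \<tau>) * \<phi> 0"
    by simp
  moreover have "exp (c * \<tau>) * \<phi> \<tau> = (norm (w \<tau>))\<^sup>2 + \<epsilon>\<^sup>2"
    by (simp add: \<phi>_def power2_norm_eq_inner mult.assoc[symmetric] del: mult_eq_0_iff flip: exp_add)
  moreover have "\<phi> 0 = (norm (w 0))\<^sup>2 + \<epsilon>\<^sup>2"
    by (simp add: \<phi>_def power2_norm_eq_inner)
  ultimately have "(norm (w \<tau>))\<^sup>2 + \<epsilon>\<^sup>2 \<le> exp (c * \<tau>) * ((norm (w 0))\<^sup>2 + \<epsilon>\<^sup>2)"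
    by metis
  also have "\<dots> \<le> exp (c * \<tau>) * (norm (w 0) + \<epsilon>)\<^sup>2"
    using \<open>\<epsilon> \<ge> 0\<close> by (intro mult_left_mono) (auto simp: power2_sum)
  also have "\<dots> \<le> exp (2 * ((L + 1) * T)) * (norm (w 0) + \<epsilon>)\<^sup>2"
  proof (intro mult_right_mono)
    have "c * \<tau> \<le> (2 * (L + 1)) * T"
      using \<open>L \<ge> 0\<close> \<open>0 \<le> \<tau>\<close> \<open>\<tau> \<le> T\<close> unfolding c_def by (intro mult_mono) auto
    then show "exp (c * \<tau>) \<le> exp (2 * ((L + 1) * T))" by (simp only: exp_le_cancel_iff mult.assoc)
  qed simp
  also have "\<dots> = (exp ((L + 1) * T) * (norm (w 0) + \<epsilon>))\<^sup>2"
    by (simp add: power_mult_distrib exp_double)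
  finally have "(norm (w \<tau>))\<^sup>2 \<le> (exp ((L + 1) * T) * (norm (w 0) + \<epsilon>))\<^sup>2"
    by (smt (verit) zero_le_power2)
  then show ?thesis
    by (rule power2_le_imp_le) (use \<open>\<epsilon> \<ge> 0\<close> in simp)
qed

lemma has_vector_derivative_iff_quotient:
  "(f has_vector_derivative D) (at a) \<longleftrightarrow> ((\<lambda>h. (1/h) *\<^sub>R (f (a + h) - f a)) \<longlongrightarrow> D) (at 0)"
proof -
  have "(f has_vector_derivative D) (at a) \<longleftrightarrow>
      ((\<lambda>h. norm (f (a + h) - f a - h *\<^sub>R D) / norm h) \<longlongrightarrow> 0) (at 0)"
    by (simp add: has_vector_derivative_def has_derivative_at bounded_linear_scaleR_left)
  also have "\<dots> \<longleftrightarrow> ((\<lambda>h. norm ((1/h) *\<^sub>R (f (a + h) - f a) - D)) \<longlongrightarrow> 0) (at 0)"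
  proof (rule filterlim_cong[OF refl refl])
    have "norm (f (a + h) - f a - h *\<^sub>R D) / norm h = norm ((1/h) *\<^sub>R (f (a + h) - f a) - D)"
      if "h \<noteq> 0" for h
    proof -
      have "(1/h) *\<^sub>R (f (a + h) - f a) - D = (1/h) *\<^sub>R (f (a + h) - f a - h *\<^sub>R D)"
        using that by (simp add: scaleR_diff_right)
      then show ?thesis by simp
    qed
    then show "\<forall>\<^sub>F h in at 0. norm (f (a + h) - f a - h *\<^sub>R D) / norm h
        = norm ((1/h) *\<^sub>R (f (a + h) - f a) - D)"
      by (simp add: eventually_at_filter)
  qed
  also have "\<dots> \<longleftrightarrow> ((\<lambda>h. (1/h) *\<^sub>R (f (a + h) - f a)) \<longlongrightarrow> D) (at 0)"
    by (simp add: tendsto_norm_zero_iff LIM_zero_iff)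
  finally show ?thesis .
qed

text \<open>
  Bisection: Lipschitz functions on two adjacent intervals can be glued with the larger of the two
  constants. The whole family \<open>f i\<close> is treated at once to obtain a constant that does not depend
  on \<open>i\<close>.
\<close>

lemma locally_imp_uniformly_lipschitz_on:
  fixes f :: "'i \<Rightarrow> real \<Rightarrow> 'b::metric_space"
  assumes "a \<le> b"
    and local: "\<And>x. x \<in> {a..b} \<Longrightarrow>
      \<exists>r>0. \<exists>K. \<forall>i\<in>I. K-lipschitz_on ({x - r..x + r} \<inter> {a..b}) (f i)"
  obtains K where "\<And>i. i \<in> I \<Longrightarrow> K-lipschitz_on {a..b} (f i)"
proof -
  define P where "P = (\<lambda>c d. \<exists>K. \<forall>i\<in>I. K-lipschitz_on ({c..d} \<inter> {a..b}) (f i))"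
  have "P a b"
  proof (rule Bolzano[OF \<open>a \<le> b\<close>])
    fix c d e assume "P c d" "P d e" and cde: "c \<le> d" "d \<le> e"
    then obtain K1 K2 where K: "\<And>i. i \<in> I \<Longrightarrow> K1-lipschitz_on ({c..d} \<inter> {a..b}) (f i)"
        "\<And>i. i \<in> I \<Longrightarrow> K2-lipschitz_on ({d..e} \<inter> {a..b}) (f i)"
      unfolding P_def by metis
    have "(max K1 K2)-lipschitz_on ({c..e} \<inter> {a..b}) (f i)" if "i \<in> I" for i
    proof (cases "d < a \<or> b < d")
      case True
      then have "{c..e} \<inter> {a..b} = {c..d} \<inter> {a..b} \<or> {c..e} \<inter> {a..b} = {d..e} \<inter> {a..b}"
        using cde by auto
      then show ?thesis using lipschitz_on_le[OF K(1)[OF that]] lipschitz_on_le[OF K(2)[OF that]] by auto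
    next
      case False
      then have "(max K1 K2)-lipschitz_on {max c a..min e b} (\<lambda>x. if x \<le> d then f i x else f i x)"
        using cde K[OF that] by (intro lipschitz_on_concat_max) (auto simp: Int_atLeastAtMost)
      then show ?thesis by (simp add: Int_atLeastAtMost)
    qed
    then show "P c e" unfolding P_def by blast
  next
    fix x assume "a \<le> x" "x \<le> b"
    then obtain r K where "r > 0" and K: "\<And>i. i \<in> I \<Longrightarrow> K-lipschitz_on ({x - r..x + r} \<inter> {a..b}) (f i)"
      using local[of x] by auto
    have "P c d" if "c \<le> x \<and> x \<le> d \<and> d - c < r" for c d
      unfolding P_def using that by (intro exI[of _ K] ballI lipschitz_on_subset[OF K]) auto
    then show "\<exists>r>0. \<forall>c d. c \<le> x \<and> x \<le> d \<and> d - c < r \<longrightarrow> P c d"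
      using \<open>r > 0\<close> by blast
  qed
  then show ?thesis using that unfolding P_def by auto
qed

section \<open>Piecewise smooth functions\<close>

lemma smooth_on_imp_lipschitz_on_interval:
  assumes "smooth_on UNIV h"
  obtains K where "K-lipschitz_on {a..b} (h :: real \<Rightarrow> real)"
proof -
  obtain h'' where h: "\<And>w. (h has_real_derivative deriv h w) (at w)"
      "\<And>w. (deriv h has_real_derivative h'' w) (at w)"
    using smooth_on_real_derivatives[OF open_UNIV assms] by (metis UNIV_I)
  have "continuous_on {a..b} (deriv h)"
    using h(2) DERIV_isCont continuous_at_imp_continuous_on by blast
  then have "bounded (deriv h ` {a..b})"
    by (intro compact_imp_bounded compact_continuous_image) auto
  then obtain K where "K > 0" and K: "\<And>w. w \<in> {a..b} \<Longrightarrow> \<bar>deriv h w\<bar> \<le> K"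
    by (auto simp: bounded_pos)
  have "K-lipschitz_on {a..b} h"
    using \<open>K > 0\<close> field_differentiable_bound[of "{a..b}" h "deriv h" K] h(1) K
    by (intro lipschitz_onI) (auto simp: dist_norm intro: has_field_derivative_at_within)
  then show ?thesis using that by blast
qed

lemma locally_finite_avoid:
  fixes P :: "real set"
  assumes "\<And>a b. finite (P \<inter> {a..b})"
  obtains d where "d > 0" "{x - d<..<x} \<inter> P = {}" "{x<..<x + d} \<inter> P = {}"
proof -
  obtain d where "d > 0" and d: "\<forall>y\<in>P \<inter> {x - 1..x + 1}. y \<noteq> x \<longrightarrow> d \<le> dist x y"
    using finite_set_avoid[OF assms] by metis
  then show ?thesis
    using that[of "min d 1"] by (force simp: dist_real_def)
qed

lemma piecewise_smoothE:
  assumes "piecewise_smooth f"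
  obtains P where "\<And>a b. finite (P \<inter> {a..b})"
    "\<And>a b. a < b \<Longrightarrow> {a<..<b} \<inter> P = {} \<Longrightarrow> (\<exists>h. smooth_on UNIV h \<and> (\<forall>y\<in>{a<..<b}. f y = h y))"
proof -
  obtain P where P: "(\<forall>a b. finite (P \<inter> {a..b})) \<and>
      (\<forall>a b. a < b \<and> {a<..<b} \<inter> P = {} \<longrightarrow> (\<exists>h. smooth_on UNIV h \<and> (\<forall>y\<in>{a<..<b}. f y = h y)))"
    using assms unfolding piecewise_smooth_def by (rule exE)
  show ?thesis
    by (rule that[of P, OF P[THEN conjunct1, rule_format] P[THEN conjunct2, rule_format]]) auto
qed

text \<open>
  Near each point there is at most one breakpoint. Each of the two adjacent pieces is Lipschitz
  because it extends smoothly to its end point, and continuity glues them at the breakpoint.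
\<close>

lemma piecewise_smooth_imp_lipschitz_on:
  assumes f: "piecewise_smooth f" and cont: "continuous_on UNIV f" and "a \<le> b"
  obtains K where "K-lipschitz_on {a..b} f"
proof -
  obtain P where fin: "\<And>a b. finite (P \<inter> {a..b})" and piece: "\<And>a b. a < b \<Longrightarrow> {a<..<b} \<inter> P = {} \<Longrightarrow>
      (\<exists>h. smooth_on UNIV h \<and> (\<forall>y\<in>{a<..<b}. f y = h y))"
    by (rule piecewise_smoothE[OF f]) (rule that, assumption+)
  have closed_piece: "\<exists>K. K-lipschitz_on {c..d} f" if cd: "c < d" "{c<..<d} \<inter> P = {}" for c d
  proof -
    obtain h where "smooth_on UNIV h" and eq: "\<And>y. y \<in> {c<..<d} \<Longrightarrow> f y = h y"
      using piece[OF cd] by blast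
    then obtain K where "K-lipschitz_on {c..d} h"
      using smooth_on_imp_lipschitz_on_interval by blast
    then have "K-lipschitz_on {c<..<d} h"
      by (rule lipschitz_on_subset) auto
    then have "K-lipschitz_on {c<..<d} f"
      using lipschitz_on_transform[of K "{c<..<d}" h f] eq by simp
    then have "K-lipschitz_on (closure {c<..<d}) f"
      by (rule lipschitz_on_closure) (rule continuous_on_subset[OF cont], simp)
    then show ?thesis using cd by auto
  qed
  have "\<exists>r>0. \<exists>K. \<forall>i\<in>{()}. K-lipschitz_on ({x - r..x + r} \<inter> {a..b}) f" if x: "x \<in> {a..b}" for x
  proof -
    obtain d where "d > 0" "{x - d<..<x} \<inter> P = {}" "{x<..<x + d} \<inter> P = {}"
      using locally_finite_avoid[OF fin] by metis
    then obtain K1 K2 where "K1-lipschitz_on {x - d..x} f" "K2-lipschitz_on {x..x + d} f"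
      using closed_piece[of "x - d" x] closed_piece[of x "x + d"] by auto
    then have "(max K1 K2)-lipschitz_on {x - d..x + d} (\<lambda>y. if y \<le> x then f y else f y)"
      by (intro lipschitz_on_concat_max) auto
    then have "(max K1 K2)-lipschitz_on {x - d..x + d} f" by simp
    then have "(max K1 K2)-lipschitz_on ({x - d..x + d} \<inter> {a..b}) f"
      by (rule lipschitz_on_subset) auto
    then show ?thesis using \<open>d > 0\<close> by blast
  qed
  from locally_imp_uniformly_lipschitz_on[OF \<open>a \<le> b\<close> this] show ?thesis
    using that by blast
qed

lemma piecewise_smooth_imp_differentiable:
  assumes "piecewise_smooth f"
  obtains P where "\<And>a b. finite (P \<inter> {a..b})" "\<And>s. s \<notin> P \<Longrightarrow> f differentiable (at s)"
proof -
  obtain P where fin: "\<And>a b. finite (P \<inter> {a..b})" and piece: "\<And>a b. a < b \<Longrightarrow> {a<..<b} \<inter> P = {} \<Longrightarrow>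
      (\<exists>h. smooth_on UNIV h \<and> (\<forall>y\<in>{a<..<b}. f y = h y))"
    by (rule piecewise_smoothE[OF assms]) (rule that, assumption+)
  have "f differentiable (at s)" if "s \<notin> P" for s
  proof -
    obtain d where "d > 0" and d: "{s - d<..<s} \<inter> P = {}" "{s<..<s + d} \<inter> P = {}"
      using locally_finite_avoid[OF fin] by metis
    have "{s - d<..<s + d} \<inter> P = {}"
    proof (rule ccontr)
      assume "{s - d<..<s + d} \<inter> P \<noteq> {}"
      then obtain y where "y \<in> P" "s - d < y" "y < s + d" by auto
      then show False using d that by (cases y s rule: linorder_cases) auto
    qed
    then obtain h where h: "smooth_on UNIV h" and eq: "\<And>y. y \<in> {s - d<..<s + d} \<Longrightarrow> f y = h y"
      using piece[of "s - d" "s + d"] \<open>d > 0\<close> by auto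
    have "(h has_real_derivative deriv h s) (at s)"
      using smooth_on_real_derivatives[OF open_UNIV h] by (metis UNIV_I)
    moreover have "\<forall>\<^sub>F y in nhds s. h y = f y"
      using eventually_nhds_in_open[of "{s - d<..<s + d}" s] \<open>d > 0\<close> eq
      by (auto elim!: eventually_mono)
    ultimately have "(f has_real_derivative deriv h s) (at s)"
      using DERIV_cong_ev[OF refl _ refl] by blast
    then show ?thesis using real_differentiable_def by blast
  qed
  then show ?thesis using that fin by blast
qed

section \<open>Dependence of a flow on its initial values\<close>

lemma vector_derivative_bound:
  fixes f :: "real \<Rightarrow> 'a::real_normed_vector"
  assumes "a \<le> b"
    and der: "\<And>x. x \<in> {a..b} \<Longrightarrow> (f has_vector_derivative f' x) (at x within {a..b})"
    and bound: "\<And>x. x \<in> {a..b} \<Longrightarrow> norm (f' x) \<le> C"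
  shows "norm (f b - f a) \<le> C * (b - a)"
proof -
  have "norm (f b - f a) \<le> C * norm (b - a)"
  proof (rule differentiable_bound[of "{a..b}", OF _ der[unfolded has_vector_derivative_def]])
    fix x assume "x \<in> {a..b}"
    then show "onorm (\<lambda>h. h *\<^sub>R f' x) \<le> C"
      using bound by (intro onorm_le) (simp add: mult.commute[of "\<bar>_\<bar>"] mult_right_mono)
  qed (use \<open>a \<le> b\<close> in auto)
  then show ?thesis using \<open>a \<le> b\<close> by simp
qed

text \<open>
  An autonomous system whose trajectories are parametrised by \<open>s\<close> and live at least up to time
  \<open>T\<close>. Time-dependent systems are covered by including time in the state.
\<close>

locale C1_flow =
  fixes W :: "'a::euclidean_space set" and \<Phi> \<Phi>' and z :: "real \<Rightarrow> real \<Rightarrow> 'a" and T :: real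
  assumes W: "open W" and C1: "C1_on W \<Phi> \<Phi>'" and T: "T \<ge> 0"
    and z_in: "\<And>s \<tau>. \<tau> \<in> {0..T} \<Longrightarrow> z s \<tau> \<in> W"
    and z_der: "\<And>s \<tau>. \<tau> \<in> {0..T} \<Longrightarrow> (z s has_vector_derivative \<Phi> (z s \<tau>)) (at \<tau> within {0..T})"
begin

lemma \<Phi>_der: "p \<in> W \<Longrightarrow> (\<Phi> has_derivative \<Phi>' p) (at p)"
  using C1 unfolding C1_on_def by blast

lemma z_cont: "continuous_on {0..T} (z s)"
  using z_der by (meson continuous_on_eq_continuous_within has_vector_derivative_continuous)

lemma compact_trajectory: "compact (z s ` {0..T})"
  by (intro compact_continuous_image z_cont) simp

lemma trajectory_subset: "z s ` {0..T} \<subseteq> W"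
  using z_in by auto

text \<open>
  In a tube of radius \<open>\<delta>\<close> around the trajectory of \<open>s0\<close> the vector field is Lipschitz, so inside
  the tube Gronwall's inequality bounds the growth of differences by a factor \<open>E\<close>. Trajectories
  that start closer than \<open>\<delta> / E\<close> therefore never reach the boundary of the tube.
\<close>

lemma trajectories_stay_close:
  obtains \<rho> K where "\<rho> > 0" "K \<ge> 1" 
    "\<And>s s' \<tau>. \<lbrakk>z s 0 \<in> ball (z s0 0) \<rho>; z s' 0 \<in> ball (z s0 0) \<rho>; \<tau> \<in> {0..T}\<rbrakk> \<Longrightarrow>
      norm (z s \<tau> - z s' \<tau>) \<le> K * norm (z s 0 - z s' 0) \<and>
      norm (\<Phi> (z s \<tau>) - \<Phi> (z s' \<tau>)) \<le> K * norm (z s 0 - z s' 0)"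
proof -
  obtain \<delta> where "\<delta> > 0" and strict: "\<And>k p q. k \<in> z s0 ` {0..T} \<Longrightarrow> p \<in> cball k \<delta> \<Longrightarrow> q \<in> cball k \<delta> \<Longrightarrow>
       norm (\<Phi> p - \<Phi> q - \<Phi>' k (p - q)) \<le> 1 * norm (p - q)"
    using C1_on_uniform_strict_derivative[OF C1 W compact_trajectory trajectory_subset zero_less_one] by metis
  obtain M where "M \<ge> 0" and M: "\<And>k h. k \<in> z s0 ` {0..T} \<Longrightarrow> norm (\<Phi>' k h) \<le> M * norm h"
    using C1_on_derivative_bounded[OF C1 compact_trajectory trajectory_subset] by metis
  define L where "L = M + 1"
  have "L \<ge> 0" using \<open>M \<ge> 0\<close> by (simp add: L_def)
  have lip: "norm (\<Phi> p - \<Phi> q) \<le> L * norm (p - q)"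
    if "\<tau> \<in> {0..T}" "p \<in> cball (z s0 \<tau>) \<delta>" "q \<in> cball (z s0 \<tau>) \<delta>" for p q \<tau>
    using strict[of "z s0 \<tau>" p q] M[of "z s0 \<tau>" "p - q"] that
      norm_triangle_sub[of "\<Phi> p - \<Phi> q" "\<Phi>' (z s0 \<tau>) (p - q)"]
    by (auto simp: L_def algebra_simps)
  define E where "E = exp ((L + 1) * T)"
  have "E \<ge> 1" using \<open>L \<ge> 0\<close> T by (simp add: E_def)
  define \<rho> where "\<rho> = \<delta> / E"
  have "\<rho> > 0" using \<open>\<delta> > 0\<close> \<open>E \<ge> 1\<close> by (simp add: \<rho>_def)
  have diff_der: "((\<lambda>\<tau>. z s \<tau> - z s' \<tau>) has_vector_derivative \<Phi> (z s \<tau>) - \<Phi> (z s' \<tau>)) (at \<tau> within {0..b})"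
    if "\<tau> \<in> {0..b}" "b \<le> T" for s s' \<tau> b
    by (rule has_vector_derivative_within_subset[OF has_vector_derivative_diff[OF z_der z_der]]) (use that in auto)
  have growth: "norm (z s b - z s' b) \<le> E * norm (z s 0 - z s' 0)"
    if "0 \<le> b" "b \<le> T" "\<And>\<tau>. \<tau> \<in> {0..b} \<Longrightarrow> z s \<tau> \<in> cball (z s0 \<tau>) \<delta>"
      "\<And>\<tau>. \<tau> \<in> {0..b} \<Longrightarrow> z s' \<tau> \<in> cball (z s0 \<tau>) \<delta>" for s s' b
  proof -
    have "norm (z s b - z s' b) \<le> exp ((L + 1) * b) * (norm (z s 0 - z s' 0) + 0)"
      by (rule gronwall_norm_bound[OF diff_der])
        (use that lip[OF _ that(3,4)] \<open>L \<ge> 0\<close> in auto)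
    also have "\<dots> \<le> E * (norm (z s 0 - z s' 0) + 0)"
      unfolding E_def using that \<open>L \<ge> 0\<close> by (intro mult_right_mono) (auto intro: mult_left_mono)
    finally show ?thesis by simp
  qed
  have tube: "z s \<tau> \<in> cball (z s0 \<tau>) \<delta>" if near: "z s 0 \<in> ball (z s0 0) \<rho>" and "\<tau> \<in> {0..T}" for s \<tau>
  proof (rule ccontr)
    assume out: "z s \<tau> \<notin> cball (z s0 \<tau>) \<delta>"
    define d where "d = (\<lambda>\<tau>. norm (z s \<tau> - z s0 \<tau>))"
    have d_cont: "continuous_on {0..\<tau>} d"
      unfolding d_def using that by (intro continuous_intros continuous_on_subset[OF z_cont]) auto
    have "E * d 0 < \<delta>"
      using near \<open>E \<ge> 1\<close> by (auto simp: d_def \<rho>_def dist_norm norm_minus_commute field_simps)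
    define B where "B = {\<sigma>\<in>{0..\<tau>}. d \<sigma> \<ge> \<delta>}"
    have "closed B"
      unfolding B_def using continuous_closed_preimage[OF d_cont closed_atLeastAtMost, of "{\<delta>..}"]
      by (simp add: vimage_def Int_def)
    moreover have "\<tau> \<in> B" using out that by (auto simp: B_def d_def dist_norm norm_minus_commute)
    moreover have "bdd_below B" by (auto simp: B_def bdd_below_def)
    ultimately have "Inf B \<in> B" by (intro closed_contains_Inf) auto
    \<comment> \<open>the first time at which the distance \<open>\<delta>\<close> is reached\<close>
    define b where "b = Inf B"
    have b: "0 \<le> b" "b \<le> T" "d b \<ge> \<delta>"
      using \<open>Inf B \<in> B\<close> that by (auto simp: b_def B_def)
    have below: "d \<sigma> < \<delta>" if "0 \<le> \<sigma>" "\<sigma> < b" for \<sigma>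
    proof (rule ccontr)
      assume "\<not> d \<sigma> < \<delta>"
      then have "\<sigma> \<in> B" using that \<open>Inf B \<in> B\<close> by (auto simp: B_def b_def)
      then have "b \<le> \<sigma>" unfolding b_def by (intro cInf_lower \<open>bdd_below B\<close>)
      then show False using that by simp
    qed
    have "b \<noteq> 0"
    proof
      assume "b = 0"
      have "1 * d 0 \<le> E * d 0" using \<open>E \<ge> 1\<close> by (intro mult_right_mono) (auto simp: d_def)
      then show False using \<open>b = 0\<close> b(3) \<open>E * d 0 < \<delta>\<close> by simp
    qed
    have "d b \<le> \<delta>"
    proof -
      have "\<exists>c\<in>{0..b}. d c = \<delta>"
        using IVT'[of d 0 \<delta> b] b continuous_on_subset[OF d_cont, of "{0..b}"] below[of 0] \<open>b \<noteq> 0\<close> \<open>Inf B \<in> B\<close>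
        by (auto simp: b_def B_def)
      then show ?thesis using below by force
    qed
    then have "d \<sigma> \<le> \<delta>" if "\<sigma> \<in> {0..b}" for \<sigma>
      using below[of \<sigma>] that by (cases "\<sigma> = b") auto
    then have "d b \<le> E * d 0"
      unfolding d_def using b \<open>\<delta> > 0\<close>
      by (intro growth) (auto simp: dist_norm norm_minus_commute)
    then show False using b(3) \<open>E * d 0 < \<delta>\<close> by simp
  qed
  have fin: "norm (z s \<tau> - z s' \<tau>) \<le> (max 1 L * E) * norm (z s 0 - z s' 0) \<and>
      norm (\<Phi> (z s \<tau>) - \<Phi> (z s' \<tau>)) \<le> (max 1 L * E) * norm (z s 0 - z s' 0)"
    if "z s 0 \<in> ball (z s0 0) \<rho>" "z s' 0 \<in> ball (z s0 0) \<rho>" "\<tau> \<in> {0..T}" for s s' \<tau>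
  proof
    have *: "norm (z s \<tau> - z s' \<tau>) \<le> E * norm (z s 0 - z s' 0)"
      by (rule growth) (use that tube in auto)
    also have "\<dots> \<le> (max 1 L * E) * norm (z s 0 - z s' 0)"
      using \<open>E \<ge> 1\<close> by (intro mult_right_mono) auto
    finally show "norm (z s \<tau> - z s' \<tau>) \<le> (max 1 L * E) * norm (z s 0 - z s' 0)" .
    have "norm (\<Phi> (z s \<tau>) - \<Phi> (z s' \<tau>)) \<le> L * norm (z s \<tau> - z s' \<tau>)"
      by (rule lip[OF that(3)]) (use that tube in auto)
    also have "\<dots> \<le> max 1 L * (E * norm (z s 0 - z s' 0))"
      using * by (intro mult_mono) auto
    finally show "norm (\<Phi> (z s \<tau>) - \<Phi> (z s' \<tau>)) \<le> (max 1 L * E) * norm (z s 0 - z s' 0)"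
      by (simp add: mult.assoc)
  qed
  have "max 1 L * E \<ge> 1 * 1" using \<open>E \<ge> 1\<close> by (intro mult_mono) auto
  then show ?thesis using that[OF \<open>\<rho> > 0\<close> _ fin] by simp
qed

text \<open>
  The difference quotients in \<open>s\<close> solve the linearised equation up to a small error. Two of them
  differ at time 0 by little, so Gronwall's inequality makes them a Cauchy family. The derivative
  is then obtained by completeness.
\<close>

lemma flow_differentiable:
  assumes d0: "(\<lambda>s. z s 0) differentiable (at s0)" and "\<tau> \<in> {0..T}"
  shows "(\<lambda>s. z s \<tau>) differentiable (at s0)"
proof -
  obtain z0' where z0': "((\<lambda>s. z s 0) has_vector_derivative z0') (at s0)"
    using d0 vector_derivative_works by blast
  define \<Delta> where "\<Delta> = (\<lambda>h \<tau>. (1/h) *\<^sub>R (z (s0 + h) \<tau> - z s0 \<tau>))"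
  have \<Delta>0: "((\<lambda>h. \<Delta> h 0) \<longlongrightarrow> z0') (at 0)"
    using z0' unfolding \<Delta>_def has_vector_derivative_iff_quotient .
  obtain \<rho> K where "\<rho> > 0" "K \<ge> 1" and
    close: "\<And>s s' \<tau>. \<lbrakk>z s 0 \<in> ball (z s0 0) \<rho>; z s' 0 \<in> ball (z s0 0) \<rho>; \<tau> \<in> {0..T}\<rbrakk> \<Longrightarrow>
      norm (z s \<tau> - z s' \<tau>) \<le> K * norm (z s 0 - z s' 0) \<and>
      norm (\<Phi> (z s \<tau>) - \<Phi> (z s' \<tau>)) \<le> K * norm (z s 0 - z s' 0)"
    using trajectories_stay_close[of s0] by metis
  obtain M where "M \<ge> 0" and M: "\<And>k h. k \<in> z s0 ` {0..T} \<Longrightarrow> norm (\<Phi>' k h) \<le> M * norm h"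
    using C1_on_derivative_bounded[OF C1 compact_trajectory trajectory_subset] by metis
  define B where "B = K * (norm z0' + 1)"
  have "B > 0" using \<open>K \<ge> 1\<close> by (auto simp: B_def intro!: mult_pos_pos add_nonneg_pos)
  have init_cont: "((\<lambda>h. z (s0 + h) 0) \<longlongrightarrow> z s0 0) (at 0)"
    using has_vector_derivative_continuous[OF z0'] by (auto simp: continuous_at dest: LIM_offset_zero)
  have linearised: "\<forall>\<^sub>F h in at 0. \<forall>\<tau>\<in>{0..T}.
      norm ((1/h) *\<^sub>R (\<Phi> (z (s0 + h) \<tau>) - \<Phi> (z s0 \<tau>)) - \<Phi>' (z s0 \<tau>) (\<Delta> h \<tau>)) \<le> \<epsilon>" if "\<epsilon> > 0" for \<epsilon>
  proof -
    have "\<epsilon> / B > 0" using \<open>B > 0\<close> that by simp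
    then obtain \<delta> where "\<delta> > 0" and strict: "\<And>k p q. k \<in> z s0 ` {0..T} \<Longrightarrow> p \<in> cball k \<delta> \<Longrightarrow> q \<in> cball k \<delta> \<Longrightarrow>
       norm (\<Phi> p - \<Phi> q - \<Phi>' k (p - q)) \<le> \<epsilon> / B * norm (p - q)"
      using C1_on_uniform_strict_derivative[OF C1 W compact_trajectory trajectory_subset] by metis
    have "\<forall>\<^sub>F h in at 0. dist (z (s0 + h) 0) (z s0 0) < min \<rho> (\<delta> / K)"
      using init_cont \<open>\<rho> > 0\<close> \<open>\<delta> > 0\<close> \<open>K \<ge> 1\<close> by (intro tendstoD) auto
    moreover have "\<forall>\<^sub>F h in at 0. dist (\<Delta> h 0) z0' < 1"
      using \<Delta>0 by (intro tendstoD) auto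
    moreover have "\<forall>\<^sub>F h in at (0::real). h \<noteq> 0"
      by (simp add: eventually_at_filter)
    ultimately show ?thesis
    proof eventually_elim
      case (elim h)
      show ?case
      proof
        fix \<tau> assume \<tau>: "\<tau> \<in> {0..T}"
        let ?d = "z (s0 + h) \<tau> - z s0 \<tau>"
        have "norm ?d \<le> K * norm (z (s0 + h) 0 - z s0 0)"
          using close[of "s0 + h" s0 \<tau>] elim \<tau> \<open>\<rho> > 0\<close> by (simp add: dist_commute)
        moreover have "K * norm (z (s0 + h) 0 - z s0 0) \<le> \<delta>"
          using elim \<open>K \<ge> 1\<close> by (simp add: dist_norm field_simps)
        moreover have "norm (z (s0 + h) 0 - z s0 0) \<le> (norm z0' + 1) * \<bar>h\<bar>"
        proof -
          have "norm (\<Delta> h 0) \<le> norm z0' + 1"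
            using elim norm_triangle_ineq2[of "\<Delta> h 0" z0'] by (simp add: dist_norm)
          moreover have "norm (\<Delta> h 0) = norm (z (s0 + h) 0 - z s0 0) / \<bar>h\<bar>"
            by (simp add: \<Delta>_def)
          ultimately show ?thesis using elim by (simp add: pos_divide_le_eq)
        qed
        ultimately have d: "norm ?d \<le> B * \<bar>h\<bar>" "norm ?d \<le> \<delta>"
          using \<open>K \<ge> 1\<close> unfolding B_def
          by (auto simp: mult.assoc intro: order_trans mult_left_mono)
        have lin: "linear (\<Phi>' (z s0 \<tau>))"
          using C1 z_in[OF \<tau>] has_derivative_linear unfolding C1_on_def by blast
        have "(1/h) *\<^sub>R (\<Phi> (z (s0 + h) \<tau>) - \<Phi> (z s0 \<tau>)) - \<Phi>' (z s0 \<tau>) (\<Delta> h \<tau>)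
          = (1/h) *\<^sub>R (\<Phi> (z (s0 + h) \<tau>) - \<Phi> (z s0 \<tau>) - \<Phi>' (z s0 \<tau>) ?d)"
          unfolding \<Delta>_def linear_scale[OF lin] by (simp only: scaleR_diff_right)
        also have "norm \<dots> = (1 / \<bar>h\<bar>) * norm (\<Phi> (z (s0 + h) \<tau>) - \<Phi> (z s0 \<tau>) - \<Phi>' (z s0 \<tau>) ?d)"
          by simp
        also have "\<dots> \<le> (1 / \<bar>h\<bar>) * (\<epsilon> / B * norm ?d)"
          using strict[of "z s0 \<tau>" "z (s0 + h) \<tau>" "z s0 \<tau>"] \<tau> d(2) \<open>\<delta> > 0\<close>
          by (intro mult_left_mono) (auto simp: dist_norm norm_minus_commute)
        also have "\<dots> \<le> (1 / \<bar>h\<bar>) * (\<epsilon> / B * (B * \<bar>h\<bar>))"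
          using d \<open>B > 0\<close> that by (intro mult_left_mono) auto
        also have "\<dots> = \<epsilon>" using elim \<open>B > 0\<close> by simp
        finally show "norm ((1/h) *\<^sub>R (\<Phi> (z (s0 + h) \<tau>) - \<Phi> (z s0 \<tau>)) - \<Phi>' (z s0 \<tau>) (\<Delta> h \<tau>)) \<le> \<epsilon>" .
      qed
    qed
  qed
  define E where "E = exp ((M + 1) * T)"
  have "E > 0" by (simp add: E_def)
  have "cauchy_filter (filtermap (\<lambda>h. \<Delta> h \<tau>) (at 0))"
    unfolding cauchy_filter_metric_filtermap
  proof (intro allI impI)
    fix e :: real assume "e > 0"
    define \<epsilon> where "\<epsilon> = e / (5 * E)"
    have "\<epsilon> > 0" using \<open>e > 0\<close> \<open>E > 0\<close> by (simp add: \<epsilon>_def)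
    define P where "P = (\<lambda>h. dist (\<Delta> h 0) z0' < \<epsilon> \<and> (\<forall>\<tau>\<in>{0..T}.
      norm ((1/h) *\<^sub>R (\<Phi> (z (s0 + h) \<tau>) - \<Phi> (z s0 \<tau>)) - \<Phi>' (z s0 \<tau>) (\<Delta> h \<tau>)) \<le> \<epsilon>))"
    have "eventually P (at 0)"
      unfolding P_def using linearised[OF \<open>\<epsilon> > 0\<close>] tendstoD[OF \<Delta>0 \<open>\<epsilon> > 0\<close>] by (intro eventually_conj)
    moreover have "dist (\<Delta> h \<tau>) (\<Delta> k \<tau>) < e" if "P h" "P k" for h k
    proof -
      define \<Delta>' where "\<Delta>' = (\<lambda>h \<tau>. (1/h) *\<^sub>R (\<Phi> (z (s0 + h) \<tau>) - \<Phi> (z s0 \<tau>)))"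
      have der: "((\<lambda>\<tau>. \<Delta> h \<tau> - \<Delta> k \<tau>) has_vector_derivative \<Delta>' h \<tau> - \<Delta>' k \<tau>) (at \<tau> within {0..T})"
        if "\<tau> \<in> {0..T}" for \<tau>
        unfolding \<Delta>_def \<Delta>'_def using that
        by (intro has_vector_derivative_diff z_der
            bounded_linear.has_vector_derivative[OF bounded_linear_scaleR_right])
      have "norm (\<Delta> h \<tau> - \<Delta> k \<tau>) \<le> E * (norm (\<Delta> h 0 - \<Delta> k 0) + 2 * \<epsilon>)"
        unfolding E_def
      proof (rule gronwall_norm_bound[OF der])
        fix \<tau> assume \<tau>: "\<tau> \<in> {0..T}"
        have lin: "linear (\<Phi>' (z s0 \<tau>))"
          using C1 z_in[OF \<tau>] has_derivative_linear unfolding C1_on_def by blast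
        have "\<Delta>' h \<tau> - \<Delta>' k \<tau> = (\<Delta>' h \<tau> - \<Phi>' (z s0 \<tau>) (\<Delta> h \<tau>))
            - (\<Delta>' k \<tau> - \<Phi>' (z s0 \<tau>) (\<Delta> k \<tau>)) + \<Phi>' (z s0 \<tau>) (\<Delta> h \<tau> - \<Delta> k \<tau>)"
          by (simp add: linear_diff[OF lin])
        also have "norm \<dots> \<le> \<epsilon> + \<epsilon> + M * norm (\<Delta> h \<tau> - \<Delta> k \<tau>)"
          using \<open>P h\<close> \<open>P k\<close> \<tau> M unfolding P_def \<Delta>'_def
          by (intro norm_triangle_le[OF add_mono] norm_triangle_le_diff[OF add_mono]) auto
        finally show "norm (\<Delta>' h \<tau> - \<Delta>' k \<tau>) \<le> M * norm (\<Delta> h \<tau> - \<Delta> k \<tau>) + 2 * \<epsilon>"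
          by simp
      qed (use \<open>M \<ge> 0\<close> \<open>\<epsilon> > 0\<close> assms in auto)
      also have "norm (\<Delta> h 0 - \<Delta> k 0) \<le> 2 * \<epsilon>"
        using \<open>P h\<close> \<open>P k\<close> dist_triangle2[of "\<Delta> h 0" "\<Delta> k 0" z0'] unfolding P_def by (auto simp: dist_norm)
      finally have "norm (\<Delta> h \<tau> - \<Delta> k \<tau>) \<le> E * (4 * \<epsilon>)"
        using \<open>E > 0\<close> by simp
      also have "\<dots> < e" using \<open>e > 0\<close> \<open>E > 0\<close> by (simp add: \<epsilon>_def)
      finally show ?thesis by (simp add: dist_norm)
    qed
    ultimately show "\<exists>P. eventually P (at 0) \<and> (\<forall>h k. P h \<and> P k \<longrightarrow> dist (\<Delta> h \<tau>) (\<Delta> k \<tau>) < e)"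
      by blast
  qed
  then obtain D where "filtermap (\<lambda>h. \<Delta> h \<tau>) (at 0) \<le> nhds D"
    using cauchy_filter_complete_converges[of _ UNIV] complete_UNIV
    by (metis UNIV_I filtermap_bot_iff principal_UNIV top_greatest trivial_limit_at)
  then have "((\<lambda>s. z s \<tau>) has_vector_derivative D) (at s0)"
    unfolding has_vector_derivative_iff_quotient \<Delta>_def filterlim_def .
  then show ?thesis
    using differentiableI_vector by blast
qed

lemma flow_Lipschitz:
  assumes lip0: "M-lipschitz_on {a..b} (\<lambda>s. z s 0)" and "a \<le> b"
  obtains K where "K \<ge> 0" "\<And>\<tau>. \<tau> \<in> {0..T} \<Longrightarrow> K-lipschitz_on {a..b} (\<lambda>s. z s \<tau>)"
    "\<And>\<tau>. \<tau> \<in> {0..T} \<Longrightarrow> K-lipschitz_on {a..b} (\<lambda>s. \<Phi> (z s \<tau>))"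
proof -
  have M: "M \<ge> 0" using lip0 lipschitz_on_nonneg by blast
  have local: "\<exists>r>0. \<exists>K. \<forall>\<tau>\<in>{0..T}. K-lipschitz_on ({x - r..x + r} \<inter> {a..b}) (\<lambda>s. z s \<tau>) \<and>
      K-lipschitz_on ({x - r..x + r} \<inter> {a..b}) (\<lambda>s. \<Phi> (z s \<tau>))" if x: "x \<in> {a..b}" for x
  proof -
    obtain \<rho> K where "\<rho> > 0" "K \<ge> 1" and
      close: "\<And>s s' \<tau>. \<lbrakk>z s 0 \<in> ball (z x 0) \<rho>; z s' 0 \<in> ball (z x 0) \<rho>; \<tau> \<in> {0..T}\<rbrakk> \<Longrightarrow>
        norm (z s \<tau> - z s' \<tau>) \<le> K * norm (z s 0 - z s' 0) \<and>
        norm (\<Phi> (z s \<tau>) - \<Phi> (z s' \<tau>)) \<le> K * norm (z s 0 - z s' 0)"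
      using trajectories_stay_close[of x] by metis
    define r where "r = \<rho> / (M + 1)"
    have "r > 0" using \<open>\<rho> > 0\<close> M by (simp add: r_def)
    let ?S = "{x - r..x + r} \<inter> {a..b}"
    have in_ball: "z s 0 \<in> ball (z x 0) \<rho>" if "s \<in> ?S" for s
    proof -
      have "dist (z x 0) (z s 0) \<le> M * dist x s"
        using lipschitz_onD[OF lip0] x that by auto
      also have "\<dots> \<le> M * r"
        using that M by (intro mult_left_mono) (auto simp: dist_real_def)
      also have "\<dots> < \<rho>" using \<open>\<rho> > 0\<close> M by (simp add: r_def field_simps)
      finally show ?thesis by simp
    qed
    have bd: "K * norm (z s 0 - z s' 0) \<le> (K * M) * dist s s'" if "s \<in> {a..b}" "s' \<in> {a..b}" for s s'
      using lipschitz_onD[OF lip0 that] \<open>K \<ge> 1\<close> by (auto simp: dist_norm mult.assoc)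
    have "(K * M)-lipschitz_on ?S (\<lambda>s. z s \<tau>)" "(K * M)-lipschitz_on ?S (\<lambda>s. \<Phi> (z s \<tau>))"
      if "\<tau> \<in> {0..T}" for \<tau>
      using close[OF in_ball in_ball that, unfolded dist_norm[symmetric]] bd[unfolded dist_norm[symmetric]]
        M \<open>K \<ge> 1\<close>
      by (auto intro!: lipschitz_onI order_trans[OF _ bd[unfolded dist_norm[symmetric]]])
    then show ?thesis using \<open>r > 0\<close> by blast
  qed
  obtain K1 where K1: "\<And>\<tau>. \<tau> \<in> {0..T} \<Longrightarrow> K1-lipschitz_on {a..b} (\<lambda>s. z s \<tau>)"
    by (rule locally_imp_uniformly_lipschitz_on[OF \<open>a \<le> b\<close>, of "{0..T}" "\<lambda>\<tau> s. z s \<tau>"])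
      (use local in blast)+
  obtain K2 where K2: "\<And>\<tau>. \<tau> \<in> {0..T} \<Longrightarrow> K2-lipschitz_on {a..b} (\<lambda>s. \<Phi> (z s \<tau>))"
    by (rule locally_imp_uniformly_lipschitz_on[OF \<open>a \<le> b\<close>, of "{0..T}" "\<lambda>\<tau> s. \<Phi> (z s \<tau>)"])
      (use local in blast)+
  have "K1 \<ge> 0" using K1[of 0] T lipschitz_on_nonneg by auto
  then show ?thesis
    using that[of "max K1 K2"] lipschitz_on_le[OF K1, of _ "max K1 K2"] lipschitz_on_le[OF K2, of _ "max K1 K2"]
    by simp
qed

text \<open>
  The velocity \<open>\<Phi> (z s \<tau>)\<close> is Lipschitz in time with a constant that is uniform in \<open>s\<close>, because
  all trajectories with parameters in \<open>[a, b]\<close> stay in one compact subset \<open>Z\<close> of \<open>W\<close>.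
\<close>

lemma flow_expansion:
  assumes lip0: "M-lipschitz_on {a..b} (\<lambda>s. z s 0)" and "a \<le> b"
  obtains C where "C \<ge> 0"
    "\<And>s \<sigma> \<tau>. \<lbrakk>s \<in> {a..b}; 0 \<le> \<sigma>; \<sigma> \<le> \<tau>; \<tau> \<le> T\<rbrakk> \<Longrightarrow>
       norm (z s \<tau> - z s \<sigma> - (\<tau> - \<sigma>) *\<^sub>R \<Phi> (z s \<sigma>)) \<le> C * (\<tau> - \<sigma>)\<^sup>2"
proof -
  obtain K where "K \<ge> 0" and K: "\<And>\<tau>. \<tau> \<in> {0..T} \<Longrightarrow> K-lipschitz_on {a..b} (\<lambda>s. z s \<tau>)"
    using flow_Lipschitz[OF assms] by metis
  define Z where "Z = (\<lambda>(\<tau>, s). z s \<tau>) ` ({0..T} \<times> {a..b})"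
  have "local_lipschitz {0..T} {a..b} (\<lambda>\<tau> s. z s \<tau>)"
    by (rule local_lipschitzI, rule exI[of _ 1], auto intro!: exI[of _ K] lipschitz_on_subset[OF K])
  then have "continuous_on ({0..T} \<times> {a..b}) (\<lambda>(\<tau>, s). z s \<tau>)"
    using z_cont by (intro continuous_on_TimesI) auto
  then have "compact Z" unfolding Z_def by (intro compact_continuous_image compact_Times) auto
  have "Z \<subseteq> W" using z_in by (auto simp: Z_def)
  have inZ: "z s \<tau> \<in> Z" if "s \<in> {a..b}" "\<tau> \<in> {0..T}" for s \<tau>
    using that by (auto simp: Z_def)
  have "continuous_on Z \<Phi>"
    using C1 \<open>Z \<subseteq> W\<close> unfolding C1_on_def
    by (meson continuous_at_imp_continuous_on has_derivative_continuous subsetD)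
  then have "bounded (\<Phi> ` Z)"
    using compact_imp_bounded compact_continuous_image \<open>compact Z\<close> by blast
  then obtain B where B: "\<And>p. p \<in> Z \<Longrightarrow> norm (\<Phi> p) \<le> B"
    by (auto simp: bounded_iff)
  obtain M' where "M' \<ge> 0" and M': "\<And>p h. p \<in> Z \<Longrightarrow> norm (\<Phi>' p h) \<le> M' * norm h"
    using C1_on_derivative_bounded[OF C1 \<open>compact Z\<close> \<open>Z \<subseteq> W\<close>] by metis
  define C where "C = \<bar>M' * B\<bar>"
  show ?thesis
  proof (rule that[of C])
    fix s \<sigma> \<tau> assume s: "s \<in> {a..b}" and *: "0 \<le> \<sigma>" "\<sigma> \<le> \<tau>" "\<tau> \<le> T"
    have \<Phi>z: "((\<lambda>\<tau>. \<Phi> (z s \<tau>)) has_vector_derivative \<Phi>' (z s \<theta>) (\<Phi> (z s \<theta>))) (at \<theta> within {\<sigma>..\<tau>})"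
      if "\<theta> \<in> {\<sigma>..\<tau>}" for \<theta>
    proof -
      have zd: "(z s has_vector_derivative \<Phi> (z s \<theta>)) (at \<theta> within {\<sigma>..\<tau>})"
        by (rule has_vector_derivative_within_subset[OF z_der]) (use that * in auto)
      have "(\<Phi> has_derivative \<Phi>' (z s \<theta>)) (at (z s \<theta>) within z s ` {\<sigma>..\<tau>})"
        by (rule has_derivative_at_withinI, rule \<Phi>_der, rule z_in) (use that * in auto)
      from vector_derivative_diff_chain_within[OF zd this] show ?thesis unfolding o_def .
    qed
    have \<Phi>lip: "norm (\<Phi> (z s \<theta>) - \<Phi> (z s \<sigma>)) \<le> C * (\<tau> - \<sigma>)" if \<theta>: "\<theta> \<in> {\<sigma>..\<tau>}" for \<theta>
    proof -
      have "norm (\<Phi> (z s \<theta>) - \<Phi> (z s \<sigma>)) \<le> C * (\<theta> - \<sigma>)"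
      proof (rule vector_derivative_bound)
        fix \<theta>' assume \<theta>': "\<theta>' \<in> {\<sigma>..\<theta>}"
        show "((\<lambda>\<tau>. \<Phi> (z s \<tau>)) has_vector_derivative \<Phi>' (z s \<theta>') (\<Phi> (z s \<theta>'))) (at \<theta>' within {\<sigma>..\<theta>})"
          by (rule has_vector_derivative_within_subset[OF \<Phi>z]) (use \<theta> \<theta>' in auto)
        have "z s \<theta>' \<in> Z" using inZ s * \<theta> \<theta>' by auto
        then have "norm (\<Phi>' (z s \<theta>') (\<Phi> (z s \<theta>'))) \<le> M' * B"
          using M' B \<open>M' \<ge> 0\<close> by (meson mult_left_mono order_trans)
        then show "norm (\<Phi>' (z s \<theta>') (\<Phi> (z s \<theta>'))) \<le> C" by (simp add: C_def)
      qed (use \<theta> in auto)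
      also have "\<dots> \<le> C * (\<tau> - \<sigma>)" using \<theta> by (intro mult_left_mono) (auto simp: C_def)
      finally show ?thesis .
    qed
    have "norm (z s \<tau> - z s \<sigma> - (\<tau> - \<sigma>) *\<^sub>R \<Phi> (z s \<sigma>)) \<le> norm (\<tau> - \<sigma>) * (C * (\<tau> - \<sigma>))"
    proof (rule vector_differentiable_bound_linearization[where S = "{\<sigma>..\<tau>}"])
      show "(z s has_vector_derivative \<Phi> (z s \<theta>)) (at \<theta> within {\<sigma>..\<tau>})" if "\<theta> \<in> {\<sigma>..\<tau>}" for \<theta>
        by (rule has_vector_derivative_within_subset[OF z_der]) (use that * in auto)
    qed (use * \<Phi>lip closed_segment_eq_real_ivl in auto)
    then show "norm (z s \<tau> - z s \<sigma> - (\<tau> - \<sigma>) *\<^sub>R \<Phi> (z s \<sigma>)) \<le> C * (\<tau> - \<sigma>)\<^sup>2"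
      using * by (simp add: power2_eq_square mult_ac)
  qed (simp add: C_def)
qed

text \<open>
  The displacement over a short time is not only small but also Lipschitz in \<open>s\<close> with a small
  constant. Hence a short step does not destroy the transversality of a curve.
\<close>

lemma flow_step_Lipschitz:
  assumes K: "\<And>\<tau>. \<tau> \<in> {0..T} \<Longrightarrow> K-lipschitz_on S (\<lambda>s. \<Phi> (z s \<tau>))"
    and "0 \<le> \<sigma>" "\<sigma> \<le> \<tau>" "\<tau> \<le> T"
  shows "((\<tau> - \<sigma>) * K)-lipschitz_on S (\<lambda>s. z s \<tau> - z s \<sigma>)"
proof (rule lipschitz_onI)
  have "\<sigma> \<in> {0..T}" using assms by auto
  then have "K \<ge> 0" using lipschitz_on_nonneg[OF K] by blast
  then show "0 \<le> (\<tau> - \<sigma>) * K" using assms by simp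
  fix s s' assume s: "s \<in> S" "s' \<in> S"
  have "norm ((z s \<tau> - z s' \<tau>) - (z s \<sigma> - z s' \<sigma>)) \<le> (K * dist s s') * (\<tau> - \<sigma>)"
  proof (rule vector_derivative_bound[OF \<open>\<sigma> \<le> \<tau>\<close>])
    fix \<theta> assume \<theta>: "\<theta> \<in> {\<sigma>..\<tau>}"
    show "((\<lambda>\<tau>. z s \<tau> - z s' \<tau>) has_vector_derivative \<Phi> (z s \<theta>) - \<Phi> (z s' \<theta>)) (at \<theta> within {\<sigma>..\<tau>})"
      by (rule has_vector_derivative_within_subset[OF has_vector_derivative_diff[OF z_der z_der]])
        (use \<theta> assms in auto)
    show "norm (\<Phi> (z s \<theta>) - \<Phi> (z s' \<theta>)) \<le> K * dist s s'"
      using lipschitz_onD[OF K s, of \<theta>] \<theta> assms by (simp add: dist_norm)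
  qed
  then show "dist (z s \<tau> - z s \<sigma>) (z s' \<tau> - z s' \<sigma>) \<le> (\<tau> - \<sigma>) * K * dist s s'"
    by (simp add: dist_norm algebra_simps)
qed

end

section \<open>Integration along Lipschitz curves\<close>

lemma derivative_abs_le_lipschitz:
  fixes f :: "real \<Rightarrow> real"
  assumes lip: "K-lipschitz_on S f" and s: "s \<in> interior S" and diff: "f differentiable (at s)"
  shows "\<bar>deriv f s\<bar> \<le> K"
proof -
  have "(f has_real_derivative deriv f s) (at s)"
    using diff DERIV_deriv_iff_real_differentiable by blast
  then have "((\<lambda>y. (f y - f s) / (y - s)) \<longlongrightarrow> deriv f s) (at s)"
    by (simp add: has_field_derivative_iff)
  then have "((\<lambda>y. \<bar>(f y - f s) / (y - s)\<bar>) \<longlongrightarrow> \<bar>deriv f s\<bar>) (at s)"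
    by (rule tendsto_rabs)
  moreover have "\<forall>\<^sub>F y in at s. \<bar>(f y - f s) / (y - s)\<bar> \<le> K"
  proof -
    have "\<forall>\<^sub>F y in at s. y \<in> interior S"
      using s by (intro eventually_at_in_open') auto
    moreover have "\<forall>\<^sub>F y in at s. y \<noteq> s" by (simp add: eventually_at_filter)
    ultimately show ?thesis
    proof eventually_elim
      case (elim y)
      then have "\<bar>f y - f s\<bar> \<le> K * \<bar>y - s\<bar>"
        using lipschitz_onD[OF lip, of y s] s interior_subset by (auto simp: dist_real_def)
      then show ?case using elim by (simp add: abs_divide divide_le_eq)
    qed
  qed
  ultimately show ?thesis
    by (intro tendsto_upperbound[where F = "at s"]) auto
qed

text \<open>
  Lipschitz functions that are differentiable off a finite set satisfy the fundamental theorem of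
  calculus, and their derivative may be multiplied by continuous functions without losing
  integrability. At the points of \<open>N\<close> the value of \<open>deriv f\<close> is arbitrary.
\<close>

locale lipschitz_curve =
  fixes A B K :: real and N :: "real set" and f :: "real \<Rightarrow> real"
  assumes lip: "K-lipschitz_on {A..B} f" and fin: "finite N"
    and diff: "\<And>s. s \<in> {A<..<B} - N \<Longrightarrow> f differentiable (at s)"
begin

lemma K_nonneg: "K \<ge> 0"
  using lip lipschitz_on_nonneg by blast

lemma deriv_bound: "s \<in> {A<..<B} - N \<Longrightarrow> \<bar>deriv f s\<bar> \<le> K"
  using derivative_abs_le_lipschitz[OF lip] diff by auto

lemma continuous: "continuous_on {A..B} f"
  using lipschitz_on_continuous_on[OF lip] .

lemma continuous_mult_deriv_integrable:
  assumes \<phi>: "continuous_on {A..B} \<phi>" and "A \<le> a" "b \<le> B"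
  shows "(\<lambda>s. \<phi> s * deriv f s) integrable_on {a..b}"
proof (cases "A \<le> B")
  case True
  \<comment> \<open>\<open>deriv f\<close> with the arbitrary values removed, so that it is bounded everywhere\<close>
  define df where "df = (\<lambda>s. if s \<in> {A<..<B} - N then deriv f s else 0)"
  have "(df has_integral (f B - f A)) {A..B}"
  proof (rule fundamental_theorem_of_calculus_interior_strong[OF fin True])
    fix s assume "s \<in> {A<..<B} - N"
    then have "(f has_real_derivative df s) (at s)"
      using diff[of s] DERIV_deriv_iff_real_differentiable by (simp add: df_def)
    then show "(f has_vector_derivative df s) (at s)"
      by (simp add: has_real_derivative_iff_has_vector_derivative)
  qed (rule continuous)
  then have "df absolutely_integrable_on {A..B}"
    by (intro absolutely_integrable_integrable_bound[where g = "\<lambda>_. K"])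
      (use deriv_bound K_nonneg in \<open>auto simp: df_def intro: integrable_const_ivl\<close>)
  moreover have "\<phi> \<in> borel_measurable (lebesgue_on {A..B})"
    by (rule continuous_imp_measurable_on_sets_lebesgue[OF \<phi>]) simp
  moreover have "bounded (\<phi> ` {A..B})"
    by (intro compact_imp_bounded compact_continuous_image \<phi>) simp
  ultimately have "(\<lambda>s. \<phi> s * df s) absolutely_integrable_on {A..B}"
    by (intro absolutely_integrable_bounded_measurable_product_real) auto
  then have "(\<lambda>s. \<phi> s * df s) integrable_on {a..b}"
    using assms by (intro set_lebesgue_integral_eq_integral(1) absolutely_integrable_on_subinterval) auto
  then show ?thesis
    by (rule integrable_spike_finite[of "insert A (insert B N)", rotated 2])
      (use fin assms in \<open>auto simp: df_def\<close>)
next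
  case False
  then have "{a..b} = {}" using assms by auto
  then show ?thesis by (metis integrable_on_empty)
qed

lemma continuous_mult_deriv_integral_bound:
  assumes \<phi>: "continuous_on {A..B} \<phi>" and ab: "A \<le> a" "a \<le> b" "b \<le> B"
    and c: "\<And>s. s \<in> {a..b} \<Longrightarrow> \<bar>\<phi> s\<bar> \<le> c"
  shows "\<bar>integral {a..b} (\<lambda>s. \<phi> s * deriv f s)\<bar> \<le> c * K * (b - a)"
proof -
  have "c \<ge> 0" using c[of a] ab by auto
  have "norm (integral {a..b} (\<lambda>s. \<phi> s * deriv f s)) \<le> (c * K) * measure lborel (cbox a b)"
  proof (rule has_integral_bound_spike_finite[of _ "insert A (insert B N)"])
    show "((\<lambda>s. \<phi> s * deriv f s) has_integral integral {a..b} (\<lambda>s. \<phi> s * deriv f s)) (cbox a b)"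
      using continuous_mult_deriv_integrable[OF \<phi> ab(1,3)] by (simp add: has_integral_integral)
    fix s assume "s \<in> cbox a b - insert A (insert B N)"
    then show "norm (\<phi> s * deriv f s) \<le> c * K"
      using c[of s] deriv_bound[of s] ab \<open>c \<ge> 0\<close> by (auto simp: abs_mult intro!: mult_mono)
  qed (use \<open>c \<ge> 0\<close> K_nonneg fin in auto)
  then show ?thesis using ab by simp
qed

end

text \<open>
  Integrating against \<open>h - y\<close> instead of \<open>h\<close> makes the boundary terms vanish.
\<close>

lemma lipschitz_curve_integral_by_parts:
  assumes "lipschitz_curve A B K N f" "lipschitz_curve A B K' N h"
    and ab: "A \<le> a" "a \<le> b" "b \<le> B" and h0: "h a = y" "h b = y"
  shows "integral {a..b} (\<lambda>s. f s * deriv h s) = - integral {a..b} (\<lambda>s. (h s - y) * deriv f s)"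
proof -
  interpret f: lipschitz_curve A B K N f by fact
  interpret h: lipschitz_curve A B K' N h by fact
  have "((\<lambda>s. f s * deriv h s + (h s - y) * deriv f s) has_integral
      f b * (h b - y) - f a * (h a - y)) {a..b}"
  proof (rule fundamental_theorem_of_calculus_interior_strong[OF f.fin ab(2)])
    fix s assume "s \<in> {a<..<b} - N"
    then have s: "s \<in> {A<..<B} - N" using ab by auto
    have "(f has_real_derivative deriv f s) (at s)" "(h has_real_derivative deriv h s) (at s)"
      using f.diff[OF s] h.diff[OF s] DERIV_deriv_iff_real_differentiable by blast+
    then have "((\<lambda>s. f s * (h s - y)) has_real_derivative f s * deriv h s + (h s - y) * deriv f s) (at s)"
      by (auto intro!: derivative_eq_intros)
    then show "((\<lambda>s. f s * (h s - y)) has_vector_derivative f s * deriv h s + (h s - y) * deriv f s) (at s)"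
      by (simp add: has_real_derivative_iff_has_vector_derivative)
  next
    show "continuous_on {a..b} (\<lambda>s. f s * (h s - y))"
      by (rule continuous_on_subset[of "{A..B}"])
        (use ab in \<open>auto intro!: continuous_intros f.continuous h.continuous\<close>)
  qed
  then have "integral {a..b} (\<lambda>s. f s * deriv h s + (h s - y) * deriv f s) = 0"
    using h0 by (simp add: integral_unique)
  moreover have "(\<lambda>s. f s * deriv h s) integrable_on {a..b}"
    by (rule h.continuous_mult_deriv_integrable[OF f.continuous ab(1,3)])
  moreover have "(\<lambda>s. (h s - y) * deriv f s) integrable_on {a..b}"
    by (rule f.continuous_mult_deriv_integrable[OF _ ab(1,3)]) (intro continuous_intros h.continuous)
  ultimately show ?thesis
    by (simp add: Henstock_Kurzweil_Integration.integral_add)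
qed

section \<open>Expansion of the modified area\<close>

text \<open>
  What the equal-area argument needs to know about the characteristics: \<open>v\<close> are the heights at
  time \<open>t\<close>, \<open>X \<delta>\<close> the positions at time \<open>t + \<delta>\<close>, \<open>f\<close> is the derivative of the flux \<open>F\<close>, and \<open>X0\<close>
  the position of the shock at time \<open>t\<close>. The interval \<open>[A, B]\<close> leaves room for the end points to
  move, and one constant \<open>M\<close> serves for all bounds. Since \<open>\<delta>0 \<le> 1\<close>, every \<open>\<delta>\<^sup>2\<close> may be estimated
  by \<open>\<delta>\<close>.
\<close>

locale equal_area_step =
  fixes A B s1 s2 M \<delta>0 X0 :: real and N :: "real set"
    and v :: "real \<Rightarrow> real" and X :: "real \<Rightarrow> real \<Rightarrow> real" and F f :: "real \<Rightarrow> real"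
  assumes order: "A < s1" "s1 < s2" "s2 < B" and \<delta>0: "0 < \<delta>0" "\<delta>0 \<le> 1"
    and v_curve: "lipschitz_curve A B M N v"
    and X_curve: "\<And>\<delta>. \<delta> \<in> {0..\<delta>0} \<Longrightarrow> lipschitz_curve A B M N (X \<delta>)"
    and X_expansion: "\<And>\<delta> s. \<delta> \<in> {0..\<delta>0} \<Longrightarrow> s \<in> {A..B} \<Longrightarrow> \<bar>X \<delta> s - X 0 s - \<delta> * f (v s)\<bar> \<le> M * \<delta>\<^sup>2"
    and X_step_lip: "\<And>\<delta>. \<delta> \<in> {0..\<delta>0} \<Longrightarrow> (\<delta> * M)-lipschitz_on {A..B} (\<lambda>s. X \<delta> s - X 0 s)"
    and F_der: "\<And>s. s \<in> {A..B} \<Longrightarrow> (F has_real_derivative f (v s)) (at (v s))"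
    and f_cont: "continuous_on {A..B} (\<lambda>s. f (v s))"
    and f_bound: "\<And>s. s \<in> {A..B} \<Longrightarrow> \<bar>f (v s)\<bar> \<le> M"
    and ends: "X 0 s1 = X0" "X 0 s2 = X0"
    and area: "integral {s1..s2} (\<lambda>s. v s * deriv (X 0) s) = 0"
    and jump: "v s1 \<noteq> v s2"
begin

sublocale v: lipschitz_curve A B M N v by (rule v_curve)

lemma X_cont: "\<delta> \<in> {0..\<delta>0} \<Longrightarrow> continuous_on {A..B} (X \<delta>)"
  using lipschitz_curve.continuous[OF X_curve] .

text \<open>
  The area that the modified equal-area principle sets to zero.
\<close>

definition J where "J \<delta> a b = integral {a..b} (\<lambda>s. v s * deriv (X \<delta>) s)"

lemma J_integrable: 
  "\<delta> \<in> {0..\<delta>0} \<Longrightarrow> A \<le> a \<Longrightarrow> b \<le> B \<Longrightarrow> (\<lambda>s. v s * deriv (X \<delta>) s) integrable_on {a..b}"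
  by (rule lipschitz_curve.continuous_mult_deriv_integrable[OF X_curve v.continuous])

lemma flux_integral:
  assumes ab: "A \<le> a" "a \<le> b" "b \<le> B"
  shows "integral {a..b} (\<lambda>s. f (v s) * deriv v s) = F (v b) - F (v a)"
proof -
  have F_der': "((\<lambda>s. F (v s)) has_real_derivative f (v s) * deriv v s) (at s)" if "s \<in> {A<..<B} - N" for s
    using DERIV_chain2[of F "f (v s)" v s "deriv v s"] F_der[of s] v.diff[OF that] that
      DERIV_deriv_iff_real_differentiable by auto
  have "((\<lambda>s. f (v s) * deriv v s) has_integral F (v b) - F (v a)) {a..b}"
  proof (rule fundamental_theorem_of_calculus_interior_strong[OF v.fin ab(2)])
    fix s assume "s \<in> {a<..<b} - N"
    then show "((\<lambda>s. F (v s)) has_vector_derivative f (v s) * deriv v s) (at s)"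
      using F_der'[of s] ab by (simp add: has_real_derivative_iff_has_vector_derivative)
  next
    have "continuous_on {A..B} (\<lambda>s. F (v s))"
      unfolding continuous_on_eq_continuous_within
    proof
      fix s assume s: "s \<in> {A..B}"
      have "isCont F (v s)" using F_der[OF s] DERIV_isCont by blast
      moreover have "continuous (at s within {A..B}) v"
        using v.continuous s by (simp add: continuous_on_eq_continuous_within)
      ultimately show "continuous (at s within {A..B}) (\<lambda>s. F (v s))"
        by (rule continuous_within_compose3)
    qed
    then show "continuous_on {a..b} (\<lambda>s. F (v s))"
      by (rule continuous_on_subset) (use ab in auto)
  qed
  then show ?thesis by (rule integral_unique)
qed

lemma flux_lipschitz:
  assumes "a \<in> {A..B}" "b \<in> {A..B}"
  shows "\<bar>F (v b) - F (v a)\<bar> \<le> M\<^sup>2 * \<bar>b - a\<bar>"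
proof -
  have *: "\<bar>F (v b) - F (v a)\<bar> \<le> M * M * (b - a)" if "A \<le> a" "a \<le> b" "b \<le> B" for a b
    unfolding flux_integral[OF that, symmetric]
    by (rule v.continuous_mult_deriv_integral_bound[OF f_cont that]) (use f_bound that in auto)
  show ?thesis
    using *[of a b] *[of b a] assms by (cases "a \<le> b") (auto simp: power2_eq_square abs_minus_commute)
qed

text \<open>
  Moving an end point of the integral away from a zero \<open>s\<close> of \<open>X 0 - X0\<close> costs only the square of
  the distance, because the integrand vanishes at \<open>s\<close>.
\<close>

lemma end_piece:
  assumes a: "a \<in> {A..B}" and s: "s \<in> {A..B}" "X 0 s = X0"
  defines "P \<equiv> \<lambda>y. integral {A..y} (\<lambda>s. (X 0 s - X0) * deriv v s)"
  shows "\<bar>P a - P s\<bar> \<le> M\<^sup>2 * (a - s)\<^sup>2"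
proof -
  have cont: "continuous_on {A..B} (\<lambda>s. X 0 s - X0)"
    by (intro continuous_intros X_cont) (use \<delta>0 in auto)
  have int: "(\<lambda>s. (X 0 s - X0) * deriv v s) integrable_on {c..d}" if "A \<le> c" "d \<le> B" for c d
    by (rule v.continuous_mult_deriv_integrable[OF cont that])
  have split: "P d - P c = integral {c..d} (\<lambda>s. (X 0 s - X0) * deriv v s)" if "A \<le> c" "c \<le> d" "d \<le> B" for c d
    using Henstock_Kurzweil_Integration.integral_combine[OF that(1,2) int] that by (simp add: P_def)
  have bound: "\<bar>P d - P c\<bar> \<le> (M * (d - c)) * M * (d - c)"
    if cd: "A \<le> c" "c \<le> d" "d \<le> B" and "s = c \<or> s = d" for c d
    unfolding split[OF cd]
  proof (rule v.continuous_mult_deriv_integral_bound[OF cont cd])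
    fix y assume y: "y \<in> {c..d}"
    have "M-lipschitz_on {A..B} (X 0)"
      using X_curve[of 0] \<delta>0 unfolding lipschitz_curve_def by auto
    then have "\<bar>X 0 y - X 0 s\<bar> \<le> M * \<bar>y - s\<bar>"
      using y cd s lipschitz_onD[of M "{A..B}" "X 0" y s] by (auto simp: dist_real_def)
    also have "\<dots> \<le> M * (d - c)" using that y v.K_nonneg by (intro mult_left_mono) auto
    finally show "\<bar>X 0 y - X0\<bar> \<le> M * (d - c)" using s by simp
  qed
  show ?thesis
  proof (cases "a \<le> s")
    case True
    then show ?thesis using bound[of a s] a s by (simp add: power2_eq_square abs_minus_commute algebra_simps)
  next
    case False
    then show ?thesis using bound[of s a] a s by (simp add: power2_eq_square abs_minus_commute algebra_simps)
  qed
qed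

definition C0 where "C0 = M\<^sup>2 * (B - A) + M\<^sup>2"

lemma C0_nonneg: "C0 \<ge> 0"
  using order by (simp add: C0_def)

text \<open>
  The heart of the argument. After the integration by parts, \<open>X \<delta> - Y\<close> is split into
  \<open>h0 = X 0 - X0\<close>, the drift \<open>\<delta> f(v)\<close>, a remainder \<open>\<rho> = O(\<delta>\<^sup>2)\<close>, and the constant \<open>X0 - Y\<close>. The
  integral of \<open>h0\<close> reduces to the two end pieces since the area at time \<open>t\<close> is zero.
\<close>

lemma J_expansion:
  assumes \<delta>: "\<delta> \<in> {0..\<delta>0}" and ab: "A \<le> a" "a \<le> b" "b \<le> B" and Y: "X \<delta> a = Y" "X \<delta> b = Y"
  shows "\<bar>J \<delta> a b - ((Y - X0) * (v b - v a) - \<delta> * (F (v b) - F (v a)))\<bar>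
    \<le> C0 * (\<delta>\<^sup>2 + (a - s1)\<^sup>2 + (b - s2)\<^sup>2)"
proof -
  define \<rho> where "\<rho> = (\<lambda>s. X \<delta> s - X 0 s - \<delta> * f (v s))"
  define I where "I = (\<lambda>\<phi> a b. integral {a..b} (\<lambda>s. \<phi> s * deriv v s))"
  define h0 where "h0 = (\<lambda>s. X 0 s - X0)"
  have zero: "(0::real) \<in> {0..\<delta>0}" using \<delta>0 by simp
  have cont: "continuous_on {A..B} \<rho>" "continuous_on {A..B} h0" "continuous_on {A..B} (\<lambda>s. Y - X0)"
    unfolding \<rho>_def h0_def by (intro continuous_intros X_cont \<delta> zero f_cont)+
  note int = v.continuous_mult_deriv_integrable[OF _ ab(1,3)]
  have Iv: "integral {a..b} (\<lambda>s. (Y - X0) * deriv v s) = (Y - X0) * (v b - v a)"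
  proof -
    have "integral {a..b} (\<lambda>s. 1 * deriv v s) = v b - v a"
    proof (rule integral_unique, rule fundamental_theorem_of_calculus_interior_strong[OF v.fin ab(2)])
      fix s assume "s \<in> {a<..<b} - N"
      then show "(v has_vector_derivative 1 * deriv v s) (at s)"
        using v.diff[of s] ab DERIV_deriv_iff_real_differentiable
        by (simp add: has_real_derivative_iff_has_vector_derivative)
    qed (rule continuous_on_subset[OF v.continuous], use ab in auto)
    then show ?thesis by simp
  qed
  have "J \<delta> a b = - integral {a..b} (\<lambda>s. (X \<delta> s - Y) * deriv v s)"
    unfolding J_def by (rule lipschitz_curve_integral_by_parts[OF v_curve X_curve[OF \<delta>] ab Y])
  also have "(\<lambda>s. (X \<delta> s - Y) * deriv v s) =
      (\<lambda>s. (h0 s * deriv v s + \<delta> * (f (v s) * deriv v s)) + (\<rho> s * deriv v s - (Y - X0) * deriv v s))"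
    by (simp add: h0_def \<rho>_def fun_eq_iff algebra_simps)
  also have "integral {a..b} \<dots> = I h0 a b + \<delta> * (F (v b) - F (v a)) + (I \<rho> a b - (Y - X0) * (v b - v a))"
    unfolding I_def flux_integral[OF ab, symmetric] Iv[symmetric]
    by (subst Henstock_Kurzweil_Integration.integral_add Henstock_Kurzweil_Integration.integral_diff
          Henstock_Kurzweil_Integration.integral_mult_right;
        (intro integrable_add integrable_diff integrable_on_mult_right int cont f_cont refl)?)+
  finally have J: "J \<delta> a b - ((Y - X0) * (v b - v a) - \<delta> * (F (v b) - F (v a))) = - I h0 a b - I \<rho> a b"
    by simp
  have "\<bar>I \<rho> a b\<bar> \<le> (M * \<delta>\<^sup>2) * M * (b - a)"
    unfolding I_def
    by (rule v.continuous_mult_deriv_integral_bound[OF cont(1) ab]) (use X_expansion[OF \<delta>] ab in \<open>auto simp: \<rho>_def\<close>)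
  also have "\<dots> \<le> (M * \<delta>\<^sup>2) * M * (B - A)"
    using ab v.K_nonneg by (intro mult_left_mono) auto
  finally have I\<rho>: "\<bar>I \<rho> a b\<bar> \<le> M\<^sup>2 * (B - A) * \<delta>\<^sup>2"
    by (simp add: power2_eq_square mult_ac)
  have comb: "I h0 c d = I h0 A d - I h0 A c" if "A \<le> c" "c \<le> d" "d \<le> B" for c d
    using Henstock_Kurzweil_Integration.integral_combine[OF that(1,2) v.continuous_mult_deriv_integrable[OF cont(2)]] that
    by (simp add: I_def)
  have "I h0 s1 s2 = 0"
    using lipschitz_curve_integral_by_parts[OF v_curve X_curve[OF zero] _ _ _ ends] area order
    by (simp add: I_def h0_def)
  then have "I h0 a b = (I h0 A b - I h0 A s2) - (I h0 A a - I h0 A s1)"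
    using comb[OF ab] comb[of s1 s2] order by simp
  moreover have "\<bar>I h0 A b - I h0 A s2\<bar> \<le> M\<^sup>2 * (b - s2)\<^sup>2" "\<bar>I h0 A a - I h0 A s1\<bar> \<le> M\<^sup>2 * (a - s1)\<^sup>2"
    unfolding I_def h0_def using ab order by (intro end_piece[OF _ _ ends(2)] end_piece[OF _ _ ends(1)]; simp)+
  ultimately have Ih: "\<bar>I h0 a b\<bar> \<le> M\<^sup>2 * (b - s2)\<^sup>2 + M\<^sup>2 * (a - s1)\<^sup>2" by linarith
  have "0 \<le> M\<^sup>2 * (B - A) * ((a - s1)\<^sup>2 + (b - s2)\<^sup>2) + M\<^sup>2 * \<delta>\<^sup>2"
    using order by (intro add_nonneg_nonneg mult_nonneg_nonneg) auto
  then show ?thesis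
    unfolding J C0_def using Ih I\<rho> by (simp add: algebra_simps)
qed

text \<open>
  The Rankine-Hugoniot speed of the jump from \<open>v s1\<close> to \<open>v s2\<close>.
\<close>

definition \<sigma> where "\<sigma> = (F (v s1) - F (v s2)) / (v s1 - v s2)"

text \<open>
  For end points within \<open>O(\<delta>)\<close> of \<open>s1\<close> and \<open>s2\<close> the area depends on \<open>Y\<close> alone, up to \<open>O(\<delta>\<^sup>2)\<close>; its
  sign tells on which side of \<open>X0 + \<delta> \<sigma>\<close> the position \<open>Y\<close> lies.
\<close>

lemma J_expansion_near:
  assumes "K \<ge> 0"
  obtains C where "C \<ge> 0" "\<And>\<delta> a b Y. \<lbrakk>\<delta> \<in> {0..\<delta>0}; A \<le> a; a \<le> b; b \<le> B; X \<delta> a = Y; X \<delta> b = Y;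
      \<bar>a - s1\<bar> \<le> K * \<delta>; \<bar>b - s2\<bar> \<le> K * \<delta>; \<bar>Y - X0\<bar> \<le> K * \<delta>\<rbrakk> \<Longrightarrow>
    \<bar>J \<delta> a b - (v s2 - v s1) * (Y - X0 - \<delta> * \<sigma>)\<bar> \<le> C * \<delta>\<^sup>2"
proof
  define C where "C = C0 * (1 + K\<^sup>2 + K\<^sup>2) + 2 * M * K\<^sup>2 + 2 * M\<^sup>2 * K"
  show "C \<ge> 0" using C0_nonneg v.K_nonneg \<open>K \<ge> 0\<close> by (simp add: C_def)
  fix \<delta> a b Y
  assume \<delta>: "\<delta> \<in> {0..\<delta>0}" and ab: "A \<le> a" "a \<le> b" "b \<le> B" and Y: "X \<delta> a = Y" "X \<delta> b = Y"
    and near: "\<bar>a - s1\<bar> \<le> K * \<delta>" "\<bar>b - s2\<bar> \<le> K * \<delta>" "\<bar>Y - X0\<bar> \<le> K * \<delta>"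
  \<comment> \<open>\<open>E1\<close> and \<open>E2\<close> are the errors of replacing \<open>a\<close>, \<open>b\<close> by \<open>s1\<close>, \<open>s2\<close> in the two main terms\<close>
  define E1 where "E1 = (Y - X0) * ((v b - v s2) - (v a - v s1))"
  define E2 where "E2 = \<delta> * ((F (v b) - F (v s2)) - (F (v a) - F (v s1)))"
  have "\<bar>v b - v s2\<bar> \<le> M * \<bar>b - s2\<bar>" "\<bar>v a - v s1\<bar> \<le> M * \<bar>a - s1\<bar>"
    using lipschitz_onD[OF v.lip, of b s2] lipschitz_onD[OF v.lip, of a s1] ab order
    by (auto simp: dist_real_def)
  moreover have "M * \<bar>b - s2\<bar> \<le> M * (K * \<delta>)" "M * \<bar>a - s1\<bar> \<le> M * (K * \<delta>)"
    using near v.K_nonneg by (auto intro: mult_left_mono)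
  ultimately have "\<bar>(v b - v s2) - (v a - v s1)\<bar> \<le> 2 * M * K * \<delta>" by linarith
  then have "\<bar>E1\<bar> \<le> (K * \<delta>) * (2 * M * K * \<delta>)"
    unfolding E1_def abs_mult using near \<delta> \<open>K \<ge> 0\<close> by (intro mult_mono) auto
  then have E1: "\<bar>E1\<bar> \<le> 2 * M * K\<^sup>2 * \<delta>\<^sup>2" by (simp add: power2_eq_square mult_ac)
  have "\<bar>F (v b) - F (v s2)\<bar> \<le> M\<^sup>2 * \<bar>b - s2\<bar>" "\<bar>F (v a) - F (v s1)\<bar> \<le> M\<^sup>2 * \<bar>a - s1\<bar>"
    using flux_lipschitz ab order by auto
  moreover have "M\<^sup>2 * \<bar>b - s2\<bar> \<le> M\<^sup>2 * (K * \<delta>)" "M\<^sup>2 * \<bar>a - s1\<bar> \<le> M\<^sup>2 * (K * \<delta>)"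
    using near by (auto intro: mult_left_mono)
  ultimately have "\<bar>(F (v b) - F (v s2)) - (F (v a) - F (v s1))\<bar> \<le> 2 * M\<^sup>2 * K * \<delta>" by linarith
  then have "\<bar>E2\<bar> \<le> \<delta> * (2 * M\<^sup>2 * K * \<delta>)"
    unfolding E2_def abs_mult using \<delta> by (intro mult_mono) auto
  then have E2: "\<bar>E2\<bar> \<le> 2 * M\<^sup>2 * K * \<delta>\<^sup>2" by (simp add: power2_eq_square mult_ac)
  have "(a - s1)\<^sup>2 \<le> K\<^sup>2 * \<delta>\<^sup>2" "(b - s2)\<^sup>2 \<le> K\<^sup>2 * \<delta>\<^sup>2"
    using near power_mono[of "\<bar>a - s1\<bar>" "K * \<delta>" 2] power_mono[of "\<bar>b - s2\<bar>" "K * \<delta>" 2]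
    by (auto simp: power_mult_distrib)
  then have "C0 * (\<delta>\<^sup>2 + (a - s1)\<^sup>2 + (b - s2)\<^sup>2) \<le> C0 * (\<delta>\<^sup>2 + K\<^sup>2 * \<delta>\<^sup>2 + K\<^sup>2 * \<delta>\<^sup>2)"
    using C0_nonneg by (intro mult_left_mono) auto
  with J_expansion[OF \<delta> ab Y] have E0: "\<bar>J \<delta> a b - ((Y - X0) * (v b - v a) - \<delta> * (F (v b) - F (v a)))\<bar>
      \<le> C0 * (1 + K\<^sup>2 + K\<^sup>2) * \<delta>\<^sup>2" by (simp add: algebra_simps)
  have "(v s2 - v s1) * \<sigma> = F (v s2) - F (v s1)"
    using jump by (simp add: \<sigma>_def field_simps)
  then have "(v s2 - v s1) * (Y - X0 - \<delta> * \<sigma>) = (Y - X0) * (v s2 - v s1) - \<delta> * (F (v s2) - F (v s1))"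
    by (metis (no_types, opaque_lifting) mult.commute mult.left_commute right_diff_distrib')
  then have "J \<delta> a b - (v s2 - v s1) * (Y - X0 - \<delta> * \<sigma>) =
      (J \<delta> a b - ((Y - X0) * (v b - v a) - \<delta> * (F (v b) - F (v a)))) + E1 - E2"
    by (simp add: E1_def E2_def algebra_simps)
  with E0 E1 E2 have "\<bar>J \<delta> a b - (v s2 - v s1) * (Y - X0 - \<delta> * \<sigma>)\<bar>
    \<le> C0 * (1 + K\<^sup>2 + K\<^sup>2) * \<delta>\<^sup>2 + 2 * M * K\<^sup>2 * \<delta>\<^sup>2 + 2 * M\<^sup>2 * K * \<delta>\<^sup>2" by linarith
  also have "\<dots> = C * \<delta>\<^sup>2" by (simp add: C_def algebra_simps)
  finally show "\<bar>J \<delta> a b - (v s2 - v s1) * (Y - X0 - \<delta> * \<sigma>)\<bar> \<le> C * \<delta>\<^sup>2" .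
qed

lemma X_drift:
  assumes "\<delta> \<in> {0..\<delta>0}" "s \<in> {A..B}"
  shows "\<bar>X \<delta> s - X 0 s\<bar> \<le> 2 * M * \<delta>"
proof -
  have "M * \<delta>\<^sup>2 \<le> M * \<delta>"
    using assms \<delta>0 v.K_nonneg by (intro mult_left_mono) (auto simp: power2_eq_square mult_left_le)
  moreover have "\<bar>\<delta> * f (v s)\<bar> \<le> \<delta> * M"
    using assms f_bound[of s] by (auto simp: abs_mult intro: mult_left_mono)
  then have "\<bar>\<delta> * f (v s)\<bar> \<le> M * \<delta>" by (simp add: mult.commute)
  moreover have "\<bar>X \<delta> s - X 0 s - \<delta> * f (v s)\<bar> \<le> M * \<delta>\<^sup>2" by (rule X_expansion[OF assms])
  ultimately have "\<bar>X \<delta> s - X 0 s\<bar> \<le> M * \<delta> + M * \<delta>" by linarith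
  then show ?thesis by simp
qed

text \<open>
  At a vanishing area the main term of \<open>J_expansion_near\<close> must be as small as the error; division
  by the jump, which is not zero, gives the claim.
\<close>

lemma predicted_position:
  assumes "K \<ge> 0"
  obtains C where "\<And>\<delta> a b. \<lbrakk>\<delta> \<in> {0..\<delta>0}; A \<le> a; a \<le> b; b \<le> B; X \<delta> a = X \<delta> b; J \<delta> a b = 0;
      \<bar>a - s1\<bar> \<le> K * \<delta>; \<bar>b - s2\<bar> \<le> K * \<delta>\<rbrakk> \<Longrightarrow> \<bar>X \<delta> a - (X0 + \<delta> * \<sigma>)\<bar> \<le> C * \<delta>\<^sup>2"
proof -
  \<comment> \<open>the distance of \<open>X \<delta> a\<close> from \<open>X0\<close> consists of \<open>M |a - s1|\<close> and the drift \<open>2 M \<delta>\<close>\<close>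
  define K' where "K' = K + M * K + 2 * M"
  have "K' \<ge> 0" "K \<le> K'" using \<open>K \<ge> 0\<close> v.K_nonneg by (auto simp: K'_def)
  from J_expansion_near[OF \<open>K' \<ge> 0\<close>] obtain C where "C \<ge> 0" and
    C: "\<And>\<delta> a b Y. \<lbrakk>\<delta> \<in> {0..\<delta>0}; A \<le> a; a \<le> b; b \<le> B; X \<delta> a = Y; X \<delta> b = Y;
      \<bar>a - s1\<bar> \<le> K' * \<delta>; \<bar>b - s2\<bar> \<le> K' * \<delta>; \<bar>Y - X0\<bar> \<le> K' * \<delta>\<rbrakk> \<Longrightarrow>
    \<bar>J \<delta> a b - (v s2 - v s1) * (Y - X0 - \<delta> * \<sigma>)\<bar> \<le> C * \<delta>\<^sup>2" by metis
  show ?thesis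
  proof (rule that[of "C / \<bar>v s2 - v s1\<bar>"])
    fix \<delta> a b
    assume \<delta>: "\<delta> \<in> {0..\<delta>0}" and ab: "A \<le> a" "a \<le> b" "b \<le> B" and eq: "X \<delta> a = X \<delta> b" and J: "J \<delta> a b = 0"
      and near: "\<bar>a - s1\<bar> \<le> K * \<delta>" "\<bar>b - s2\<bar> \<le> K * \<delta>"
    have KK': "K * \<delta> \<le> K' * \<delta>" using \<delta> \<open>K \<le> K'\<close> by (intro mult_right_mono) auto
    have "\<bar>X \<delta> a - X \<delta> s1\<bar> \<le> M * \<bar>a - s1\<bar>"
      using lipschitz_onD[OF lipschitz_curve.lip[OF X_curve[OF \<delta>]], of a s1] ab order by (auto simp: dist_real_def)
    also have "\<dots> \<le> M * (K * \<delta>)" using near v.K_nonneg by (intro mult_left_mono) auto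
    finally have "\<bar>X \<delta> a - X0\<bar> \<le> M * (K * \<delta>) + 2 * M * \<delta>"
      using X_drift[OF \<delta>, of s1] ends order by simp
    also have "\<dots> \<le> K' * \<delta>" using \<delta> \<open>K \<ge> 0\<close> by (simp add: K'_def algebra_simps)
    finally have "\<bar>J \<delta> a b - (v s2 - v s1) * (X \<delta> a - X0 - \<delta> * \<sigma>)\<bar> \<le> C * \<delta>\<^sup>2"
      using near KK' eq by (intro C[OF \<delta> ab]) auto
    then have "\<bar>v s2 - v s1\<bar> * \<bar>X \<delta> a - X0 - \<delta> * \<sigma>\<bar> \<le> C * \<delta>\<^sup>2"
      unfolding J by (simp only: diff_0 abs_minus_cancel abs_mult)
    moreover have "X \<delta> a - (X0 + \<delta> * \<sigma>) = X \<delta> a - X0 - \<delta> * \<sigma>" by simp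
    ultimately show "\<bar>X \<delta> a - (X0 + \<delta> * \<sigma>)\<bar> \<le> C / \<bar>v s2 - v s1\<bar> * \<delta>\<^sup>2"
      using jump by (simp only: times_divide_eq_left) (simp add: pos_le_divide_eq mult.commute)
  qed
qed

end

section \<open>Existence and localisation of solutions at transversal ends\<close>

text \<open>
  An expanding continuous function is injective, hence monotone, and the expansion bound makes its
  image contain the interval of radius \<open>c r\<close> around \<open>h p\<close>. The same bound read backwards says that
  the inverse \<open>\<alpha>\<close> is Lipschitz.
\<close>

lemma expanding_inverse:
  fixes h :: "real \<Rightarrow> real"
  assumes cont: "continuous_on {p - r..p + r} h" and "r > 0" "c > 0"
    and expand: "\<And>a b. a \<in> {p - r..p + r} \<Longrightarrow> b \<in> {p - r..p + r} \<Longrightarrow> c * \<bar>a - b\<bar> \<le> \<bar>h a - h b\<bar>"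
  obtains \<alpha> where "\<And>y. \<bar>y - h p\<bar> \<le> c * r \<Longrightarrow> \<alpha> y \<in> {p - r..p + r} \<and> h (\<alpha> y) = y"
    "\<And>y. \<bar>y - h p\<bar> \<le> c * r \<Longrightarrow> \<bar>\<alpha> y - p\<bar> \<le> \<bar>y - h p\<bar> / c"
    "continuous_on {y. \<bar>y - h p\<bar> \<le> c * r} \<alpha>"
proof -
  have "inj_on h {p - r..p + r}"
  proof (rule inj_onI)
    fix a b assume "a \<in> {p - r..p + r}" "b \<in> {p - r..p + r}" "h a = h b"
    then have "c * \<bar>a - b\<bar> \<le> 0" using expand[of a b] by simp
    then show "a = b" using \<open>c > 0\<close> by (simp add: mult_le_0_iff)
  qed
  then have mono: "h (p - r) < h p \<and> h p < h (p + r) \<or> h (p + r) < h p \<and> h p < h (p - r)"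
    using \<open>r > 0\<close> by (intro continuous_inj_imp_mono[OF _ _ cont]) auto
  have "c * r \<le> \<bar>h (p - r) - h p\<bar>" "c * r \<le> \<bar>h (p + r) - h p\<bar>"
    using expand[of "p - r" p] expand[of "p + r" p] \<open>r > 0\<close> by auto
  then have "\<exists>a. p - r \<le> a \<and> a \<le> p + r \<and> h a = y" if "\<bar>y - h p\<bar> \<le> c * r" for y
    using mono IVT'[of h "p - r" y "p + r"] IVT2'[of h "p + r" y "p - r"] cont \<open>r > 0\<close> that by fastforce
  then have "\<forall>y. \<exists>a. \<bar>y - h p\<bar> \<le> c * r \<longrightarrow> a \<in> {p - r..p + r} \<and> h a = y" by force
  then obtain \<alpha> where \<alpha>: "\<And>y. \<bar>y - h p\<bar> \<le> c * r \<Longrightarrow> \<alpha> y \<in> {p - r..p + r} \<and> h (\<alpha> y) = y" by metis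
  have lip: "(1 / c)-lipschitz_on {y. \<bar>y - h p\<bar> \<le> c * r} \<alpha>"
  proof (rule lipschitz_onI)
    fix y y' assume "y \<in> {y. \<bar>y - h p\<bar> \<le> c * r}" "y' \<in> {y. \<bar>y - h p\<bar> \<le> c * r}"
    then show "dist (\<alpha> y) (\<alpha> y') \<le> 1 / c * dist y y'"
      using \<alpha>[of y] \<alpha>[of y'] expand[of "\<alpha> y" "\<alpha> y'"] \<open>c > 0\<close> by (simp add: dist_real_def field_simps)
  qed (use \<open>c > 0\<close> in simp)
  show ?thesis
  proof (rule that[OF \<alpha>])
    fix y assume y: "\<bar>y - h p\<bar> \<le> c * r"
    show "\<bar>\<alpha> y - p\<bar> \<le> \<bar>y - h p\<bar> / c"
      using \<alpha>[OF y] expand[of "\<alpha> y" p] \<open>r > 0\<close> \<open>c > 0\<close> by (simp add: field_simps)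
  qed (use lipschitz_on_continuous_on[OF lip] in auto)
qed

locale transversal_equal_area_step = equal_area_step +
  fixes c r0 :: real
  assumes c: "c > 0" and r0: "r0 > 0"
    and trans: "\<And>a b. a \<in> ball s1 r0 \<Longrightarrow> b \<in> ball s1 r0 \<Longrightarrow> c * \<bar>a - b\<bar> \<le> \<bar>X 0 a - X 0 b\<bar>"
      "\<And>a b. a \<in> ball s2 r0 \<Longrightarrow> b \<in> ball s2 r0 \<Longrightarrow> c * \<bar>a - b\<bar> \<le> \<bar>X 0 a - X 0 b\<bar>"
begin

text \<open>
  Near \<open>s1\<close> and \<open>s2\<close> the two branches of the moved curve can be parametrised by the position \<open>Y\<close>,
  which solves the condition \<open>X \<delta> a = X \<delta> b\<close>. What remains is one continuous function of \<open>Y\<close>, and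
  \<open>J_expansion_near\<close> shows that it has opposite signs at \<open>X0 + \<delta> \<sigma> \<plusminus> \<delta>\<close>.
\<close>

lemma solution_exists:
  assumes "r > 0"
  shows "\<forall>\<^sub>F \<delta> in at_right 0. \<exists>a\<in>ball s1 r. \<exists>b\<in>ball s2 r. A \<le> a \<and> a < b \<and> b \<le> B \<and> X \<delta> a = X \<delta> b \<and> J \<delta> a b = 0"
proof -
  define \<rho> where "\<rho> = Min {r, r0, s1 - A, B - s2, (s2 - s1) / 2} / 2"
  have \<rho>: "\<rho> > 0" "\<rho> < r" "\<rho> < r0" "\<rho> < s1 - A" "\<rho> < B - s2" "2 * \<rho> < s2 - s1"
    using \<open>r > 0\<close> r0 order by (auto simp: \<rho>_def min_def)
  \<comment> \<open>half of the transversality constant is given away to the motion during the step\<close>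
  define k where "k = c / 2"
  have "k > 0" using c by (simp add: k_def)
  define K where "K = 1 + \<bar>\<sigma>\<bar> + (1 + \<bar>\<sigma>\<bar> + 2 * M) / k"
  have "K \<ge> 0" using v.K_nonneg \<open>k > 0\<close> by (simp add: K_def)
  from J_expansion_near[OF this] obtain C where "C \<ge> 0" and
    C: "\<And>\<delta> a b Y. \<lbrakk>\<delta> \<in> {0..\<delta>0}; A \<le> a; a \<le> b; b \<le> B; X \<delta> a = Y; X \<delta> b = Y;
      \<bar>a - s1\<bar> \<le> K * \<delta>; \<bar>b - s2\<bar> \<le> K * \<delta>; \<bar>Y - X0\<bar> \<le> K * \<delta>\<rbrakk> \<Longrightarrow>
    \<bar>J \<delta> a b - (v s2 - v s1) * (Y - X0 - \<delta> * \<sigma>)\<bar> \<le> C * \<delta>\<^sup>2" by metis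
  define m where "m = \<bar>v s2 - v s1\<bar>"
  have "m > 0" using jump by (simp add: m_def)
  \<comment> \<open>The bounds for \<open>\<delta>\<close> ensure, in this order: the expansion is valid, the moved curve is still
    transversal, the positions between \<open>Ym\<close> and \<open>Yp\<close> below lie in the images of both branches, the
    error is smaller than the main term at \<open>Ym\<close> and \<open>Yp\<close>.\<close>
  define \<delta>1 where "\<delta>1 = Min {\<delta>0, k / (M + 1), k * \<rho> / (1 + \<bar>\<sigma>\<bar> + 2 * M), m / (C + 1)}"
  have pos: "M + 1 > 0" "1 + \<bar>\<sigma>\<bar> + 2 * M > 0" "C + 1 > 0" using v.K_nonneg \<open>C \<ge> 0\<close> by auto
  then have "\<delta>1 > 0" using \<delta>0 \<open>k > 0\<close> \<rho> \<open>m > 0\<close> by (simp add: \<delta>1_def)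
  have "\<exists>a\<in>ball s1 r. \<exists>b\<in>ball s2 r. A \<le> a \<and> a < b \<and> b \<le> B \<and> X \<delta> a = X \<delta> b \<and> J \<delta> a b = 0"
    if "0 < \<delta>" "\<delta> < \<delta>1" for \<delta>
  proof -
    have "\<delta> < \<delta>0" "\<delta> < k / (M + 1)" "\<delta> < k * \<rho> / (1 + \<bar>\<sigma>\<bar> + 2 * M)" "\<delta> < m / (C + 1)"
      using that(2) by (auto simp: \<delta>1_def)
    then have small: "\<delta> \<in> {0..\<delta>0}" "\<delta> * (M + 1) < k" "\<delta> * (1 + \<bar>\<sigma>\<bar> + 2 * M) < k * \<rho>" "\<delta> * (C + 1) < m"
      using that(1) pos by (auto simp: less_divide_eq)
    have expand: "k * \<bar>a - b\<bar> \<le> \<bar>X \<delta> a - X \<delta> b\<bar>"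
      if ab: "a \<in> {p - \<rho>..p + \<rho>}" "b \<in> {p - \<rho>..p + \<rho>}" and p: "p = s1 \<or> p = s2" for a b p
    proof -
      have AB: "a \<in> {A..B}" "b \<in> {A..B}" using ab p \<rho> order by auto
      have "\<bar>(X \<delta> a - X 0 a) - (X \<delta> b - X 0 b)\<bar> \<le> \<delta> * M * \<bar>a - b\<bar>"
        using lipschitz_onD[OF X_step_lip[OF small(1)] AB] by (simp add: dist_real_def)
      also have "\<dots> \<le> k * \<bar>a - b\<bar>" using small(2) that(1) \<open>0 < \<delta>\<close> by (intro mult_right_mono) (auto simp: algebra_simps)
      finally have "\<bar>(X \<delta> a - X 0 a) - (X \<delta> b - X 0 b)\<bar> \<le> k * \<bar>a - b\<bar>" .
      moreover have "2 * k * \<bar>a - b\<bar> \<le> \<bar>X 0 a - X 0 b\<bar>"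
        using trans(1)[of a b] trans(2)[of a b] p ab \<rho> by (auto simp: k_def dist_real_def)
      ultimately show ?thesis by linarith
    qed
    have conts: "continuous_on {s1 - \<rho>..s1 + \<rho>} (X \<delta>)" "continuous_on {s2 - \<rho>..s2 + \<rho>} (X \<delta>)"
      by (rule continuous_on_subset[OF X_cont[OF small(1)]]; use \<rho> order in auto)+
    obtain \<alpha> where \<alpha>: "\<And>y. \<bar>y - X \<delta> s1\<bar> \<le> k * \<rho> \<Longrightarrow> \<alpha> y \<in> {s1 - \<rho>..s1 + \<rho>} \<and> X \<delta> (\<alpha> y) = y"
        "\<And>y. \<bar>y - X \<delta> s1\<bar> \<le> k * \<rho> \<Longrightarrow> \<bar>\<alpha> y - s1\<bar> \<le> \<bar>y - X \<delta> s1\<bar> / k"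
        "continuous_on {y. \<bar>y - X \<delta> s1\<bar> \<le> k * \<rho>} \<alpha>"
      using expanding_inverse[OF conts(1) \<open>\<rho> > 0\<close> \<open>k > 0\<close>] expand by metis
    obtain \<beta> where \<beta>: "\<And>y. \<bar>y - X \<delta> s2\<bar> \<le> k * \<rho> \<Longrightarrow> \<beta> y \<in> {s2 - \<rho>..s2 + \<rho>} \<and> X \<delta> (\<beta> y) = y"
        "\<And>y. \<bar>y - X \<delta> s2\<bar> \<le> k * \<rho> \<Longrightarrow> \<bar>\<beta> y - s2\<bar> \<le> \<bar>y - X \<delta> s2\<bar> / k"
        "continuous_on {y. \<bar>y - X \<delta> s2\<bar> \<le> k * \<rho>} \<beta>"
      using expanding_inverse[OF conts(2) \<open>\<rho> > 0\<close> \<open>k > 0\<close>] expand by metis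
    define Ym where "Ym = X0 + \<delta> * \<sigma> - \<delta>"
    define Yp where "Yp = X0 + \<delta> * \<sigma> + \<delta>"
    have "Ym \<le> Yp" using that by (simp add: Ym_def Yp_def)
    have Y_near: "\<bar>Y - X0\<bar> \<le> (1 + \<bar>\<sigma>\<bar>) * \<delta>" if "Y \<in> {Ym..Yp}" for Y
    proof -
      have "\<bar>\<delta> * \<sigma>\<bar> = \<bar>\<sigma>\<bar> * \<delta>" using \<open>0 < \<delta>\<close> by (simp add: abs_mult)
      then show ?thesis using that \<open>0 < \<delta>\<close> by (simp add: Ym_def Yp_def algebra_simps) linarith
    qed
    have Y_dist: "\<bar>Y - X \<delta> p\<bar> \<le> (1 + \<bar>\<sigma>\<bar> + 2 * M) * \<delta>" if "Y \<in> {Ym..Yp}" "p = s1 \<or> p = s2" for Y p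
    proof -
      have "\<bar>X \<delta> p - X0\<bar> \<le> 2 * M * \<delta>"
        using X_drift[OF small(1), of p] that(2) ends order by auto
      then show ?thesis using Y_near[OF that(1)] by (simp add: algebra_simps)
    qed
    have Y_in: "\<bar>Y - X \<delta> p\<bar> \<le> k * \<rho>" if "Y \<in> {Ym..Yp}" "p = s1 \<or> p = s2" for Y p
      using Y_dist[OF that] small(3) by (simp add: mult.commute)
    have ab: "A \<le> \<alpha> Y" "\<alpha> Y < \<beta> Y" "\<beta> Y \<le> B" "X \<delta> (\<alpha> Y) = Y" "X \<delta> (\<beta> Y) = Y" "\<alpha> Y \<in> ball s1 r" "\<beta> Y \<in> ball s2 r"
      if "Y \<in> {Ym..Yp}" for Y
      using \<alpha>(1)[OF Y_in[OF that]] \<beta>(1)[OF Y_in[OF that]] \<rho> by (auto simp: dist_real_def)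
    define H where "H = (\<lambda>Y. J \<delta> (\<alpha> Y) (\<beta> Y))"
    have H: "\<bar>H Y - (v s2 - v s1) * (Y - X0 - \<delta> * \<sigma>)\<bar> \<le> C * \<delta>\<^sup>2" if Y: "Y \<in> {Ym..Yp}" for Y
      unfolding H_def
    proof (rule C[OF small(1)])
      have KK: "(1 + \<bar>\<sigma>\<bar> + 2 * M) * \<delta> / k \<le> K * \<delta>" "(1 + \<bar>\<sigma>\<bar>) * \<delta> \<le> K * \<delta>"
        using \<open>0 < \<delta>\<close> \<open>k > 0\<close> v.K_nonneg by (auto simp: K_def algebra_simps)
      have div: "\<bar>Y - X \<delta> p\<bar> / k \<le> (1 + \<bar>\<sigma>\<bar> + 2 * M) * \<delta> / k" if "p = s1 \<or> p = s2" for p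
        using Y_dist[OF Y that] \<open>k > 0\<close> by (simp add: divide_right_mono)
      show "\<bar>\<alpha> Y - s1\<bar> \<le> K * \<delta>" "\<bar>\<beta> Y - s2\<bar> \<le> K * \<delta>"
        using \<alpha>(2)[OF Y_in[OF Y]] \<beta>(2)[OF Y_in[OF Y]] div[of s1] div[of s2] KK by auto
      show "\<bar>Y - X0\<bar> \<le> K * \<delta>" using Y_near[OF Y] KK by linarith
    qed (use ab[OF Y] in auto)
    have H_cont: "continuous_on {Ym..Yp} H"
    proof -
      define P where "P = (\<lambda>y. integral {A..y} (\<lambda>s. v s * deriv (X \<delta>) s))"
      have P_cont: "continuous_on {A..B} P"
        unfolding P_def by (rule indefinite_integral_continuous_1) (rule J_integrable[OF small(1)]; simp)
      have "continuous_on {Ym..Yp} \<alpha>" "continuous_on {Ym..Yp} \<beta>"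
        using Y_in by (auto intro: continuous_on_subset[OF \<alpha>(3)] continuous_on_subset[OF \<beta>(3)])
      then have "continuous_on {Ym..Yp} (\<lambda>Y. P (\<beta> Y) - P (\<alpha> Y))"
        using ab by (intro continuous_intros continuous_on_compose2[OF P_cont]) fastforce+
      moreover have "H Y = P (\<beta> Y) - P (\<alpha> Y)" if "Y \<in> {Ym..Yp}" for Y
        using Henstock_Kurzweil_Integration.integral_combine[of A "\<alpha> Y" "\<beta> Y", OF _ _ J_integrable[OF small(1)]]
          ab[OF that] by (simp add: H_def J_def P_def)
      ultimately show ?thesis by (metis (no_types, lifting) continuous_on_cong)
    qed
    have "C * \<delta>\<^sup>2 < m * \<delta>"
      using small(4) that(1) by (simp add: power2_eq_square algebra_simps mult_strict_right_mono)
    define q where "q = (v s2 - v s1) * \<delta>"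
    have "\<bar>q\<bar> = m * \<delta>" using \<open>0 < \<delta>\<close> by (simp add: q_def m_def abs_mult)
    with \<open>C * \<delta>\<^sup>2 < m * \<delta>\<close> have "C * \<delta>\<^sup>2 < \<bar>q\<bar>" by simp
    moreover have "\<bar>H Ym + q\<bar> \<le> C * \<delta>\<^sup>2" "\<bar>H Yp - q\<bar> \<le> C * \<delta>\<^sup>2"
      using H[of Ym] H[of Yp] \<open>Ym \<le> Yp\<close> by (auto simp: Ym_def Yp_def q_def)
    ultimately have "H Ym \<le> 0 \<and> 0 \<le> H Yp \<or> H Yp \<le> 0 \<and> 0 \<le> H Ym"
      by (smt (verit))
    then obtain Y where "Y \<in> {Ym..Yp}" "H Y = 0"
      using IVT'[OF _ _ \<open>Ym \<le> Yp\<close> H_cont, of 0] IVT2'[OF _ _ \<open>Ym \<le> Yp\<close> H_cont, of 0] by auto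
    then show ?thesis using ab[of Y] unfolding H_def by metis
  qed
  then show ?thesis
    using \<open>\<delta>1 > 0\<close> by (auto simp: eventually_at_right_field intro!: exI[of _ \<delta>1])
qed

text \<open>
  Transversality bounds the distances of \<open>a\<close>, \<open>b\<close> from \<open>s1\<close>, \<open>s2\<close> by \<open>D / c\<close>, where
  \<open>D = |Y - X0| + 2 M \<delta>\<close>. Inserted into \<open>J_expansion\<close>, this gives an inequality for \<open>|Y - X0|\<close>
  whose quadratic error is absorbed by the left-hand side if \<open>D\<close> is small, that is, if \<open>r\<close> and \<open>\<delta>\<close>
  are small. The radius \<open>r\<close> is chosen before \<open>\<delta>\<close>, so that one neighbourhood serves for all small
  steps.
\<close>

lemma solutions_near_ends:
  obtains r K where "r > 0" "K \<ge> 0"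
    "\<forall>\<^sub>F \<delta> in at_right 0. \<forall>a\<in>ball s1 r. \<forall>b\<in>ball s2 r. X \<delta> a = X \<delta> b \<and> J \<delta> a b = 0 \<longrightarrow>
       A \<le> a \<and> a \<le> b \<and> b \<le> B \<and> \<bar>a - s1\<bar> \<le> K * \<delta> \<and> \<bar>b - s2\<bar> \<le> K * \<delta>"
proof -
  define m where "m = \<bar>v s2 - v s1\<bar>"
  have "m > 0" using jump by (simp add: m_def)
  \<comment> \<open>\<open>G D\<^sup>2\<close> bounds the quadratic error\<close>
  define G where "G = 2 * C0 / c\<^sup>2"
  have "G \<ge> 0" using C0_nonneg by (simp add: G_def)
  \<comment> \<open>\<open>L r\<close> controls both the change \<open>2 M r\<close> of the jump and the coefficient \<open>G M r\<close> of the
    quadratic error\<close>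
  define L where "L = 1 + 4 * M + G * M"
  have "L > 0" "L \<ge> 4 * M" "L \<ge> G * M" using v.K_nonneg \<open>G \<ge> 0\<close> by (auto simp: L_def add_pos_nonneg)
  define r where "r = Min {r0, s1 - A, B - s2, (s2 - s1) / 2, m / (8 * L)}"
  have r: "r > 0" "r \<le> r0" "r \<le> s1 - A" "r \<le> B - s2" "2 * r \<le> s2 - s1" "r \<le> m / (8 * L)"
    using r0 order \<open>m > 0\<close> \<open>L > 0\<close> by (auto simp: r_def min_def)
  have Lr: "L * r \<le> m / 8" using r(6) \<open>L > 0\<close> by (simp add: field_simps)
  have Mr: "4 * M * r \<le> m / 8" "G * M * r \<le> m / 8"
    using Lr mult_right_mono[OF \<open>L \<ge> 4 * M\<close>, of r] mult_right_mono[OF \<open>L \<ge> G * M\<close>, of r] less_imp_le[OF r(1)]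
    by linarith+
  define \<delta>1 where "\<delta>1 = min \<delta>0 (m / (8 * (1 + 4 * G * M)))"
  have "1 + 4 * G * M > 0" using \<open>G \<ge> 0\<close> v.K_nonneg by (simp add: add_pos_nonneg)
  then have "\<delta>1 > 0" using \<delta>0 \<open>m > 0\<close> by (simp add: \<delta>1_def)
  define e0 where "e0 = 4 * (M\<^sup>2 * (B - A) + C0 + m * M / 2) / m"
  define K where "K = (e0 + 2 * M) / c"
  have "e0 \<ge> 0" using C0_nonneg v.K_nonneg \<open>m > 0\<close> order by (simp add: e0_def)
  then have "K \<ge> 0" using c v.K_nonneg by (simp add: K_def)
  have main: "A \<le> a \<and> a \<le> b \<and> b \<le> B \<and> \<bar>a - s1\<bar> \<le> K * \<delta> \<and> \<bar>b - s2\<bar> \<le> K * \<delta>"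
    if "0 < \<delta>" "\<delta> < \<delta>1" and ab: "a \<in> ball s1 r" "b \<in> ball s2 r" and eq: "X \<delta> a = X \<delta> b" and J: "J \<delta> a b = 0" for \<delta> a b
  proof -
    have \<delta>: "\<delta> \<in> {0..\<delta>0}" "\<delta> \<le> 1" using that \<delta>0 by (auto simp: \<delta>1_def)
    have "\<delta> < m / (8 * (1 + 4 * G * M))" using that(2) by (simp add: \<delta>1_def)
    then have "(1 + 4 * G * M) * \<delta> \<le> m / 8" using \<open>1 + 4 * G * M > 0\<close> by (simp add: field_simps)
    then have \<delta>G: "4 * G * M * \<delta> \<le> m / 8" using \<open>0 < \<delta>\<close> by (simp add: algebra_simps)
    have AB: "A \<le> a" "a \<le> b" "b \<le> B" using ab r by (auto simp: dist_real_def)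
    define e where "e = \<bar>X \<delta> a - X0\<bar>"
    define D where "D = e + 2 * M * \<delta>"
    have "e \<ge> 0" by (simp add: e_def)
    have "D \<ge> 0" using v.K_nonneg \<open>0 < \<delta>\<close> by (simp add: D_def e_def)
    have drift: "\<bar>X \<delta> a - X 0 a\<bar> \<le> 2 * M * \<delta>" "\<bar>X \<delta> b - X 0 b\<bar> \<le> 2 * M * \<delta>"
      using X_drift[OF \<delta>(1)] AB by auto
    have "c * \<bar>a - s1\<bar> \<le> \<bar>X 0 a - X0\<bar>" "c * \<bar>b - s2\<bar> \<le> \<bar>X 0 b - X0\<bar>"
      using trans(1)[of a s1] trans(2)[of b s2] ab r r0 by (auto simp: ends)
    then have cD: "c * \<bar>a - s1\<bar> \<le> D" "c * \<bar>b - s2\<bar> \<le> D"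
      using drift eq unfolding D_def e_def by linarith+
    then have aD: "\<bar>a - s1\<bar> \<le> D / c" "\<bar>b - s2\<bar> \<le> D / c" using c by (auto simp: field_simps)
    have "\<bar>X 0 a - X 0 s1\<bar> \<le> M * \<bar>a - s1\<bar>"
      using lipschitz_onD[OF lipschitz_curve.lip[OF X_curve[of 0]], of a s1] AB order \<delta>0 by (auto simp: dist_real_def)
    also have "\<dots> \<le> M * r" using ab v.K_nonneg by (intro mult_left_mono) (auto simp: dist_real_def)
    finally have D_le: "D \<le> M * r + 4 * M * \<delta>" using drift(1) ends(1) unfolding D_def e_def by linarith
    have sq: "(a - s1)\<^sup>2 + (b - s2)\<^sup>2 \<le> 2 * (D / c)\<^sup>2"
      using power_mono[OF aD(1), of 2] power_mono[OF aD(2), of 2] by simp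
    have "C0 * ((a - s1)\<^sup>2 + (b - s2)\<^sup>2) \<le> C0 * (2 * (D / c)\<^sup>2)" 
      using mult_left_mono[OF sq C0_nonneg] .
    also have "\<dots> = G * D * D" by (simp add: G_def power2_eq_square)
    also have "\<dots> \<le> (m / 4) * D"
    proof (rule mult_right_mono[OF _ \<open>D \<ge> 0\<close>])
      have "G * D \<le> G * (M * r + 4 * M * \<delta>)" using D_le \<open>G \<ge> 0\<close> by (rule mult_left_mono)
      also have "\<dots> \<le> m / 4" using Mr(2) \<delta>G by (simp add: algebra_simps)
      finally show "G * D \<le> m / 4" .
    qed
    finally have quad: "C0 * ((a - s1)\<^sup>2 + (b - s2)\<^sup>2) \<le> (m / 4) * D" .
    have "\<bar>v a - v s1\<bar> \<le> M * \<bar>a - s1\<bar>" "\<bar>v b - v s2\<bar> \<le> M * \<bar>b - s2\<bar>"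
      using lipschitz_onD[OF v.lip, of a s1] lipschitz_onD[OF v.lip, of b s2] AB order by (auto simp: dist_real_def)
    moreover have "M * \<bar>a - s1\<bar> \<le> M * r" "M * \<bar>b - s2\<bar> \<le> M * r"
      using ab v.K_nonneg by (auto simp: dist_real_def intro!: mult_left_mono)
    ultimately have "\<bar>v a - v s1\<bar> \<le> m / 32" "\<bar>v b - v s2\<bar> \<le> m / 32"
      using Mr(1) by linarith+
    moreover have "m \<le> \<bar>v b - v a\<bar> + \<bar>v b - v s2\<bar> + \<bar>v a - v s1\<bar>"
      unfolding m_def by (auto simp: abs_if)
    ultimately have jump': "m / 2 \<le> \<bar>v b - v a\<bar>" using \<open>m > 0\<close> by linarith
    have "\<bar>(X \<delta> a - X0) * (v b - v a)\<bar> \<le> \<bar>\<delta> * (F (v b) - F (v a))\<bar> + C0 * (\<delta>\<^sup>2 + (a - s1)\<^sup>2 + (b - s2)\<^sup>2)"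
      using J_expansion[OF \<delta>(1) AB refl eq[symmetric]] J by linarith
    moreover have "e * (m / 2) \<le> \<bar>(X \<delta> a - X0) * (v b - v a)\<bar>"
      unfolding abs_mult e_def using jump' \<open>m > 0\<close> by (intro mult_mono) auto
    moreover have "\<bar>\<delta> * (F (v b) - F (v a))\<bar> \<le> \<delta> * (M\<^sup>2 * (B - A))"
    proof -
      have "\<bar>F (v b) - F (v a)\<bar> \<le> M\<^sup>2 * \<bar>b - a\<bar>" by (rule flux_lipschitz) (use AB in auto)
      also have "\<dots> \<le> M\<^sup>2 * (B - A)" using AB by (intro mult_left_mono) auto
      finally show ?thesis using \<open>0 < \<delta>\<close> by (simp add: abs_mult)
    qed
    moreover have "C0 * \<delta>\<^sup>2 \<le> C0 * \<delta>"
      using \<delta> \<open>0 < \<delta>\<close> C0_nonneg by (intro mult_left_mono) (auto simp: power2_eq_square mult_left_le)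
    ultimately have "e * (m / 2) \<le> \<delta> * (M\<^sup>2 * (B - A)) + C0 * \<delta> + (m / 4) * D"
      using quad unfolding distrib_left by linarith
    then have "e * (m / 4) \<le> \<delta> * (M\<^sup>2 * (B - A) + C0 + m * M / 2)"
      by (simp add: D_def algebra_simps)
    then have "e \<le> e0 * \<delta>"
      using \<open>m > 0\<close> by (simp add: e0_def field_simps)
    then have "D / c \<le> K * \<delta>"
      using c unfolding D_def K_def by (simp add: divide_right_mono algebra_simps flip: add_divide_distrib)
    then show ?thesis using AB aD by auto
  qed
  show ?thesis
  proof (rule that[OF r(1) \<open>K \<ge> 0\<close>])
    show "\<forall>\<^sub>F \<delta> in at_right 0. \<forall>a\<in>ball s1 r. \<forall>b\<in>ball s2 r. X \<delta> a = X \<delta> b \<and> J \<delta> a b = 0 \<longrightarrow>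
       A \<le> a \<and> a \<le> b \<and> b \<le> B \<and> \<bar>a - s1\<bar> \<le> K * \<delta> \<and> \<bar>b - s2\<bar> \<le> K * \<delta>"
      unfolding eventually_at_right_field using \<open>\<delta>1 > 0\<close> main by (intro exI[of _ \<delta>1]) blast
  qed
qed

end

section \<open>Shock states\<close>

text \<open>
  A Lipschitz bound next to the shock extends to the one-sided limits at the shock. The filter \<open>G\<close>
  stands for the approach from the left or from the right.
\<close>

lemma lipschitz_limit_bound:
  fixes u :: "real \<Rightarrow> real \<Rightarrow> real"
  assumes lip: "L-lipschitz_on S (\<lambda>(y, \<tau>). u y \<tau>)"
    and lim: "((\<lambda>y. u y \<tau>0) \<longlongrightarrow> w0) G" and G: "G \<noteq> bot" "G \<le> nhds x0" "\<forall>\<^sub>F y in G. (y, \<tau>0) \<in> S"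
    and S: "(y, \<tau>) \<in> S"
  shows "\<bar>u y \<tau> - w0\<bar> \<le> L * (\<bar>y - x0\<bar> + \<bar>\<tau> - \<tau>0\<bar>)"
proof (rule tendsto_le[OF G(1)])
  have id: "((\<lambda>y'. y') \<longlongrightarrow> x0) G"
    using G(2) by (simp add: filterlim_def)
  show "((\<lambda>y'. \<bar>u y \<tau> - u y' \<tau>0\<bar>) \<longlongrightarrow> \<bar>u y \<tau> - w0\<bar>) G"
    by (intro tendsto_intros lim)
  show "((\<lambda>y'. L * (\<bar>y - y'\<bar> + \<bar>\<tau> - \<tau>0\<bar>)) \<longlongrightarrow> L * (\<bar>y - x0\<bar> + \<bar>\<tau> - \<tau>0\<bar>)) G"
    by (intro tendsto_intros id)
  show "\<forall>\<^sub>F y' in G. \<bar>u y \<tau> - u y' \<tau>0\<bar> \<le> L * (\<bar>y - y'\<bar> + \<bar>\<tau> - \<tau>0\<bar>)"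
    using G(3)
  proof eventually_elim
    case (elim y')
    have "\<bar>u y \<tau> - u y' \<tau>0\<bar> \<le> L * dist (y, \<tau>) (y', \<tau>0)"
      using lipschitz_onD[OF lip S elim] by (simp add: dist_real_def)
    also have "\<dots> \<le> L * (\<bar>y - y'\<bar> + \<bar>\<tau> - \<tau>0\<bar>)"
      using lipschitz_on_nonneg[OF lip] sqrt_sum_squares_le_sum_abs[of "y - y'" "\<tau> - \<tau>0"]
      by (intro mult_left_mono) (auto simp: dist_prod_def dist_real_def)
    finally show ?case .
  qed
qed

text \<open>
  A second passage to the limit compares the shock states at two different times.
\<close>

lemma lipschitz_limits_bound:
  fixes u :: "real \<Rightarrow> real \<Rightarrow> real"
  assumes lip: "L-lipschitz_on S (\<lambda>(y, \<tau>). u y \<tau>)"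
    and "((\<lambda>y. u y \<tau>0) \<longlongrightarrow> w0) G" "G \<noteq> bot" "G \<le> nhds x0" "\<forall>\<^sub>F y in G. (y, \<tau>0) \<in> S"
    and lim: "((\<lambda>y. u y \<tau>) \<longlongrightarrow> w) H" and H: "H \<noteq> bot" "H \<le> nhds x" "\<forall>\<^sub>F y in H. (y, \<tau>) \<in> S"
  shows "\<bar>w - w0\<bar> \<le> L * (\<bar>x - x0\<bar> + \<bar>\<tau> - \<tau>0\<bar>)"
proof (rule tendsto_le[OF H(1)])
  have id: "((\<lambda>y. y) \<longlongrightarrow> x) H"
    using H(2) by (simp add: filterlim_def)
  show "((\<lambda>y. \<bar>u y \<tau> - w0\<bar>) \<longlongrightarrow> \<bar>w - w0\<bar>) H"
    by (intro tendsto_intros lim)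
  show "((\<lambda>y. L * (\<bar>y - x0\<bar> + \<bar>\<tau> - \<tau>0\<bar>)) \<longlongrightarrow> L * (\<bar>x - x0\<bar> + \<bar>\<tau> - \<tau>0\<bar>)) H"
    by (intro tendsto_intros id)
  show "\<forall>\<^sub>F y in H. \<bar>u y \<tau> - w0\<bar> \<le> L * (\<bar>y - x0\<bar> + \<bar>\<tau> - \<tau>0\<bar>)"
    using H(3) by eventually_elim (rule lipschitz_limit_bound[OF assms(1-5)])
qed

lemma isolated_shock_estimates:
  assumes shock: "isolated_shock U u I xs uL uR" and "\<tau>0 \<in> I"
  obtains r L where "r > 0" "L \<ge> 0"
    "\<And>y \<tau>. \<lbrakk>\<tau> \<in> I; \<bar>\<tau> - \<tau>0\<bar> < r; xs \<tau> - r < y; y < xs \<tau>\<rbrakk> \<Longrightarrow>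
       \<bar>u y \<tau> - uL \<tau>0\<bar> \<le> L * (\<bar>y - xs \<tau>0\<bar> + \<bar>\<tau> - \<tau>0\<bar>)"
    "\<And>y \<tau>. \<lbrakk>\<tau> \<in> I; \<bar>\<tau> - \<tau>0\<bar> < r; xs \<tau> < y; y < xs \<tau> + r\<rbrakk> \<Longrightarrow>
       \<bar>u y \<tau> - uR \<tau>0\<bar> \<le> L * (\<bar>y - xs \<tau>0\<bar> + \<bar>\<tau> - \<tau>0\<bar>)"
    "\<And>\<tau>. \<lbrakk>\<tau> \<in> I; \<bar>\<tau> - \<tau>0\<bar> < r\<rbrakk> \<Longrightarrow> \<bar>uL \<tau> - uL \<tau>0\<bar> \<le> L * (\<bar>xs \<tau> - xs \<tau>0\<bar> + \<bar>\<tau> - \<tau>0\<bar>)"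
    "\<And>\<tau>. \<lbrakk>\<tau> \<in> I; \<bar>\<tau> - \<tau>0\<bar> < r\<rbrakk> \<Longrightarrow> \<bar>uR \<tau> - uR \<tau>0\<bar> \<le> L * (\<bar>xs \<tau> - xs \<tau>0\<bar> + \<bar>\<tau> - \<tau>0\<bar>)"
proof -
  define SL where "SL = (\<lambda>r. {(y, \<tau>). \<tau> \<in> I \<and> \<bar>\<tau> - \<tau>0\<bar> < r \<and> xs \<tau> - r < y \<and> y < xs \<tau>})"
  define SR where "SR = (\<lambda>r. {(y, \<tau>). \<tau> \<in> I \<and> \<bar>\<tau> - \<tau>0\<bar> < r \<and> xs \<tau> < y \<and> y < xs \<tau> + r})"
  have lim: "((\<lambda>y. u y \<tau>) \<longlongrightarrow> uL \<tau>) (at_left (xs \<tau>))" "((\<lambda>y. u y \<tau>) \<longlongrightarrow> uR \<tau>) (at_right (xs \<tau>))"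
    if "\<tau> \<in> I" for \<tau>
    using shock that unfolding isolated_shock_def by blast+
  obtain r L where "r > 0" and lip: "L-lipschitz_on (SL r) (\<lambda>(y, \<tau>). u y \<tau>)" "L-lipschitz_on (SR r) (\<lambda>(y, \<tau>). u y \<tau>)"
    using shock \<open>\<tau>0 \<in> I\<close> unfolding isolated_shock_def SL_def SR_def by blast
  have evL: "\<forall>\<^sub>F y in at_left (xs \<tau>). (y, \<tau>) \<in> SL r" if "\<tau> \<in> I" "\<bar>\<tau> - \<tau>0\<bar> < r" for \<tau>
    using eventually_at_left_real[of "xs \<tau> - r" "xs \<tau>"] \<open>r > 0\<close> that by (auto simp: SL_def elim!: eventually_mono)
  have evR: "\<forall>\<^sub>F y in at_right (xs \<tau>). (y, \<tau>) \<in> SR r" if "\<tau> \<in> I" "\<bar>\<tau> - \<tau>0\<bar> < r" for \<tau>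
    using eventually_at_right_real[of "xs \<tau>" "xs \<tau> + r"] \<open>r > 0\<close> that by (auto simp: SR_def elim!: eventually_mono)
  have le: "at_left (a::real) \<le> nhds a" "at_right a \<le> nhds a" for a
    by (auto simp: at_within_def)
  have here: "\<bar>\<tau>0 - \<tau>0\<bar> < r" using \<open>r > 0\<close> by simp
  note L = lipschitz_limit_bound[OF lip(1) lim(1)[OF \<open>\<tau>0 \<in> I\<close>] _ le(1) evL[OF \<open>\<tau>0 \<in> I\<close> here]]
    and R = lipschitz_limit_bound[OF lip(2) lim(2)[OF \<open>\<tau>0 \<in> I\<close>] _ le(2) evR[OF \<open>\<tau>0 \<in> I\<close> here]]
  show ?thesis
  proof (rule that[OF \<open>r > 0\<close> lipschitz_on_nonneg[OF lip(1)]])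
    fix \<tau> assume \<tau>: "\<tau> \<in> I" "\<bar>\<tau> - \<tau>0\<bar> < r"
    show "\<bar>uL \<tau> - uL \<tau>0\<bar> \<le> L * (\<bar>xs \<tau> - xs \<tau>0\<bar> + \<bar>\<tau> - \<tau>0\<bar>)"
      by (rule lipschitz_limits_bound[OF lip(1) lim(1)[OF \<open>\<tau>0 \<in> I\<close>] _ le(1) evL[OF \<open>\<tau>0 \<in> I\<close> here]
            lim(1)[OF \<tau>(1)] _ le(1) evL[OF \<tau>]]) auto
    show "\<bar>uR \<tau> - uR \<tau>0\<bar> \<le> L * (\<bar>xs \<tau> - xs \<tau>0\<bar> + \<bar>\<tau> - \<tau>0\<bar>)"
      by (rule lipschitz_limits_bound[OF lip(2) lim(2)[OF \<open>\<tau>0 \<in> I\<close>] _ le(2) evR[OF \<open>\<tau>0 \<in> I\<close> here]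
            lim(2)[OF \<tau>(1)] _ le(2) evR[OF \<tau>]]) auto
  qed (rule L R; simp add: SL_def SR_def)+
qed

text \<open>
  The quantity that the Rankine-Hugoniot condition equates on both sides is \<open>F(w) - xs' w\<close>. Close
  to the shock it differs little from its value at the shock state \<open>w0\<close>.
\<close>

lemma flux_defect_small:
  fixes F xs xs' :: "real \<Rightarrow> real"
  assumes F: "isCont F w0" and xs: "continuous (at \<tau>0 within I) xs" and xs': "continuous (at \<tau>0 within I) xs'"
    and "L \<ge> 0" "\<eta> > 0"
  obtains \<rho> where "\<rho> > 0"
    "\<And>\<tau> y w. \<lbrakk>\<tau> \<in> I; \<bar>\<tau> - \<tau>0\<bar> < \<rho>; \<bar>y - xs \<tau>\<bar> < \<rho>; \<bar>w - w0\<bar> \<le> L * (\<bar>y - xs \<tau>0\<bar> + \<bar>\<tau> - \<tau>0\<bar>)\<rbrakk> \<Longrightarrow>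
       \<bar>(F w - xs' \<tau> * w) - (F w0 - xs' \<tau>0 * w0)\<bar> \<le> \<eta>"
proof -
  have "((\<lambda>p. F (snd p) - fst p * snd p) \<longlongrightarrow> F w0 - xs' \<tau>0 * w0) (nhds (xs' \<tau>0, w0))"
  proof -
    have 1: "(snd \<longlongrightarrow> w0) (nhds (xs' \<tau>0, w0))" "(fst \<longlongrightarrow> xs' \<tau>0) (nhds (xs' \<tau>0, w0))"
      by (auto intro!: tendsto_eq_intros filterlim_ident)
    have "((\<lambda>p. F (snd p)) \<longlongrightarrow> F w0) (nhds (xs' \<tau>0, w0))"
      using isCont_tendsto_compose[OF F 1(1)] .
    then show ?thesis using 1 by (intro tendsto_intros)
  qed
  then obtain d where "d > 0" and d: "\<And>m w. dist (m, w) (xs' \<tau>0, w0) < d \<Longrightarrow>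
      \<bar>(F w - m * w) - (F w0 - xs' \<tau>0 * w0)\<bar> < \<eta>"
    using \<open>\<eta> > 0\<close> unfolding tendsto_iff eventually_nhds_metric dist_real_def by fastforce
  define e where "e = (d / 6) / (L + 1)"
  have "e > 0" using \<open>d > 0\<close> \<open>L \<ge> 0\<close> by (simp add: e_def)
  have Le: "(L + 1) * e = d / 6"
    using \<open>L \<ge> 0\<close> unfolding e_def by (subst times_divide_eq_right, intro nonzero_mult_div_cancel_left) simp
  obtain r1 where "r1 > 0" and r1: "\<And>\<tau>. \<tau> \<in> I \<Longrightarrow> \<bar>\<tau> - \<tau>0\<bar> < r1 \<Longrightarrow> \<bar>xs \<tau> - xs \<tau>0\<bar> < e"
    using xs \<open>e > 0\<close> unfolding continuous_within_eps_delta dist_real_def by blast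
  obtain r2 where "r2 > 0" and r2: "\<And>\<tau>. \<tau> \<in> I \<Longrightarrow> \<bar>\<tau> - \<tau>0\<bar> < r2 \<Longrightarrow> \<bar>xs' \<tau> - xs' \<tau>0\<bar> < d / 2"
    using xs' \<open>d > 0\<close> unfolding continuous_within_eps_delta dist_real_def by (meson half_gt_zero)
  show ?thesis
  proof (rule that[of "min e (min r1 r2)"])
    fix \<tau> y w assume \<tau>: "\<tau> \<in> I" "\<bar>\<tau> - \<tau>0\<bar> < min e (min r1 r2)" and y: "\<bar>y - xs \<tau>\<bar> < min e (min r1 r2)"
      and w: "\<bar>w - w0\<bar> \<le> L * (\<bar>y - xs \<tau>0\<bar> + \<bar>\<tau> - \<tau>0\<bar>)"
    have "\<bar>y - xs \<tau>0\<bar> + \<bar>\<tau> - \<tau>0\<bar> \<le> 3 * e" using r1[of \<tau>] \<tau> y by auto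
    then have "\<bar>w - w0\<bar> \<le> L * (3 * e)" using w \<open>L \<ge> 0\<close> by (meson mult_left_mono order_trans)
    also have "\<dots> < (L + 1) * (3 * e)" using \<open>e > 0\<close> by (intro mult_strict_right_mono) auto
    also have "\<dots> = d / 2" using Le by simp
    finally have "\<bar>w - w0\<bar> < d / 2" .
    moreover have "\<bar>xs' \<tau> - xs' \<tau>0\<bar> < d / 2" using r2 \<tau> by auto
    ultimately have "dist (xs' \<tau>, w) (xs' \<tau>0, w0) < d"
      using sqrt_sum_squares_le_sum_abs[of "xs' \<tau> - xs' \<tau>0" "w - w0"]
      by (auto simp: dist_prod_def dist_real_def)
    from d[OF this] show "\<bar>(F w - xs' \<tau> * w) - (F w0 - xs' \<tau>0 * w0)\<bar> \<le> \<eta>" by simp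
  qed (use \<open>e > 0\<close> \<open>r1 > 0\<close> \<open>r2 > 0\<close> in auto)
qed

section \<open>A concentrating test function\<close>

text \<open>
  A polynomial bump: its integral and the integral of its slope over a half-line are explicit, and
  it is only \<open>C\<^sup>1\<close>, which is all that test functions have to be.
\<close>

definition bump :: "real \<Rightarrow> real" where "bump z = (max 0 (1 - z\<^sup>2))\<^sup>2"

definition bump' :: "real \<Rightarrow> real" where "bump' z = - 4 * z * max 0 (1 - z\<^sup>2)"

lemma bump_has_derivative [derivative_intros]:
  assumes "(f has_real_derivative f') (at x within S)"
  shows "((\<lambda>x. bump (f x)) has_real_derivative bump' (f x) * f') (at x within S)"
proof -
  have sq: "((\<lambda>w::real. (max 0 w)\<^sup>2) has_real_derivative 2 * max 0 w) (at w)" for w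
  proof (cases w "0::real" rule: linorder_cases)
    case less
    have ev: "\<forall>\<^sub>F y in nhds w. (0::real) = (max 0 y)\<^sup>2"
      using eventually_nhds_in_open[of "{..<0}" w] less by (auto elim!: eventually_mono simp: max_def)
    have "2 * max 0 w = 0" using less by simp
    then show ?thesis
      using iffD1[OF DERIV_cong_ev[OF refl ev refl] DERIV_const] by metis
  next
    case equal
    have "((\<lambda>h. max 0 h) \<longlongrightarrow> max 0 0) (at (0::real))" by (intro tendsto_intros)
    moreover have "(\<lambda>h. ((max 0 (w + h))\<^sup>2 - (max 0 w)\<^sup>2) / h) = (\<lambda>h. max 0 h)"
      using equal by (auto simp: fun_eq_iff max_def power2_eq_square)
    ultimately show ?thesis using equal by (simp add: DERIV_def)
  next
    case greater
    have ev: "\<forall>\<^sub>F y in nhds w. y\<^sup>2 = (max 0 y)\<^sup>2"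
      using eventually_nhds_in_open[of "{0<..}" w] greater by (auto elim!: eventually_mono simp: max_def)
    have "((\<lambda>y. y\<^sup>2) has_real_derivative 2 * w) (at w)" by (auto intro!: derivative_eq_intros)
    moreover have "2 * max 0 w = 2 * w" using greater by simp
    ultimately show ?thesis using DERIV_cong_ev[OF refl ev refl, of "2 * w"] by metis
  qed
  have "((\<lambda>z. 1 - z\<^sup>2) has_real_derivative - 2 * f x) (at (f x))" by (auto intro!: derivative_eq_intros)
  from DERIV_chain2[OF sq this] have "(bump has_real_derivative bump' (f x)) (at (f x))"
    by (simp add: bump_def[abs_def] bump'_def mult_ac)
  from DERIV_chain2[OF this assms] show ?thesis .
qed

lemma continuous_on_bump [continuous_intros]:
  "continuous_on S f \<Longrightarrow> continuous_on S (\<lambda>x. bump (f x))"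
  "continuous_on S f \<Longrightarrow> continuous_on S (\<lambda>x. bump' (f x))"
  unfolding bump_def bump'_def by (intro continuous_intros; assumption)+

lemma bump_outside: "\<bar>z\<bar> \<ge> 1 \<Longrightarrow> bump z = 0" "\<bar>z\<bar> \<ge> 1 \<Longrightarrow> bump' z = 0"
  using one_le_power[of "\<bar>z\<bar>" 2] by (auto simp: bump_def bump'_def max_def)

lemma bump_bounds: "0 \<le> bump z" "bump z \<le> 1"
  by (auto simp: bump_def max_def power_le_one)

lemma bump'_sign: "z \<le> 0 \<Longrightarrow> 0 \<le> bump' z" "0 \<le> z \<Longrightarrow> bump' z \<le> 0"
proof -
  have eq: "bump' z = - z * (4 * max 0 (1 - z\<^sup>2))" by (simp add: bump'_def)
  show "0 \<le> bump' z" if "z \<le> 0" unfolding eq using that by (intro mult_nonneg_nonneg) auto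
  show "bump' z \<le> 0" if "0 \<le> z" unfolding eq using that by (intro mult_nonpos_nonneg) auto
qed

lemma bump_at_zero: "bump 0 = 1" "bump' 0 = 0"
  by (auto simp: bump_def bump'_def)

lemma bump_integral:
  assumes "\<rho> > 0"
  shows "has_bochner_integral lborel (\<lambda>\<tau>. bump ((\<tau> - \<tau>0) / \<rho>)) (16 / 15 * \<rho>)"
proof -
  define P where "P = (\<lambda>\<tau>. \<rho> * (((\<tau> - \<tau>0) / \<rho>) - 2 / 3 * ((\<tau> - \<tau>0) / \<rho>) ^ 3 + 1 / 5 * ((\<tau> - \<tau>0) / \<rho>) ^ 5))"
  have "has_bochner_integral lborel (\<lambda>\<tau>. indicator {\<tau>0 - \<rho>..\<tau>0 + \<rho>} \<tau> *\<^sub>R bump ((\<tau> - \<tau>0) / \<rho>))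
      (P (\<tau>0 + \<rho>) - P (\<tau>0 - \<rho>))"
  proof (rule has_bochner_integral_FTC_Icc)
    fix \<tau> assume \<tau>: "\<tau>0 - \<rho> \<le> \<tau>" "\<tau> \<le> \<tau>0 + \<rho>"
    have "\<bar>(\<tau> - \<tau>0) / \<rho>\<bar> \<le> 1" using \<tau> assms by (auto simp: abs_le_iff divide_le_eq le_divide_eq)
    then have "((\<tau> - \<tau>0) / \<rho>)\<^sup>2 \<le> 1" by (simp add: abs_square_le_1)
    then have b: "bump ((\<tau> - \<tau>0) / \<rho>) = (1 - ((\<tau> - \<tau>0) / \<rho>)\<^sup>2)\<^sup>2"
      by (simp add: bump_def max_def)
    have "(P has_real_derivative (1 - ((\<tau> - \<tau>0) / \<rho>)\<^sup>2)\<^sup>2) (at \<tau> within {\<tau>0 - \<rho>..\<tau>0 + \<rho>})"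
      unfolding P_def using assms
      by (auto intro!: derivative_eq_intros simp: power2_eq_square eval_nat_numeral field_simps)
    then show "(P has_vector_derivative bump ((\<tau> - \<tau>0) / \<rho>)) (at \<tau> within {\<tau>0 - \<rho>..\<tau>0 + \<rho>})"
      by (simp add: b has_real_derivative_iff_has_vector_derivative)
  qed (use assms in \<open>auto intro!: continuous_intros\<close>)
  moreover have "P (\<tau>0 + \<rho>) - P (\<tau>0 - \<rho>) = 16 / 15 * \<rho>" using assms by (simp add: P_def)
  moreover have "indicator {\<tau>0 - \<rho>..\<tau>0 + \<rho>} \<tau> *\<^sub>R bump ((\<tau> - \<tau>0) / \<rho>) = bump ((\<tau> - \<tau>0) / \<rho>)" for \<tau>
  proof (cases "\<tau> \<in> {\<tau>0 - \<rho>..\<tau>0 + \<rho>}")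
    case False
    then have "\<bar>\<tau> - \<tau>0\<bar> \<ge> \<rho>" by (auto simp: abs_if)
    then have "\<bar>(\<tau> - \<tau>0) / \<rho>\<bar> \<ge> 1" using assms by (simp add: abs_divide le_divide_eq)
    then show ?thesis using bump_outside(1) by simp
  qed simp
  ultimately show ?thesis by (simp only:)
qed

text \<open>
  The rescaled slope has mass \<open>1\<close> on the left of \<open>X\<close> and \<open>- 1\<close> on the right, so it extracts the
  jump of a function at \<open>X\<close>, independently of the scale \<open>\<epsilon>\<close>.
\<close>

lemma bump_slope_integral:
  assumes "\<epsilon> > 0"
  shows "has_bochner_integral lborel (\<lambda>y. bump' ((y - X) / \<epsilon>) / \<epsilon> * (if y < X then p else q)) (p - q)"
proof -
  have int: "has_bochner_integral lborel (\<lambda>y. indicator {a..b} y *\<^sub>R (bump' ((y - X) / \<epsilon>) / \<epsilon>))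
      (bump ((b - X) / \<epsilon>) - bump ((a - X) / \<epsilon>))" if "a \<le> b" for a b
  proof (rule has_bochner_integral_FTC_Icc[OF that])
    fix y
    have "((\<lambda>y. bump ((y - X) / \<epsilon>)) has_real_derivative bump' ((y - X) / \<epsilon>) / \<epsilon>) (at y within {a..b})"
      using assms by (auto intro!: derivative_eq_intros)
    then show "((\<lambda>y. bump ((y - X) / \<epsilon>)) has_vector_derivative bump' ((y - X) / \<epsilon>) / \<epsilon>) (at y within {a..b})"
      by (simp add: has_real_derivative_iff_has_vector_derivative)
  qed (use assms in \<open>auto intro!: continuous_intros\<close>)
  have "has_bochner_integral lborel
    (\<lambda>y. p * (indicator {X - \<epsilon>..X} y *\<^sub>R (bump' ((y - X) / \<epsilon>) / \<epsilon>)) + q * (indicator {X..X + \<epsilon>} y *\<^sub>R (bump' ((y - X) / \<epsilon>) / \<epsilon>)))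
    (p * (bump ((X - X) / \<epsilon>) - bump ((X - \<epsilon> - X) / \<epsilon>)) + q * (bump ((X + \<epsilon> - X) / \<epsilon>) - bump ((X - X) / \<epsilon>)))"
    by (intro has_bochner_integral_add has_bochner_integral_mult_right int) (use assms in auto)
  moreover have "p * (bump ((X - X) / \<epsilon>) - bump ((X - \<epsilon> - X) / \<epsilon>)) + q * (bump ((X + \<epsilon> - X) / \<epsilon>) - bump ((X - X) / \<epsilon>)) = p - q"
    using assms by (simp add: bump_at_zero bump_outside)
  moreover have "p * (indicator {X - \<epsilon>..X} y *\<^sub>R (bump' ((y - X) / \<epsilon>) / \<epsilon>)) + q * (indicator {X..X + \<epsilon>} y *\<^sub>R (bump' ((y - X) / \<epsilon>) / \<epsilon>))
      = bump' ((y - X) / \<epsilon>) / \<epsilon> * (if y < X then p else q)" for y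
  proof (cases "\<bar>y - X\<bar> \<ge> \<epsilon> \<or> y = X")
    case True
    then have "bump' ((y - X) / \<epsilon>) = 0"
      using assms bump_outside(2)[of "(y - X) / \<epsilon>"] bump_at_zero by auto
    then show ?thesis by simp
  next
    case False
    then show ?thesis by (auto simp: indicator_def abs_if split: if_splits)
  qed
  ultimately show ?thesis by simp
qed

lemma graph_null_set:
  fixes X :: "real \<Rightarrow> real"
  assumes X: "continuous_on UNIV X"
  shows "{(y, \<tau>). y = X \<tau>} \<in> null_sets (lborel :: (real \<times> real) measure)"
proof -
  let ?G = "{(y, \<tau>). y = X \<tau>}"
  have "closed ?G"
    using closed_Collect_eq[of fst "\<lambda>p. X (snd p)"] continuous_on_compose2[OF X, of UNIV snd]
    by (simp add: case_prod_beta' continuous_on_fst continuous_on_snd)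
  then have sets: "?G \<in> sets (lborel \<Otimes>\<^sub>M lborel)" by (simp only: lborel_prod sets_lborel borel_closed)
  have "emeasure (lborel \<Otimes>\<^sub>M lborel) ?G = (\<integral>\<^sup>+\<tau>. emeasure lborel ((\<lambda>y. (y, \<tau>)) -` ?G) \<partial>lborel)"
    by (rule lborel_pair.emeasure_pair_measure_alt2[OF sets])
  also have "\<dots> = (\<integral>\<^sup>+\<tau>. 0 \<partial>lborel)"
    by (simp add: vimage_def)
  finally have "emeasure (lborel \<Otimes>\<^sub>M lborel) ?G = 0" by simp
  then show ?thesis using sets unfolding lborel_prod by (rule null_setsI)
qed

text \<open>
  The two-dimensional version: the slope across the curve \<open>y = X \<tau>\<close>, localised in time by a bump
  around \<open>\<tau>0\<close>. The factor \<open>16 / 15\<close> is the integral of \<open>bump\<close>.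
\<close>

lemma shock_kernel_integral:
  fixes X :: "real \<Rightarrow> real"
  assumes X: "continuous_on UNIV X" and "\<epsilon> > 0" "\<rho> > 0"
  shows "has_bochner_integral lborel
     (\<lambda>(y, \<tau>). bump ((\<tau> - \<tau>0) / \<rho>) * (bump' ((y - X \<tau>) / \<epsilon>) / \<epsilon>) * (if y < X \<tau> then p else q)) ((p - q) * (16 / 15 * \<rho>))"
proof -
  let ?k = "\<lambda>p q (y, \<tau>). bump ((\<tau> - \<tau>0) / \<rho>) * (bump' ((y - X \<tau>) / \<epsilon>) / \<epsilon>) * (if y < X \<tau> then p else q :: real)"
  have meas: "?k p q \<in> borel_measurable (lborel \<Otimes>\<^sub>M lborel)" for p q
  proof -
    have Xs: "continuous_on UNIV (\<lambda>p :: real \<times> real. X (snd p))"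
      by (rule continuous_on_compose2[OF X]) (auto intro: continuous_on_snd)
    have "continuous_on UNIV (\<lambda>p. bump ((snd p - \<tau>0) / \<rho>) * (bump' ((fst p - X (snd p)) / \<epsilon>) / \<epsilon>))"
      by (intro continuous_intros Xs) (use assms in auto)
    then have "(\<lambda>p. bump ((snd p - \<tau>0) / \<rho>) * (bump' ((fst p - X (snd p)) / \<epsilon>) / \<epsilon>)) \<in> borel_measurable borel"
      by (rule borel_measurable_continuous_onI)
    moreover have "{p :: real \<times> real. fst p < X (snd p)} \<in> sets borel"
      by (intro borel_open open_Collect_less Xs continuous_intros)
    then have "(\<lambda>r :: real \<times> real. if fst r < X (snd r) then p else q) \<in> borel_measurable borel"
      by (intro measurable_If borel_measurable_const) simp
    ultimately have "(\<lambda>r. bump ((snd r - \<tau>0) / \<rho>) * (bump' ((fst r - X (snd r)) / \<epsilon>) / \<epsilon>) *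
        (if fst r < X (snd r) then p else q)) \<in> borel_measurable borel"
      by (rule borel_measurable_times)
    then show ?thesis
      unfolding lborel_prod case_prod_beta' by (subst measurable_cong_sets[OF sets_lborel refl])
  qed
  have inner: "has_bochner_integral lborel (\<lambda>y. ?k p q (y, \<tau>)) (bump ((\<tau> - \<tau>0) / \<rho>) * (p - q))" for \<tau> p q
    using has_bochner_integral_mult_right[OF bump_slope_integral[OF \<open>\<epsilon> > 0\<close>], of "bump ((\<tau> - \<tau>0) / \<rho>)"]
    by (simp add: mult.assoc)
  have norm_k: "norm (?k p q (y, \<tau>)) = ?k \<bar>p\<bar> (- \<bar>q\<bar>) (y, \<tau>)" for y \<tau> p q
  proof -
    have "bump' ((y - X \<tau>) / \<epsilon>) \<ge> 0" if "y < X \<tau>"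
      using that \<open>\<epsilon> > 0\<close> by (intro bump'_sign) (simp add: divide_le_0_iff)
    moreover have "bump' ((y - X \<tau>) / \<epsilon>) \<le> 0" if "\<not> y < X \<tau>"
      using that \<open>\<epsilon> > 0\<close> by (intro bump'_sign) simp
    ultimately show ?thesis
      using bump_bounds(1) \<open>\<epsilon> > 0\<close> by (simp add: abs_mult)
  qed
  have int: "integrable (lborel \<Otimes>\<^sub>M lborel) (?k p q)"
  proof -
    have "integrable (lborel \<Otimes>\<^sub>M lborel) (\<lambda>(\<tau>, y). ?k p q (y, \<tau>))"
    proof (rule lborel_pair.Fubini_integrable)
      show "(\<lambda>(\<tau>, y). ?k p q (y, \<tau>)) \<in> borel_measurable (lborel \<Otimes>\<^sub>M lborel)"
        by (rule measurable_pair_swap[OF meas])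
      have "(\<lambda>\<tau>. \<integral>y. norm (case (\<tau>, y) of (\<tau>, y) \<Rightarrow> ?k p q (y, \<tau>)) \<partial>lborel)
          = (\<lambda>\<tau>. bump ((\<tau> - \<tau>0) / \<rho>) * (\<bar>p\<bar> + \<bar>q\<bar>))"
        unfolding prod.case(1)[of _ "_::real" "_::real"] norm_k[unfolded prod.case] 
        using has_bochner_integral_integral_eq[OF inner[of "\<bar>p\<bar>" "- \<bar>q\<bar>"]] by simp
      then show "integrable lborel (\<lambda>\<tau>. \<integral>y. norm (case (\<tau>, y) of (\<tau>, y) \<Rightarrow> ?k p q (y, \<tau>)) \<partial>lborel)"
        using has_bochner_integral_mult_left[OF bump_integral[OF \<open>\<rho> > 0\<close>]]
        by (simp add: has_bochner_integral_iff)
      show "AE \<tau> in lborel. integrable lborel (\<lambda>y. case (\<tau>, y) of (\<tau>, y) \<Rightarrow> ?k p q (y, \<tau>))"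
        using inner by (simp add: has_bochner_integral_iff)
    qed
    from lborel_pair.integrable_product_swap[OF this] show ?thesis by (simp add: case_prod_beta')
  qed
  have "integral\<^sup>L (lborel \<Otimes>\<^sub>M lborel) (?k p q) = (\<integral>\<tau>. (\<integral>y. ?k p q (y, \<tau>) \<partial>lborel) \<partial>lborel)"
    using lborel_pair.integral_snd[of "\<lambda>y \<tau>. ?k p q (y, \<tau>)"] int by simp
  also have "\<dots> = (\<integral>\<tau>. bump ((\<tau> - \<tau>0) / \<rho>) * (p - q) \<partial>lborel)"
    by (rule Bochner_Integration.integral_cong[OF refl has_bochner_integral_integral_eq[OF inner]])
  also have "\<dots> = (p - q) * (16 / 15 * \<rho>)"
    using has_bochner_integral_integral_eq[OF has_bochner_integral_mult_left[where c = "p - q", OF bump_integral[OF \<open>\<rho> > 0\<close>, of \<tau>0]]]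
    by (simp only: mult.commute)
  finally show ?thesis using int by (simp add: has_bochner_integral_iff lborel_prod)
qed

section \<open>The Rankine-Hugoniot condition\<close>

lemma integrable_mult_continuous:
  fixes f g :: "'a::euclidean_space \<Rightarrow> real"
  assumes f: "integrable lborel f" and "compact K" and f0: "\<And>p. p \<notin> K \<Longrightarrow> f p = 0"
    and g: "continuous_on UNIV g"
  shows "integrable lborel (\<lambda>p. f p * g p)"
proof -
  have "bounded (g ` K)"
    using \<open>compact K\<close> g by (meson compact_continuous_image compact_imp_bounded continuous_on_subset subset_UNIV)
  then obtain C where C: "\<And>p. p \<in> K \<Longrightarrow> \<bar>g p\<bar> \<le> C"
    by (auto simp: bounded_iff)
  have bound: "\<bar>f p * g p\<bar> \<le> \<bar>C * f p\<bar>" for p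
  proof (cases "p \<in> K")
    case True
    then have "\<bar>g p\<bar> * \<bar>f p\<bar> \<le> \<bar>C\<bar> * \<bar>f p\<bar>" using C[of p] by (intro mult_right_mono) auto
    then show ?thesis by (simp add: abs_mult mult.commute)
  qed (simp add: f0)
  have "g \<in> borel_measurable borel" by (rule borel_measurable_continuous_onI[OF g])
  then have meas: "(\<lambda>p. f p * g p) \<in> borel_measurable lborel"
    using borel_measurable_integrable[OF f] by (intro borel_measurable_times) simp_all
  show ?thesis
    by (rule Bochner_Integration.integrable_bound[OF integrable_mult_right[OF f, of C] meas])
      (simp only: real_norm_def bound AE_I2)
qed

text \<open>
  The weak formulation is tested with \<open>\<phi> = bump ((y - xs \<tau>) / \<epsilon>) \<psi>(\<tau>)\<close>, where \<open>\<psi>\<close> is a bump around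
  \<open>\<tau>0\<close>. The terms with a derivative across the shock carry a factor \<open>1 / \<epsilon>\<close> and together are the
  kernel of \<open>shock_kernel_integral\<close> times \<open>F(u) - xs' u\<close>. On the small support of \<open>\<phi>\<close> this factor
  is within \<open>\<eta>\<close> of the constants \<open>cL\<close> and \<open>cR\<close>. All other terms, including the source, tend to 0
  with \<open>\<epsilon>\<close> by dominated convergence, since the support of \<open>\<phi>\<close> shrinks to the null set \<open>y = xs \<tau>\<close>.
  Comparing the two limits gives \<open>|cL - cR| \<le> 2 \<eta>\<close>.
\<close>

lemma shock_speed_identity:
  assumes weak: "weak_solution U F D Q g T u" and "0 \<le> t" "t1 \<le> T"
    and shock: "isolated_shock U u {t..<t1} xs uL uR"
    and F_cont: "\<And>w. w \<in> U \<Longrightarrow> isCont F w"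
    and xs'_cont: "continuous_on {t..<t1} xs'"
    and xs_der: "\<And>\<tau>. \<tau> \<in> {t..<t1} \<Longrightarrow> (xs has_real_derivative xs' \<tau>) (at \<tau> within {t..<t1})"
    and \<tau>0: "t < \<tau>0" "\<tau>0 < t1"
  shows "F (uL \<tau>0) - xs' \<tau>0 * uL \<tau>0 = F (uR \<tau>0) - xs' \<tau>0 * uR \<tau>0"
proof -
  define cL where "cL = F (uL \<tau>0) - xs' \<tau>0 * uL \<tau>0"
  define cR where "cR = F (uR \<tau>0) - xs' \<tau>0 * uR \<tau>0"
  let ?I = "{t..<t1}"
  have \<tau>0I: "\<tau>0 \<in> ?I" using \<tau>0 by simp
  have uU: "uL \<tau>0 \<in> U" "uR \<tau>0 \<in> U" using shock \<tau>0I unfolding isolated_shock_def by blast+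
  have xs_cont: "continuous_on ?I xs"
    using xs_der DERIV_continuous continuous_on_eq_continuous_within by blast
  define \<rho>0 where "\<rho>0 = min (\<tau>0 - t) (t1 - \<tau>0) / 2"
  have \<rho>0: "\<rho>0 > 0" "t < \<tau>0 - \<rho>0" "\<tau>0 + \<rho>0 < t1" using \<tau>0 by (auto simp: \<rho>0_def min_def field_simps)
  \<comment> \<open>The shock path is extended continuously to all times, which makes the test function and its
    derivatives globally defined; they vanish where the extension differs from \<open>xs\<close>.\<close>
  define clamp where "clamp \<tau> = max (\<tau>0 - \<rho>0) (min (\<tau>0 + \<rho>0) \<tau>)" for \<tau>
  have clamp: "clamp \<tau> \<in> {\<tau>0 - \<rho>0..\<tau>0 + \<rho>0}" for \<tau> using \<rho>0 by (auto simp: clamp_def)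
  have clamp_id: "clamp \<tau> = \<tau>" if "\<bar>\<tau> - \<tau>0\<bar> \<le> \<rho>0" for \<tau> using that by (auto simp: clamp_def abs_le_iff)
  have clampI: "clamp \<tau> \<in> ?I" for \<tau> using clamp[of \<tau>] \<rho>0 by auto
  define X where "X \<tau> = xs (clamp \<tau>)" for \<tau>
  define X' where "X' \<tau> = xs' (clamp \<tau>)" for \<tau>
  have clamp_cont: "continuous_on UNIV clamp" unfolding clamp_def by (intro continuous_intros)
  have X_cont: "continuous_on UNIV X" "continuous_on UNIV X'"
    unfolding X_def X'_def using clampI
    by (auto intro!: continuous_on_compose2[OF xs_cont clamp_cont] continuous_on_compose2[OF xs'_cont clamp_cont])
  have X_der: "(X has_real_derivative X' \<tau>) (at \<tau>)" if "\<bar>\<tau> - \<tau>0\<bar> < \<rho>0" for \<tau>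
  proof -
    have "\<tau> \<in> interior ?I" using that \<rho>0 by (auto simp: abs_less_iff)
    then have "(xs has_real_derivative xs' \<tau>) (at \<tau>)"
      using xs_der[of \<tau>] at_within_interior interior_subset by fastforce
    moreover have "\<forall>\<^sub>F y in nhds \<tau>. xs y = X y"
    proof -
      have "\<forall>\<^sub>F y in nhds \<tau>. y \<in> {\<tau>0 - \<rho>0<..<\<tau>0 + \<rho>0}"
        using that by (intro eventually_nhds_in_open) (auto simp: abs_less_iff)
      then show ?thesis by eventually_elim (auto simp: X_def clamp_id abs_le_iff)
    qed
    ultimately show ?thesis
      using DERIV_cong_ev[OF refl, of xs X \<tau> "xs' \<tau>" "X' \<tau>"] that by (simp add: X'_def clamp_id)
  qed
  have "bounded (xs ` {\<tau>0 - \<rho>0..\<tau>0 + \<rho>0})"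
    using \<rho>0 by (intro compact_imp_bounded compact_continuous_image continuous_on_subset[OF xs_cont]) auto
  then obtain B where "\<forall>\<tau>\<in>{\<tau>0 - \<rho>0..\<tau>0 + \<rho>0}. \<bar>xs \<tau>\<bar> \<le> B"
    by (auto simp: bounded_iff)
  then have B: "\<bar>X \<tau>\<bar> \<le> B" for \<tau>
    unfolding X_def using clamp by blast
  have "\<bar>cL - cR\<bar> \<le> 2 * \<eta>" if "\<eta> > 0" for \<eta>
  proof -
    obtain r L where "r > 0" "L \<ge> 0" and
      left: "\<And>y \<tau>. \<lbrakk>\<tau> \<in> ?I; \<bar>\<tau> - \<tau>0\<bar> < r; xs \<tau> - r < y; y < xs \<tau>\<rbrakk> \<Longrightarrow>
         \<bar>u y \<tau> - uL \<tau>0\<bar> \<le> L * (\<bar>y - xs \<tau>0\<bar> + \<bar>\<tau> - \<tau>0\<bar>)" and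
      right: "\<And>y \<tau>. \<lbrakk>\<tau> \<in> ?I; \<bar>\<tau> - \<tau>0\<bar> < r; xs \<tau> < y; y < xs \<tau> + r\<rbrakk> \<Longrightarrow>
         \<bar>u y \<tau> - uR \<tau>0\<bar> \<le> L * (\<bar>y - xs \<tau>0\<bar> + \<bar>\<tau> - \<tau>0\<bar>)"
      using isolated_shock_estimates[OF shock \<tau>0I] by metis
    have conts: "continuous (at \<tau>0 within ?I) xs" "continuous (at \<tau>0 within ?I) xs'"
      using xs_cont xs'_cont \<tau>0I by (auto simp: continuous_on_eq_continuous_within)
    obtain \<rho>L where "\<rho>L > 0" and \<rho>L:
      "\<And>\<tau> y w. \<lbrakk>\<tau> \<in> ?I; \<bar>\<tau> - \<tau>0\<bar> < \<rho>L; \<bar>y - xs \<tau>\<bar> < \<rho>L; \<bar>w - uL \<tau>0\<bar> \<le> L * (\<bar>y - xs \<tau>0\<bar> + \<bar>\<tau> - \<tau>0\<bar>)\<rbrakk> \<Longrightarrow>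
         \<bar>(F w - xs' \<tau> * w) - cL\<bar> \<le> \<eta>"
      using flux_defect_small[OF F_cont[OF uU(1)] conts \<open>L \<ge> 0\<close> \<open>\<eta> > 0\<close>] unfolding cL_def by metis
    obtain \<rho>R where "\<rho>R > 0" and \<rho>R:
      "\<And>\<tau> y w. \<lbrakk>\<tau> \<in> ?I; \<bar>\<tau> - \<tau>0\<bar> < \<rho>R; \<bar>y - xs \<tau>\<bar> < \<rho>R; \<bar>w - uR \<tau>0\<bar> \<le> L * (\<bar>y - xs \<tau>0\<bar> + \<bar>\<tau> - \<tau>0\<bar>)\<rbrakk> \<Longrightarrow>
         \<bar>(F w - xs' \<tau> * w) - cR\<bar> \<le> \<eta>"
      using flux_defect_small[OF F_cont[OF uU(2)] conts \<open>L \<ge> 0\<close> \<open>\<eta> > 0\<close>] unfolding cR_def by metis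
    define \<rho> where "\<rho> = Min {\<rho>0, r, \<rho>L, \<rho>R} / 2"
    have \<rho>: "\<rho> > 0" "\<rho> < \<rho>0" "\<rho> < r" "\<rho> < \<rho>L" "\<rho> < \<rho>R"
      using \<open>r > 0\<close> \<open>\<rho>L > 0\<close> \<open>\<rho>R > 0\<close> \<rho>0(1) by (auto simp: \<rho>_def min_def)
    define \<psi> where "\<psi> \<tau> = bump ((\<tau> - \<tau>0) / \<rho>)" for \<tau>
    define \<psi>' where "\<psi>' \<tau> = bump' ((\<tau> - \<tau>0) / \<rho>) / \<rho>" for \<tau>
    have \<psi>_der: "(\<psi> has_real_derivative \<psi>' \<tau>) (at \<tau>)" for \<tau>
      unfolding \<psi>_def \<psi>'_def using \<rho>(1) by (auto intro!: derivative_eq_intros)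
    have \<psi>_cont: "continuous_on UNIV \<psi>" "continuous_on UNIV \<psi>'"
      unfolding \<psi>_def \<psi>'_def using \<rho>(1) by (auto intro!: continuous_intros)
    have \<psi>_out: "\<psi> \<tau> = 0 \<and> \<psi>' \<tau> = 0" if "\<bar>\<tau> - \<tau>0\<bar> \<ge> \<rho>" for \<tau>
      using that \<rho>(1) bump_outside[of "(\<tau> - \<tau>0) / \<rho>"] by (simp add: \<psi>_def \<psi>'_def abs_divide)
    define K where "K = {- B - \<rho>..B + \<rho>} \<times> {\<tau>0 - \<rho>..\<tau>0 + \<rho>}"
    have "compact K" unfolding K_def by (intro compact_Times) auto
    have KT: "K \<subseteq> UNIV \<times> {0..<T}" using \<rho> \<rho>0 \<open>0 \<le> t\<close> \<open>t1 \<le> T\<close> by (auto simp: K_def)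
    have outK: "\<rho> < \<bar>\<tau> - \<tau>0\<bar> \<or> \<rho> < \<bar>y - X \<tau>\<bar>" if "(y, \<tau>) \<notin> K" for y \<tau>
      using that B[of \<tau>] unfolding K_def by (auto simp: abs_if split: if_splits)
    \<comment> \<open>The solution is integrable on compact sets only, so it is cut off outside the box \<open>K\<close>, which
      contains the supports of all test functions used below.\<close>
    define U1 where "U1 p = indicator K p * (case p of (y, \<tau>) \<Rightarrow> u y \<tau>)" for p :: "real \<times> real"
    define U2 where "U2 p = indicator K p * (case p of (y, \<tau>) \<Rightarrow> F (u y \<tau>))" for p :: "real \<times> real"
    define U3 where "U3 p = indicator K p * (case p of (y, \<tau>) \<Rightarrow> Q (u y \<tau>, y, \<tau>))" for p :: "real \<times> real"
    have U_int: "integrable lborel U1" "integrable lborel U2" "integrable lborel U3"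
      using weak \<open>compact K\<close> KT unfolding weak_solution_def set_integrable_def U1_def[abs_def] U2_def[abs_def] U3_def[abs_def]
      by simp_all
    have U_out: "p \<notin> K \<Longrightarrow> U1 p = 0" "p \<notin> K \<Longrightarrow> U2 p = 0" "p \<notin> K \<Longrightarrow> U3 p = 0" for p
      by (auto simp: U1_def U2_def U3_def)
    note U_mult = integrable_mult_continuous[OF U_int(1) \<open>compact K\<close> U_out(1)]
      integrable_mult_continuous[OF U_int(2) \<open>compact K\<close> U_out(2)]
      integrable_mult_continuous[OF U_int(3) \<open>compact K\<close> U_out(3)]
    have snd_cont: "continuous_on UNIV (\<lambda>p :: real \<times> real. h (snd p))" if "continuous_on UNIV h" for h :: "real \<Rightarrow> real"
      by (rule continuous_on_compose2[OF that]) (auto intro: continuous_on_snd)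
    define W where "W p = U1 p * \<psi>' (snd p) + U3 p * \<psi> (snd p)" for p
    have W_int: "integrable lborel W"
      unfolding W_def by (intro Bochner_Integration.integrable_add U_mult snd_cont \<psi>_cont)
    define Rest where "Rest \<epsilon> p = W p * bump ((fst p - X (snd p)) / \<epsilon>)" for \<epsilon> p
    have bound: "\<bar>(cL - cR) * (16 / 15 * \<rho>) + integral\<^sup>L lborel (Rest \<epsilon>)\<bar> \<le> 2 * \<eta> * (16 / 15 * \<rho>)"
      if \<epsilon>: "0 < \<epsilon>" "\<epsilon> \<le> \<rho>" for \<epsilon>
    proof -
      define z where "z p = (fst p - X (snd p)) / \<epsilon>" for p
      define \<phi> where "\<phi> p = bump (z p) * \<psi> (snd p)" for p
      define \<phi>x where "\<phi>x p = \<psi> (snd p) * (bump' (z p) / \<epsilon>)" for p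
      define \<phi>t where "\<phi>t p = \<psi>' (snd p) * bump (z p) - \<psi> (snd p) * (bump' (z p) / \<epsilon>) * X' (snd p)" for p
      have z_cont: "continuous_on UNIV z"
        unfolding z_def by (intro continuous_intros snd_cont X_cont) (use \<epsilon> in auto)
      have cont: "continuous_on UNIV \<phi>" "continuous_on UNIV \<phi>x" "continuous_on UNIV \<phi>t"
        unfolding \<phi>_def[abs_def] \<phi>x_def[abs_def] \<phi>t_def[abs_def]
        by (intro continuous_intros z_cont snd_cont X_cont \<psi>_cont; use \<epsilon> in simp)+
      have out: "\<phi> p = 0" "\<phi>x p = 0" "\<phi>t p = 0" if "p \<notin> K" for p
      proof -
        have "\<rho> < \<bar>snd p - \<tau>0\<bar> \<or> \<rho> < \<bar>fst p - X (snd p)\<bar>"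
          using outK[of "fst p" "snd p"] that by simp
        then have "(\<psi> (snd p) = 0 \<and> \<psi>' (snd p) = 0) \<or> \<bar>z p\<bar> \<ge> 1"
          using \<psi>_out[of "snd p"] \<epsilon> by (auto simp: z_def abs_divide)
        then show "\<phi> p = 0" "\<phi>x p = 0" "\<phi>t p = 0"
          using bump_outside[of "z p"] by (auto simp: \<phi>_def \<phi>x_def \<phi>t_def)
      qed
      have \<phi>_der: "(\<phi> has_derivative (\<lambda>(h, k). \<phi>x p * h + \<phi>t p * k)) (at p)" for p
      proof (cases "\<bar>snd p - \<tau>0\<bar> < \<rho>0")
        case True
        have Xs: "((\<lambda>p. X (snd p)) has_derivative (\<lambda>h. snd h * X' (snd p))) (at p)"
          by (rule DERIV_compose_FDERIV[where f = X and g = snd, OF X_der[OF True]]) (auto intro!: derivative_eq_intros)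
        have "(z has_derivative (\<lambda>h. (fst h - snd h * X' (snd p)) / \<epsilon>)) (at p)"
          unfolding z_def[abs_def] using \<epsilon> by (auto intro!: derivative_eq_intros Xs)
        moreover have "(bump has_real_derivative bump' (z p)) (at (z p))"
          by (auto intro!: derivative_eq_intros)
        ultimately have bz: "((\<lambda>p. bump (z p)) has_derivative (\<lambda>h. (fst h - snd h * X' (snd p)) / \<epsilon> * bump' (z p))) (at p)"
          by (intro DERIV_compose_FDERIV[where f = bump and g = z])
        have \<psi>s: "((\<lambda>p. \<psi> (snd p)) has_derivative (\<lambda>h. snd h * \<psi>' (snd p))) (at p)"
          by (rule DERIV_compose_FDERIV[where f = \<psi> and g = snd, OF \<psi>_der]) (auto intro!: derivative_eq_intros)
        show ?thesis
          unfolding \<phi>_def[abs_def]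
          by (rule has_derivative_eq_rhs[OF has_derivative_mult[OF bz \<psi>s]])
            (use \<epsilon> in \<open>auto simp: fun_eq_iff \<phi>x_def \<phi>t_def field_simps\<close>)
      next
        case False
        then have far: "snd p \<in> - {\<tau>0 - \<rho>..\<tau>0 + \<rho>}" using \<rho> by (auto simp: abs_if split: if_splits)
        have "(\<phi> has_derivative (\<lambda>_. 0)) (at p)"
        proof (rule has_derivative_transform_within_open)
          show "((\<lambda>_. 0) has_derivative (\<lambda>_. 0)) (at p)" by simp
          show "open (UNIV \<times> (- {\<tau>0 - \<rho>..\<tau>0 + \<rho>}) :: (real \<times> real) set)"
            by (intro open_Times) auto
          show "p \<in> UNIV \<times> (- {\<tau>0 - \<rho>..\<tau>0 + \<rho>})" using far by (cases p) auto
          fix q :: "real \<times> real" assume "q \<in> UNIV \<times> (- {\<tau>0 - \<rho>..\<tau>0 + \<rho>})"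
          then have "\<bar>snd q - \<tau>0\<bar> \<ge> \<rho>" by auto
          then show "0 = \<phi> q" by (simp add: \<phi>_def \<psi>_out)
        qed
        moreover have "p \<notin> K" using far by (auto simp: K_def)
        then have "(\<lambda>(h, k). \<phi>x p * h + \<phi>t p * k) = (\<lambda>_. 0)" using out by auto
        ultimately show ?thesis by simp
      qed
      have test: "test_function T \<phi> \<phi>x \<phi>t"
        unfolding test_function_def using \<phi>_der cont out \<open>compact K\<close> KT by (auto intro!: exI[of _ K])
      define E where "E p = U1 p * \<phi>t p + U2 p * \<phi>x p + U3 p * \<phi> p" for p
      have E_int: "integrable lborel E"
        unfolding E_def by (intro Bochner_Integration.integrable_add U_mult cont)
      have "\<phi> (y, 0) = 0" for y
        using out(1)[of "(y, 0)"] \<rho> \<rho>0 \<open>0 \<le> t\<close> by (auto simp: K_def)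
      then have "(LINT y|lborel. g y * \<phi> (y, 0)) = 0" by simp
      then have "(LINT p:UNIV \<times> {0..<T}|lborel. (case p of (y, \<tau>) \<Rightarrow>
            u y \<tau> * \<phi>t (y, \<tau>) + F (u y \<tau>) * \<phi>x (y, \<tau>) + Q (u y \<tau>, y, \<tau>) * \<phi> (y, \<tau>))) = 0"
        using weak test unfolding weak_solution_def by (metis (no_types, lifting) add.right_neutral)
      moreover have "indicator (UNIV \<times> {0..<T}) p *\<^sub>R (case p of (y, \<tau>) \<Rightarrow>
            u y \<tau> * \<phi>t (y, \<tau>) + F (u y \<tau>) * \<phi>x (y, \<tau>) + Q (u y \<tau>, y, \<tau>) * \<phi> (y, \<tau>)) = E p" for p
      proof (cases "p \<in> K")
        case True
        then show ?thesis using KT by (auto simp: E_def U1_def U2_def U3_def split: prod.split)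
      next
        case False
        obtain y \<tau> where p: "p = (y, \<tau>)" by (cases p)
        show ?thesis using out[OF False, unfolded p] by (simp add: p E_def)
      qed
      ultimately have E0: "integral\<^sup>L lborel E = 0"
        unfolding set_lebesgue_integral_def by simp
      define k where "k p q = (\<lambda>(y, \<tau>). bump ((\<tau> - \<tau>0) / \<rho>) * (bump' ((y - X \<tau>) / \<epsilon>) / \<epsilon>) * (if y < X \<tau> then p else q))" for p q
      note k = shock_kernel_integral[OF X_cont(1) \<epsilon>(1) \<rho>(1), of \<tau>0, folded k_def]
      have k_eq: "k p q s = \<phi>x s * (if fst s < X (snd s) then p else q)" for p q s
        by (simp add: k_def \<phi>x_def \<psi>_def z_def case_prod_beta')
      have Rest_int: "integrable lborel (Rest \<epsilon>)"
      proof -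
        have "continuous_on UNIV (\<lambda>p. bump (z p))" by (intro continuous_intros z_cont)
        moreover have "W p = 0" if "p \<notin> K" for p using U_out that by (simp add: W_def)
        ultimately show ?thesis
          unfolding Rest_def[abs_def] z_def[symmetric]
          by (intro integrable_mult_continuous[OF W_int \<open>compact K\<close>]) auto
      qed
      \<comment> \<open>what is left when the shock states replace the solution in the singular terms\<close>
      define mid where "mid s = E s - k cL cR s - Rest \<epsilon> s" for s
      have mid_eq: "mid s = \<phi>x s * ((U2 s - X' (snd s) * U1 s) - (if fst s < X (snd s) then cL else cR))" for s
        unfolding mid_def k_eq E_def Rest_def W_def \<phi>_def \<phi>t_def \<phi>x_def z_def[symmetric] by (simp add: algebra_simps)
      have mid_bound: "norm (mid s) \<le> k \<eta> (- \<eta>) s" for s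
      proof (cases "\<phi>x s = 0")
        case True
        then show ?thesis by (simp add: mid_eq k_eq)
      next
        case False
        obtain y \<tau> where s: "s = (y, \<tau>)" by (cases s)
        have "s \<in> K" using out(2)[of s] False by blast
        have \<tau>: "\<bar>\<tau> - \<tau>0\<bar> < \<rho>" using False \<psi>_out[of \<tau>] by (force simp: \<phi>x_def s)
        have "\<bar>z s\<bar> < 1" using False bump_outside(2)[of "z s"] by (force simp: \<phi>x_def)
        then have y: "\<bar>y - X \<tau>\<bar> < \<rho>" using \<epsilon> by (simp add: z_def s abs_divide)
        have "z s \<noteq> 0" using False bump_at_zero by (auto simp: \<phi>x_def)
        then have "y \<noteq> X \<tau>" by (auto simp: z_def s)
        have XX: "X \<tau> = xs \<tau>" "X' \<tau> = xs' \<tau>" using \<tau> \<rho> by (auto simp: X_def X'_def clamp_id)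
        have \<tau>I: "\<tau> \<in> ?I" using \<tau> \<rho> \<rho>0 by (auto simp: abs_if split: if_splits)
        have UU: "U2 (y, \<tau>) - X' \<tau> * U1 (y, \<tau>) = F (u y \<tau>) - xs' \<tau> * u y \<tau>"
          using \<open>s \<in> K\<close> by (simp add: U1_def U2_def s XX)
        have \<psi>0: "\<psi> \<tau> \<ge> 0" by (simp add: \<psi>_def bump_bounds)
        show ?thesis
        proof (cases "y < X \<tau>")
          case True
          have "\<bar>F (u y \<tau>) - xs' \<tau> * u y \<tau> - cL\<bar> \<le> \<eta>"
            using \<tau> y \<rho> True XX by (intro \<rho>L[OF \<tau>I, of y] left[OF \<tau>I]) (auto simp: abs_if split: if_splits)
          moreover have "\<phi>x s \<ge> 0"
            using True \<epsilon> \<psi>0 bump'_sign(1)[of "z s"] by (simp add: \<phi>x_def s z_def divide_le_0_iff)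
          ultimately show ?thesis using True by (simp add: mid_eq k_eq UU abs_mult mult_left_mono s)
        next
          case False
          have "\<bar>F (u y \<tau>) - xs' \<tau> * u y \<tau> - cR\<bar> \<le> \<eta>"
            using \<tau> y \<rho> False XX \<open>y \<noteq> X \<tau>\<close> by (intro \<rho>R[OF \<tau>I, of y] right[OF \<tau>I]) (auto simp: abs_if split: if_splits)
          moreover have "\<phi>x s \<le> 0"
            using False \<epsilon> \<psi>0 bump'_sign(2)[of "z s"] by (simp add: \<phi>x_def s z_def mult_nonneg_nonpos divide_le_0_iff)
          ultimately have "\<bar>\<phi>x s\<bar> * \<bar>F (u y \<tau>) - xs' \<tau> * u y \<tau> - cR\<bar> \<le> - \<phi>x s * \<eta>"
            by (simp add: mult_left_mono_neg)
          then show ?thesis using False by (simp add: mid_eq k_eq UU abs_mult s)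
        qed
      qed
      have mid_int: "integrable lborel mid"
        unfolding mid_def[abs_def] using E_int k[of cL cR] Rest_int by (auto simp: has_bochner_integral_iff)
      have "norm (integral\<^sup>L lborel mid) \<le> integral\<^sup>L lborel (k \<eta> (- \<eta>))"
        using k[of \<eta> "- \<eta>"] mid_int mid_bound
        by (intro Bochner_Integration.integral_norm_bound_integral) (auto simp: has_bochner_integral_iff)
      also have "\<dots> = 2 * \<eta> * (16 / 15 * \<rho>)"
        using has_bochner_integral_integral_eq[OF k[of \<eta> "- \<eta>"]] by simp
      also have "integral\<^sup>L lborel mid = 0 - (cL - cR) * (16 / 15 * \<rho>) - integral\<^sup>L lborel (Rest \<epsilon>)"
        unfolding mid_def[abs_def] using E_int k[of cL cR] Rest_int E0
        by (simp add: has_bochner_integral_iff)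
      finally show ?thesis unfolding real_norm_def by linarith
    qed
    define \<epsilon> where "\<epsilon> n = \<rho> / real (Suc n)" for n
    have \<epsilon>: "0 < \<epsilon> n" "\<epsilon> n \<le> \<rho>" for n using \<rho>(1) by (auto simp: \<epsilon>_def divide_le_eq)
    have "(\<lambda>n. integral\<^sup>L lborel (Rest (\<epsilon> n))) \<longlonglongrightarrow> integral\<^sup>L lborel (\<lambda>_ :: real \<times> real. 0 :: real)"
    proof (rule integral_dominated_convergence[where w = "\<lambda>p. norm (W p)"])
      show "Rest (\<epsilon> n) \<in> borel_measurable lborel" for n
      proof -
        have "continuous_on UNIV (\<lambda>p. bump ((fst p - X (snd p)) / \<epsilon> n))"
          by (intro continuous_intros snd_cont X_cont) (use \<epsilon>(1)[of n] in auto)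
        then have "(\<lambda>p. bump ((fst p - X (snd p)) / \<epsilon> n)) \<in> borel_measurable borel"
          by (rule borel_measurable_continuous_onI)
        then show ?thesis
          unfolding Rest_def[abs_def] using borel_measurable_integrable[OF W_int] by simp
      qed
      show "AE p in lborel. (\<lambda>n. Rest (\<epsilon> n) p) \<longlonglongrightarrow> 0"
        using AE_not_in[OF graph_null_set[OF X_cont(1)]]
      proof eventually_elim
        case (elim p)
        then have d: "\<bar>fst p - X (snd p)\<bar> > 0" by (auto simp: case_prod_beta')
        obtain n0 where n0: "\<rho> / \<bar>fst p - X (snd p)\<bar> < real n0" using reals_Archimedean2 by blast
        have "Rest (\<epsilon> n) p = 0" if "n \<ge> n0" for n
        proof -
          have "\<rho> / \<bar>fst p - X (snd p)\<bar> < real (Suc n)" using n0 that by linarith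
          then have "\<epsilon> n \<le> \<bar>fst p - X (snd p)\<bar>" using d by (simp add: \<epsilon>_def field_simps)
          then have "\<bar>(fst p - X (snd p)) / \<epsilon> n\<bar> \<ge> 1" using \<epsilon>(1)[of n] by (simp add: abs_divide)
          then show ?thesis by (simp add: Rest_def bump_outside)
        qed
        then show ?case
          by (intro tendsto_eventually) (auto simp: eventually_sequentially)
      qed
      show "AE p in lborel. norm (Rest (\<epsilon> n) p) \<le> norm (W p)" for n
        using bump_bounds by (auto simp: Rest_def abs_mult intro!: mult_left_le)
    qed (use W_int in auto)
    then have "(\<lambda>n. integral\<^sup>L lborel (Rest (\<epsilon> n))) \<longlonglongrightarrow> 0" by simp
    then have "(\<lambda>n. \<bar>(cL - cR) * (16 / 15 * \<rho>) + integral\<^sup>L lborel (Rest (\<epsilon> n))\<bar>) \<longlonglongrightarrow> \<bar>(cL - cR) * (16 / 15 * \<rho>) + 0\<bar>"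
      by (intro tendsto_intros)
    then have "\<bar>(cL - cR) * (16 / 15 * \<rho>) + 0\<bar> \<le> 2 * \<eta> * (16 / 15 * \<rho>)"
      by (rule LIMSEQ_le_const2) (use bound \<epsilon> in auto)
    then show ?thesis using \<rho>(1) by (simp add: abs_mult)
  qed
  then have "\<bar>cL - cR\<bar> \<le> 0 + e" if "e > 0" for e using that by (metis add_0 field_sum_of_halves half_gt_zero mult_2)
  then have "\<bar>cL - cR\<bar> \<le> 0" by (rule field_le_epsilon)
  then show ?thesis by (simp add: cL_def cR_def)
qed

lemma isolated_shock_states_continuous:
  assumes shock: "isolated_shock U u I xs uL uR" and xs: "continuous_on I xs"
  shows "continuous_on I uL" "continuous_on I uR"
proof -
  have *: "continuous_on I w"
    if w: "\<And>\<tau>0. \<tau>0 \<in> I \<Longrightarrow> \<exists>r>0. \<exists>L. \<forall>\<tau>\<in>I. \<bar>\<tau> - \<tau>0\<bar> < r \<longrightarrow> \<bar>w \<tau> - w \<tau>0\<bar> \<le> L * (\<bar>xs \<tau> - xs \<tau>0\<bar> + \<bar>\<tau> - \<tau>0\<bar>)"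
    for w :: "real \<Rightarrow> real"
    unfolding continuous_on_def
  proof
    fix \<tau>0 assume \<tau>0: "\<tau>0 \<in> I"
    then obtain r L where "r > 0" and rL: "\<And>\<tau>. \<tau> \<in> I \<Longrightarrow> \<bar>\<tau> - \<tau>0\<bar> < r \<Longrightarrow>
        \<bar>w \<tau> - w \<tau>0\<bar> \<le> L * (\<bar>xs \<tau> - xs \<tau>0\<bar> + \<bar>\<tau> - \<tau>0\<bar>)"
      using w[OF \<tau>0] by metis
    have "((\<lambda>\<tau>. w \<tau> - w \<tau>0) \<longlongrightarrow> 0) (at \<tau>0 within I)"
    proof (rule Lim_null_comparison)
      have "(xs \<longlongrightarrow> xs \<tau>0) (at \<tau>0 within I)" using xs \<tau>0 by (simp add: continuous_on_def)
      then have "((\<lambda>\<tau>. L * (\<bar>xs \<tau> - xs \<tau>0\<bar> + \<bar>\<tau> - \<tau>0\<bar>)) \<longlongrightarrow> L * (\<bar>xs \<tau>0 - xs \<tau>0\<bar> + \<bar>\<tau>0 - \<tau>0\<bar>)) (at \<tau>0 within I)"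
        by (intro tendsto_intros)
      then show "((\<lambda>\<tau>. L * (\<bar>xs \<tau> - xs \<tau>0\<bar> + \<bar>\<tau> - \<tau>0\<bar>)) \<longlongrightarrow> 0) (at \<tau>0 within I)" by simp
      show "\<forall>\<^sub>F \<tau> in at \<tau>0 within I. norm (w \<tau> - w \<tau>0) \<le> L * (\<bar>xs \<tau> - xs \<tau>0\<bar> + \<bar>\<tau> - \<tau>0\<bar>)"
        unfolding eventually_at using \<open>r > 0\<close> rL by (intro exI[of _ r]) (auto simp: dist_real_def)
    qed
    then show "(w \<longlongrightarrow> w \<tau>0) (at \<tau>0 within I)" by (rule LIM_zero_cancel)
  qed
  show "continuous_on I uL" by (rule *) (metis isolated_shock_estimates[OF shock])
  show "continuous_on I uR" by (rule *) (metis isolated_shock_estimates[OF shock])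
qed

text \<open>
  The identity for interior times extends to the initial time \<open>t\<close> by continuity. At \<open>t = 0\<close> this
  avoids test functions that see the initial data.
\<close>

theorem weak_solution_imp_rankine_hugoniot:
  assumes weak: "weak_solution U F D Q g T u" and "0 \<le> t" "t1 \<le> T"
    and shock: "isolated_shock U u {t..<t1} xs uL uR"
    and F_cont: "\<And>w. w \<in> U \<Longrightarrow> isCont F w"
  shows "rankine_hugoniot F {t..<t1} xs uL uR"
proof -
  let ?I = "{t..<t1}"
  obtain xs' where xs'_cont: "continuous_on ?I xs'"
    and xs_der: "\<And>\<tau>. \<tau> \<in> ?I \<Longrightarrow> (xs has_real_derivative xs' \<tau>) (at \<tau> within ?I)"
    using shock unfolding isolated_shock_def by blast
  have states: "uL \<tau> \<in> U" "uR \<tau> \<in> U" "uL \<tau> \<noteq> uR \<tau>" if "\<tau> \<in> ?I" for \<tau>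
    using shock that unfolding isolated_shock_def by blast+
  have "continuous_on ?I xs"
    using xs_der DERIV_continuous continuous_on_eq_continuous_within by blast
  note cont = isolated_shock_states_continuous[OF shock this]
  define jump where "jump \<tau> = (F (uL \<tau>) - xs' \<tau> * uL \<tau>) - (F (uR \<tau>) - xs' \<tau> * uR \<tau>)" for \<tau>
  have interior: "jump \<tau> = 0" if "t < \<tau>" "\<tau> < t1" for \<tau>
    using shock_speed_identity[OF weak assms(2,3) shock F_cont xs'_cont xs_der that] by (simp add: jump_def)
  have "jump t = 0" if "t < t1"
  proof (rule tendsto_unique)
    show "at t within {t<..<t1} \<noteq> bot" using that islimpt_greaterThanLessThan1[of t t1] by (simp add: trivial_limit_within)
    have F_lim: "((\<lambda>\<tau>. F (w \<tau>)) \<longlongrightarrow> F (w t)) (at t within ?I)" if "continuous_on ?I w" "w t \<in> U" for w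
      by (rule isCont_tendsto_compose[OF F_cont[OF that(2)]]) (use that(1) \<open>t < t1\<close> in \<open>simp add: continuous_on_def\<close>)
    have "(jump \<longlongrightarrow> jump t) (at t within ?I)"
      unfolding jump_def using that cont xs'_cont
      by (intro tendsto_intros F_lim states) (auto simp: continuous_on_def)
    then show "(jump \<longlongrightarrow> jump t) (at t within {t<..<t1})"
      by (rule tendsto_within_subset) auto
    show "(jump \<longlongrightarrow> 0) (at t within {t<..<t1})"
      by (rule tendsto_eventually) (auto simp: eventually_at_filter interior)
  qed
  then have "jump \<tau> = 0" if "\<tau> \<in> ?I" for \<tau>
    using interior[of \<tau>] that by (cases "\<tau> = t") auto
  then have "xs' \<tau> = (F (uL \<tau>) - F (uR \<tau>)) / (uL \<tau> - uR \<tau>)" if "\<tau> \<in> ?I" for \<tau>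
    using states(3)[OF that] that by (simp add: jump_def field_simps)
  then show ?thesis
    using xs_der unfolding rankine_hugoniot_def by metis
qed

lemma has_derivative_imp_local_bound:
  assumes "(f has_derivative f') (at x within S)"
  obtains C d where "C \<ge> 0" "d > 0" "\<And>y. y \<in> S \<Longrightarrow> norm (y - x) < d \<Longrightarrow> norm (f y - f x) \<le> C * norm (y - x)"
proof -
  have bl: "bounded_linear f'" using assms has_derivative_bounded_linear by blast
  obtain d where "d > 0" and d: "\<And>y. y \<in> S \<Longrightarrow> norm (y - x) < d \<Longrightarrow>
      norm (f y - f x - f' (y - x)) \<le> 1 * norm (y - x)"
    using assms unfolding has_derivative_within_alt by (metis zero_less_one)
  show ?thesis
  proof (rule that[of "onorm f' + 1" d])
    show "onorm f' + 1 \<ge> 0" using onorm_pos_le[OF bl] by simp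
    fix y assume "y \<in> S" "norm (y - x) < d"
    then show "norm (f y - f x) \<le> (onorm f' + 1) * norm (y - x)"
      using d[of y] onorm[OF bl, of "y - x"] norm_triangle_sub[of "f y - f x" "f' (y - x)"]
      by (simp add: algebra_simps)
  qed (fact \<open>d > 0\<close>)
qed

text \<open>
  As a function of the two shock states the Rankine-Hugoniot speed \<open>S\<close> is differentiable where
  they differ, and the states vary at most linearly in time. So the speed stays within \<open>O(\<delta>)\<close> of
  its initial value, although \<open>xs\<close> need not be twice differentiable.
\<close>

lemma shock_path_expansion:
  assumes "t < t1" and shock: "isolated_shock U u {t..<t1} xs uL uR"
    and RH: "rankine_hugoniot F {t..<t1} xs uL uR"
    and F_der: "\<And>w. w \<in> U \<Longrightarrow> F differentiable (at w)"
  obtains C where "\<forall>\<^sub>F \<delta> in at_right 0.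
    \<bar>xs (t + \<delta>) - (xs t + \<delta> * ((F (uL t) - F (uR t)) / (uL t - uR t)))\<bar> \<le> C * \<delta>\<^sup>2"
proof -
  let ?I = "{t..<t1}"
  have tI: "t \<in> ?I" using \<open>t < t1\<close> by simp
  define S where "S = (\<lambda>p. (F (fst p) - F (snd p)) / (fst p - snd p))"
  have xs_der: "(xs has_real_derivative S (uL \<tau>, uR \<tau>)) (at \<tau> within ?I)" if "\<tau> \<in> ?I" for \<tau>
    using RH that unfolding rankine_hugoniot_def S_def by simp
  have states: "uL t \<in> U" "uR t \<in> U" "uL t \<noteq> uR t"
    using shock tI unfolding isolated_shock_def by blast+
  obtain FL FR where FLR: "(F has_real_derivative FL) (at (uL t))" "(F has_real_derivative FR) (at (uR t))"
    using F_der states real_differentiable_def by metis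
  have "((\<lambda>p. F (fst p)) has_derivative (\<lambda>h. fst h * FL)) (at (uL t, uR t))"
    by (rule DERIV_compose_FDERIV[where f = F and g = fst])
      (use FLR in \<open>auto intro!: derivative_eq_intros\<close>)
  moreover have "((\<lambda>p. F (snd p)) has_derivative (\<lambda>h. snd h * FR)) (at (uL t, uR t))"
    by (rule DERIV_compose_FDERIV[where f = F and g = snd])
      (use FLR in \<open>auto intro!: derivative_eq_intros\<close>)
  ultimately have "S differentiable (at (uL t, uR t))"
    unfolding S_def using states
    by (intro differentiable_divide differentiable_diff) (auto simp: differentiable_def intro!: derivative_intros)
  then obtain S' where "(S has_derivative S') (at (uL t, uR t))" unfolding differentiable_def by blast
  from has_derivative_imp_local_bound[OF this] obtain C1 d1 where "C1 \<ge> 0" "d1 > 0" and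
    S: "\<And>p. norm (p - (uL t, uR t)) < d1 \<Longrightarrow> norm (S p - S (uL t, uR t)) \<le> C1 * norm (p - (uL t, uR t))"
    by (metis UNIV_I)
  from has_derivative_imp_local_bound[OF xs_der[OF tI, unfolded has_field_derivative_def]]
  obtain C2 d2 where "C2 \<ge> 0" "d2 > 0" and
    xs: "\<And>\<tau>. \<tau> \<in> ?I \<Longrightarrow> norm (\<tau> - t) < d2 \<Longrightarrow> norm (xs \<tau> - xs t) \<le> C2 * norm (\<tau> - t)"
    by metis
  obtain r L where "r > 0" "L \<ge> 0" and
    u: "\<And>\<tau>. \<lbrakk>\<tau> \<in> ?I; \<bar>\<tau> - t\<bar> < r\<rbrakk> \<Longrightarrow> \<bar>uL \<tau> - uL t\<bar> \<le> L * (\<bar>xs \<tau> - xs t\<bar> + \<bar>\<tau> - t\<bar>)"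
      "\<And>\<tau>. \<lbrakk>\<tau> \<in> ?I; \<bar>\<tau> - t\<bar> < r\<rbrakk> \<Longrightarrow> \<bar>uR \<tau> - uR t\<bar> \<le> L * (\<bar>xs \<tau> - xs t\<bar> + \<bar>\<tau> - t\<bar>)"
    using isolated_shock_estimates[OF shock tI] by metis
  define K where "K = 2 * (L * (C2 + 1))"
  have "K \<ge> 0" using \<open>L \<ge> 0\<close> \<open>C2 \<ge> 0\<close> by (simp add: K_def)
  define d where "d = Min {d2, r, t1 - t, d1 / (K + 1)}"
  have d: "d > 0" "d \<le> d2" "d \<le> r" "d \<le> t1 - t" "d \<le> d1 / (K + 1)"
    using \<open>d1 > 0\<close> \<open>d2 > 0\<close> \<open>r > 0\<close> \<open>t < t1\<close> \<open>K \<ge> 0\<close> by (auto simp: d_def)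
  have speed: "\<bar>S (uL \<tau>, uR \<tau>) - S (uL t, uR t)\<bar> \<le> C1 * K * (\<tau> - t)" if \<tau>: "t \<le> \<tau>" "\<tau> < t + d" for \<tau>
  proof -
    have I: "\<tau> \<in> ?I" "\<bar>\<tau> - t\<bar> < r" "norm (\<tau> - t) < d2" using \<tau> d by auto
    have "\<bar>xs \<tau> - xs t\<bar> + \<bar>\<tau> - t\<bar> \<le> (C2 + 1) * (\<tau> - t)"
      using xs[OF I(1,3)] \<tau> by (simp add: algebra_simps)
    then have "L * (\<bar>xs \<tau> - xs t\<bar> + \<bar>\<tau> - t\<bar>) \<le> L * ((C2 + 1) * (\<tau> - t))"
      using \<open>L \<ge> 0\<close> by (rule mult_left_mono)
    then have "\<bar>uL \<tau> - uL t\<bar> + \<bar>uR \<tau> - uR t\<bar> \<le> K * (\<tau> - t)"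
      using u[OF I(1,2)] by (simp add: K_def algebra_simps)
    then have near: "norm ((uL \<tau>, uR \<tau>) - (uL t, uR t)) \<le> K * (\<tau> - t)"
      using norm_Pair_le[of "uL \<tau> - uL t" "uR \<tau> - uR t"] by simp
    also have "K * (\<tau> - t) \<le> K * d" using \<tau> \<open>K \<ge> 0\<close> by (intro mult_left_mono) auto
    also have "\<dots> < (K + 1) * d" using d(1) by simp
    also have "\<dots> \<le> d1" using d(5) \<open>K \<ge> 0\<close> by (simp add: field_simps)
    finally have "norm ((uL \<tau>, uR \<tau>) - (uL t, uR t)) < d1" .
    from S[OF this] have "\<bar>S (uL \<tau>, uR \<tau>) - S (uL t, uR t)\<bar> \<le> C1 * norm ((uL \<tau>, uR \<tau>) - (uL t, uR t))" by simp
    also have "\<dots> \<le> C1 * (K * (\<tau> - t))" using near \<open>C1 \<ge> 0\<close> by (rule mult_left_mono)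
    finally show ?thesis by (simp add: mult.assoc)
  qed
  have "\<bar>xs (t + \<delta>) - (xs t + \<delta> * S (uL t, uR t))\<bar> \<le> C1 * K * \<delta>\<^sup>2" if \<delta>: "0 < \<delta>" "\<delta> < d" for \<delta>
  proof -
    have "\<exists>\<theta>\<in>{t..t + \<delta>}. xs (t + \<delta>) - xs t = S (uL \<theta>, uR \<theta>) * (t + \<delta> - t)"
      using \<delta> d by (intro mvt_very_simple has_derivative_subset[OF xs_der[unfolded has_field_derivative_def]]) auto
    then obtain \<theta> where \<theta>: "\<theta> \<in> {t..t + \<delta>}" and eq: "xs (t + \<delta>) - xs t = S (uL \<theta>, uR \<theta>) * \<delta>" by auto
    have "\<bar>S (uL \<theta>, uR \<theta>) - S (uL t, uR t)\<bar> \<le> C1 * K * (\<theta> - t)" using speed[of \<theta>] \<theta> \<delta> by auto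
    also have "\<dots> \<le> C1 * K * \<delta>" using \<theta> \<open>C1 \<ge> 0\<close> \<open>K \<ge> 0\<close> by (intro mult_left_mono) auto
    finally have "\<bar>S (uL \<theta>, uR \<theta>) - S (uL t, uR t)\<bar> * \<delta> \<le> C1 * K * \<delta> * \<delta>"
      using \<delta> by (intro mult_right_mono) auto
    moreover have "xs (t + \<delta>) - (xs t + \<delta> * S (uL t, uR t)) = (S (uL \<theta>, uR \<theta>) - S (uL t, uR t)) * \<delta>"
      using eq by (simp add: algebra_simps)
    ultimately show ?thesis using \<delta> by (simp add: abs_mult power2_eq_square mult.assoc)
  qed
  then have "\<forall>\<^sub>F \<delta> in at_right 0. \<bar>xs (t + \<delta>) - (xs t + \<delta> * S (uL t, uR t))\<bar> \<le> C1 * K * \<delta>\<^sup>2"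
    unfolding eventually_at_right_field using d(1) by blast
  then show ?thesis using that unfolding S_def by simp
qed

section \<open>The predicted shock position along characteristics\<close>

lemma lipschitz_on_components:
  assumes "K-lipschitz_on S (\<lambda>s. (a s, b s, c s))"
  shows "K-lipschitz_on S a" "K-lipschitz_on S b"
proof -
  have d: "dist (a s) (a s') \<le> dist (a s, b s, c s) (a s', b s', c s')"
    "dist (b s) (b s') \<le> dist (a s, b s, c s) (a s', b s', c s')" for s s'
    using dist_fst_le[of "(a s, b s, c s)" "(a s', b s', c s')"]
      dist_fst_le[of "(b s, c s)" "(b s', c s')"] dist_snd_le[of "(a s, b s, c s)" "(a s', b s', c s')"]
    by auto
  show "K-lipschitz_on S a"
    by (rule lipschitz_onI[OF order_trans[OF d(1) lipschitz_onD[OF assms]] lipschitz_on_nonneg[OF assms]])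
  show "K-lipschitz_on S b"
    by (rule lipschitz_onI[OF order_trans[OF d(2) lipschitz_onD[OF assms]] lipschitz_on_nonneg[OF assms]])
qed

text \<open>
  Time is the third component of the state, with velocity 1, because \<open>Q\<close> depends on it.
\<close>

lemma characteristic_curve_imp_C1_flow:
  assumes U: "open U" "smooth_on U F" and D: "open D" "smooth_on D Q"
    and cc: "characteristic_curve U F D Q g T x v" and T0: "0 \<le> T0" "T0 < T"
  defines "\<Phi> \<equiv> \<lambda>p. (Q p, deriv F (fst p), 1)"
  obtains \<Phi>' where "C1_flow {p \<in> D. fst p \<in> U} \<Phi> \<Phi>' (\<lambda>s \<tau>. (v s \<tau>, x s \<tau>, \<tau>)) T0"
proof -
  let ?W = "{p \<in> D. fst p \<in> U}"
  obtain F'' where F'': "\<And>w. w \<in> U \<Longrightarrow> (deriv F has_real_derivative F'' w) (at w)" "continuous_on U F''"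
    using smooth_on_real_derivatives[OF U] by metis
  have Q: "C1_on D Q (\<lambda>p. frechet_derivative Q (at p))" by (rule smooth_on_imp_C1_on[OF D(2)])
  define \<Phi>' where "\<Phi>' p h = (frechet_derivative Q (at p) h, fst h * F'' (fst p), 0 :: real)" for p h
  have "C1_flow ?W \<Phi> \<Phi>' (\<lambda>s \<tau>. (v s \<tau>, x s \<tau>, \<tau>)) T0"
  proof
    have "?W = D \<inter> fst -` U" by auto
    then show "open ?W" using open_Int[OF D(1) open_vimage_fst[OF U(1)]] by (simp add: vimage_fst Int_def)
    show "C1_on ?W \<Phi> \<Phi>'"
      unfolding C1_on_def
    proof (intro conjI ballI allI)
      fix p assume p: "p \<in> ?W"
      have "(Q has_derivative frechet_derivative Q (at p)) (at p)" using Q p unfolding C1_on_def by blast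
      moreover have "((\<lambda>p. deriv F (fst p)) has_derivative (\<lambda>h. fst h * F'' (fst p))) (at p)"
        by (rule DERIV_compose_FDERIV[where f = "deriv F" and g = fst])
          (use F''(1)[of "fst p"] p in \<open>auto intro!: derivative_eq_intros\<close>)
      ultimately show "(\<Phi> has_derivative \<Phi>' p) (at p)"
        unfolding \<Phi>_def \<Phi>'_def[abs_def] by (intro has_derivative_Pair has_derivative_const)
    next
      fix e :: "real \<times> real \<times> real"
      have "continuous_on ?W (\<lambda>p. frechet_derivative Q (at p) e)"
        by (rule continuous_on_subset[of D]) (use Q[unfolded C1_on_def] in blast)+
      moreover have "continuous_on ?W (\<lambda>p. F'' (fst p))"
        by (rule continuous_on_compose2[OF F''(2)]) (auto intro!: continuous_intros)
      ultimately show "continuous_on ?W (\<lambda>p. \<Phi>' p e)"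
        unfolding \<Phi>'_def by (intro continuous_intros)
    qed
    fix s \<tau> assume \<tau>: "\<tau> \<in> {0..T0}"
    then have \<tau>T: "\<tau> \<in> {0..<T}" using T0 by auto
    have *: "v s \<tau> \<in> U" "(v s \<tau>, x s \<tau>, \<tau>) \<in> D"
      "(x s has_real_derivative deriv F (v s \<tau>)) (at \<tau> within {0..<T})"
      "(v s has_real_derivative Q (v s \<tau>, x s \<tau>, \<tau>)) (at \<tau> within {0..<T})"
      using cc \<tau>T unfolding characteristic_curve_def by blast+
    show "(v s \<tau>, x s \<tau>, \<tau>) \<in> ?W" using * by simp
    have sub: "{0..T0} \<subseteq> {0..<T}" using T0 by auto
    show "((\<lambda>\<tau>. (v s \<tau>, x s \<tau>, \<tau>)) has_vector_derivative \<Phi> (v s \<tau>, x s \<tau>, \<tau>)) (at \<tau> within {0..T0})"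
      unfolding \<Phi>_def fst_conv using *(3,4)
      by (intro has_vector_derivative_Pair has_vector_derivative_id has_vector_derivative_within_subset[OF _ sub])
        (auto simp: has_real_derivative_iff_has_vector_derivative)
  qed (rule T0(1))
  then show ?thesis by (rule that)
qed

text \<open>
  The final time \<open>T0 < T\<close> keeps the time interval compact. The set \<open>N\<close> collects the breakpoints of
  the initial curve, which are the only parameters at which the evolved curve may fail to be
  differentiable.
\<close>

lemma equal_area_curve_imp_equal_area_step:
  assumes U: "open U" "smooth_on U F" and D: "open D" "smooth_on D Q"
    and cc: "characteristic_curve U F D Q g T x v" and t: "0 \<le> t" "t < T"
    and area: "equal_area_curve_about x v t X0 wL wR s1 s2" and jump: "wL \<noteq> wR"
  obtains A B M \<delta>0 N where
    "equal_area_step A B s1 s2 M \<delta>0 X0 N (\<lambda>s. v s t) (\<lambda>\<delta> s. x s (t + \<delta>)) F (deriv F)" "t + \<delta>0 < T"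
proof -
  define A where "A = s1 - 1"
  define B where "B = s2 + 1"
  define T0 where "T0 = (t + T) / 2"
  have T0: "0 \<le> T0" "t < T0" "T0 < T" using t by (auto simp: T0_def)
  define \<delta>0 where "\<delta>0 = min 1 (T0 - t)"
  have \<delta>0: "0 < \<delta>0" "\<delta>0 \<le> 1" "t + \<delta>0 \<le> T0" using T0 by (auto simp: \<delta>0_def)
  let ?W = "{p \<in> D. fst p \<in> U}"
  let ?\<Phi> = "\<lambda>p. (Q p, deriv F (fst p), 1 :: real)"
  let ?z = "\<lambda>s \<tau>. (v s \<tau>, x s \<tau>, \<tau>)"
  obtain \<Phi>' where flow: "C1_flow ?W ?\<Phi> \<Phi>' ?z T0"
    using characteristic_curve_imp_C1_flow[OF U D cc T0(1,3)] by blast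
  interpret C1_flow ?W ?\<Phi> \<Phi>' ?z T0 by (rule flow)
  have s12: "s1 < s2" "x s1 t = X0" "x s2 t = X0" "v s1 t = wL" "v s2 t = wR"
    and int0: "((\<lambda>s. v s t * deriv (\<lambda>s'. x s' t) s) has_integral 0) {s1..s2}"
    using area unfolding equal_area_curve_about_def by auto
  have AB: "A \<le> B" using s12 by (simp add: A_def B_def)
  have init: "continuous_on UNIV (\<lambda>s. x s 0)" "piecewise_smooth (\<lambda>s. x s 0)"
    "continuous_on UNIV (\<lambda>s. v s 0)" "piecewise_smooth (\<lambda>s. v s 0)"
    using cc unfolding characteristic_curve_def initial_curve_def by auto
  obtain K1 where K1: "K1-lipschitz_on {A..B} (\<lambda>s. v s 0)"
    using piecewise_smooth_imp_lipschitz_on[OF init(4,3) AB] by blast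
  obtain K2 where K2: "K2-lipschitz_on {A..B} (\<lambda>s. x s 0)"
    using piecewise_smooth_imp_lipschitz_on[OF init(2,1) AB] by blast
  from lipschitz_on_Pair[OF K1 lipschitz_on_Pair[OF K2 lipschitz_on_constant]]
  obtain K0 where lip0: "K0-lipschitz_on {A..B} (\<lambda>s. ?z s 0)" by blast
  obtain Pv where Pv: "\<And>a b. finite (Pv \<inter> {a..b})" "\<And>s. s \<notin> Pv \<Longrightarrow> (\<lambda>s. v s 0) differentiable (at s)"
    using piecewise_smooth_imp_differentiable[OF init(4)] by blast
  obtain Px where Px: "\<And>a b. finite (Px \<inter> {a..b})" "\<And>s. s \<notin> Px \<Longrightarrow> (\<lambda>s. x s 0) differentiable (at s)"
    using piecewise_smooth_imp_differentiable[OF init(2)] by blast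
  define N where "N = (Pv \<inter> {A..B}) \<union> (Px \<inter> {A..B})"
  have "finite N" using Pv(1) Px(1) by (simp add: N_def)
  have diff: "(\<lambda>s. v s \<tau>) differentiable (at s)" "(\<lambda>s. x s \<tau>) differentiable (at s)"
    if "s \<in> {A<..<B} - N" "\<tau> \<in> {0..T0}" for s \<tau>
  proof -
    have "(\<lambda>s. ?z s 0) differentiable (at s)"
    proof -
      have "(\<lambda>s. v s 0) differentiable (at s)" "(\<lambda>s. x s 0) differentiable (at s)"
        using that Pv(2) Px(2) by (auto simp: N_def)
      then obtain v' x' where "((\<lambda>s. v s 0) has_derivative v') (at s)" "((\<lambda>s. x s 0) has_derivative x') (at s)"
        unfolding differentiable_def by blast
      from has_derivative_Pair[OF this(1) has_derivative_Pair[OF this(2) has_derivative_const]]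
      show ?thesis by (rule differentiableI)
    qed
    then have "(\<lambda>s. ?z s \<tau>) differentiable (at s)" using that(2) by (rule flow_differentiable)
    then obtain z' where z': "((\<lambda>s. ?z s \<tau>) has_derivative z') (at s)" unfolding differentiable_def by blast
    show "(\<lambda>s. v s \<tau>) differentiable (at s)" "(\<lambda>s. x s \<tau>) differentiable (at s)"
      using has_derivative_fst[OF z'] has_derivative_fst[OF has_derivative_snd[OF z']]
      unfolding differentiable_def by auto
  qed
  obtain K where "K \<ge> 0" and K: "\<And>\<tau>. \<tau> \<in> {0..T0} \<Longrightarrow> K-lipschitz_on {A..B} (\<lambda>s. ?z s \<tau>)"
    "\<And>\<tau>. \<tau> \<in> {0..T0} \<Longrightarrow> K-lipschitz_on {A..B} (\<lambda>s. ?\<Phi> (?z s \<tau>))"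
    by (rule flow_Lipschitz[OF lip0 AB]) (rule that, assumption+)
  obtain C where "C \<ge> 0" and C: "\<And>s \<sigma> \<tau>. \<lbrakk>s \<in> {A..B}; 0 \<le> \<sigma>; \<sigma> \<le> \<tau>; \<tau> \<le> T0\<rbrakk> \<Longrightarrow>
       norm (?z s \<tau> - ?z s \<sigma> - (\<tau> - \<sigma>) *\<^sub>R ?\<Phi> (?z s \<sigma>)) \<le> C * (\<tau> - \<sigma>)\<^sup>2"
    by (rule flow_expansion[OF lip0 AB]) (rule that, assumption+)
  have tT0: "t \<in> {0..T0}" using t T0 by simp
  have "K-lipschitz_on {A..B} (\<lambda>s. deriv F (v s t))"
    using lipschitz_on_components(2)[OF K(2)[OF tT0, unfolded fst_conv]] .
  then have f_cont: "continuous_on {A..B} (\<lambda>s. deriv F (v s t))"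
    by (rule lipschitz_on_continuous_on)
  then have "bounded ((\<lambda>s. deriv F (v s t)) ` {A..B})"
    by (intro compact_imp_bounded compact_continuous_image) auto
  then obtain Bf where Bf: "\<forall>s\<in>{A..B}. \<bar>deriv F (v s t)\<bar> \<le> Bf"
    by (auto simp: bounded_iff)
  define M where "M = max K (max C Bf)"
  have M: "K \<le> M" "C \<le> M" "Bf \<le> M" by (auto simp: M_def)
  have time: "t + \<delta> \<in> {0..T0}" if "\<delta> \<in> {0..\<delta>0}" for \<delta> using that t \<delta>0 by auto
  have "equal_area_step A B s1 s2 M \<delta>0 X0 N (\<lambda>s. v s t) (\<lambda>\<delta> s. x s (t + \<delta>)) F (deriv F)"
  proof (rule equal_area_step.intro)
    show "lipschitz_curve A B M N (\<lambda>s. v s t)"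
      by unfold_locales
        (use lipschitz_on_le[OF lipschitz_on_components(1)[OF K(1)[OF tT0]] M(1)] \<open>finite N\<close> diff(1) tT0 in auto)
    show "lipschitz_curve A B M N (\<lambda>s. x s (t + \<delta>))" if "\<delta> \<in> {0..\<delta>0}" for \<delta>
      by unfold_locales
        (use lipschitz_on_le[OF lipschitz_on_components(2)[OF K(1)[OF time[OF that]]] M(1)] \<open>finite N\<close> diff(2) time[OF that] in auto)
    show "\<bar>x s (t + \<delta>) - x s (t + 0) - \<delta> * deriv F (v s t)\<bar> \<le> M * \<delta>\<^sup>2" if "\<delta> \<in> {0..\<delta>0}" "s \<in> {A..B}" for \<delta> s
    proof -
      let ?e = "?z s (t + \<delta>) - ?z s t - \<delta> *\<^sub>R ?\<Phi> (?z s t)"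
      have "norm (fst (snd e)) \<le> norm e" for e :: "real \<times> real \<times> real"
        using order_trans[OF norm_fst_le[of "fst (snd e)" "snd (snd e)"], of "norm e"]
          norm_snd_le[of "snd e" "fst e"] by simp
      then have "norm (fst (snd ?e)) \<le> norm ?e" .
      also have "norm ?e \<le> C * \<delta>\<^sup>2"
        using C[OF that(2), of t "t + \<delta>"] t that(1) \<delta>0 by simp
      also have "C * \<delta>\<^sup>2 \<le> M * \<delta>\<^sup>2" using M(2) by (rule mult_right_mono) simp
      finally show ?thesis by simp
    qed
    show "(\<delta> * M)-lipschitz_on {A..B} (\<lambda>s. x s (t + \<delta>) - x s (t + 0))" if "\<delta> \<in> {0..\<delta>0}" for \<delta>
    proof -
      have "(\<delta> * K)-lipschitz_on {A..B} (\<lambda>s. ?z s (t + \<delta>) - ?z s t)"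
        using flow_step_Lipschitz[OF K(2), of t "t + \<delta>"] t that \<delta>0 by simp
      then have "(\<delta> * K)-lipschitz_on {A..B} (\<lambda>s. x s (t + \<delta>) - x s (t + 0))"
        using lipschitz_on_components(2)[of "\<delta> * K" "{A..B}" "\<lambda>s. v s (t + \<delta>) - v s t" "\<lambda>s. x s (t + \<delta>) - x s t"] by simp
      then show ?thesis by (rule lipschitz_on_le) (use M(1) that in \<open>auto intro: mult_left_mono\<close>)
    qed
    show "(F has_real_derivative deriv F (v s t)) (at (v s t))" if "s \<in> {A..B}" for s
    proof -
      have "v s t \<in> U" using z_in[OF tT0, of s] by simp
      then show ?thesis using smooth_on_real_derivatives[OF U] by metis
    qed
    show "integral {s1..s2} (\<lambda>s. v s t * deriv (\<lambda>s. x s (t + 0)) s) = 0"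
      using integral_unique[OF int0] by simp
    show "\<And>s. s \<in> {A..B} \<Longrightarrow> \<bar>deriv F (v s t)\<bar> \<le> M" using Bf M(3) by (meson order_trans)
  qed (use s12 jump \<delta>0 f_cont in \<open>auto simp: A_def B_def\<close>)
  then show ?thesis using that T0 \<delta>0 by fastforce
qed

text \<open>
  By the characteristic equation, the position in the modified equal-area principle is the
  position at time \<open>t + \<delta>\<close>.
\<close>

lemma modified_equal_area_iff:
  assumes cc: "characteristic_curve U F D Q g T x v" and "0 \<le> t" "0 \<le> \<delta>" "t + \<delta> < T"
  shows "modified_equal_area F x v t \<delta> a b \<longleftrightarrow> a < b \<and> x a (t + \<delta>) = x b (t + \<delta>) \<and>
     ((\<lambda>s. v s t * deriv (\<lambda>s'. x s' (t + \<delta>)) s) has_integral 0) {a..b}"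
proof -
  have "x s t + integral {t..t + \<delta>} (\<lambda>\<tau>. deriv F (v s \<tau>)) = x s (t + \<delta>)" for s
  proof -
    have "((\<lambda>\<tau>. deriv F (v s \<tau>)) has_integral x s (t + \<delta>) - x s t) {t..t + \<delta>}"
    proof (rule fundamental_theorem_of_calculus)
      fix \<tau> assume \<tau>: "\<tau> \<in> {t..t + \<delta>}"
      have "(x s has_real_derivative deriv F (v s \<tau>)) (at \<tau> within {0..<T})"
        using cc \<tau> assms(2-4) unfolding characteristic_curve_def by auto
      then have "(x s has_vector_derivative deriv F (v s \<tau>)) (at \<tau> within {0..<T})"
        by (simp add: has_real_derivative_iff_has_vector_derivative)
      then show "(x s has_vector_derivative deriv F (v s \<tau>)) (at \<tau> within {t..t + \<delta>})"
        by (rule has_vector_derivative_within_subset) (use assms(2-4) in auto)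
    qed (use \<open>0 \<le> \<delta>\<close> in simp)
    then show ?thesis by (simp add: integral_unique)
  qed
  then show ?thesis unfolding modified_equal_area_def by simp
qed

lemma differentiable_at_right_imp_linear_bound:
  assumes "\<sigma> differentiable (at_right (0::real))"
  obtains C where "C \<ge> 0" "\<forall>\<^sub>F \<delta> in at_right 0. \<bar>\<sigma> \<delta> - \<sigma> 0 :: real\<bar> \<le> C * \<delta>"
proof -
  obtain \<sigma>' where "(\<sigma> has_derivative \<sigma>') (at 0 within {0<..})"
    using assms unfolding differentiable_def by blast
  from has_derivative_imp_local_bound[OF this] obtain C d where "C \<ge> 0" "d > 0"
    and C: "\<And>\<delta>. \<delta> \<in> {0<..} \<Longrightarrow> norm (\<delta> - 0) < d \<Longrightarrow> norm (\<sigma> \<delta> - \<sigma> 0) \<le> C * norm (\<delta> - 0)" by metis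
  have "\<bar>\<sigma> \<delta> - \<sigma> 0\<bar> \<le> C * \<delta>" if "0 < \<delta>" "\<delta> < d" for \<delta>
    using C[of \<delta>] that by simp
  then have "\<forall>\<^sub>F \<delta> in at_right 0. \<bar>\<sigma> \<delta> - \<sigma> 0\<bar> \<le> C * \<delta>"
    unfolding eventually_at_right_field using \<open>d > 0\<close> by blast
  then show ?thesis using that \<open>C \<ge> 0\<close> by blast
qed

theorem theorem4p2:
  fixes U :: "real set" and F :: "real \<Rightarrow> real"
    and D :: "(real \<times> real \<times> real) set" and Q :: "real \<times> real \<times> real \<Rightarrow> real"
    and g :: "real \<Rightarrow> real" and u :: "real \<Rightarrow> real \<Rightarrow> real"
    and x v :: "real \<Rightarrow> real \<Rightarrow> real"
    and xs uL uR :: "real \<Rightarrow> real"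
    and t t1 T s1 s2 :: real
  assumes "open U" and "connected U" and "smooth_on U F" and "uniformly_convex_on U F"
    and "open D" and "smooth_on D Q"
    and "piecewise_smooth g"
    and "0 \<le> t" and "t < t1" and "t1 \<le> T"
    and "weak_solution U F D Q g T u"
    and "isolated_shock U u {t..<t1} xs uL uR"
    and "characteristic_curve U F D Q g T x v"
    and "equal_area_curve_about x v t (xs t) (uL t) (uR t) s1 s2"
  shows "rankine_hugoniot F {t..<t1} xs uL uR \<and>
    (\<forall>\<sigma>1 \<sigma>2. \<sigma>1 0 = s1 \<and> \<sigma>2 0 = s2 \<and>
        \<sigma>1 differentiable (at_right 0) \<and> \<sigma>2 differentiable (at_right 0) \<and>
        (\<forall>\<^sub>F \<delta> in at_right 0. modified_equal_area F x v t \<delta> (\<sigma>1 \<delta>) (\<sigma>2 \<delta>)) \<longrightarrow>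
        (\<lambda>\<delta>. x (\<sigma>1 \<delta>) (t + \<delta>) - xs (t + \<delta>)) \<in> O[at_right 0](\<lambda>\<delta>. \<delta>\<^sup>2)) \<and>
    (transversal_at x t s1 \<and> transversal_at x t s2 \<longrightarrow>
      (\<exists>r>0. \<exists>C. \<forall>\<^sub>F \<delta> in at_right 0.
        (\<exists>a\<in>ball s1 r. \<exists>b\<in>ball s2 r. modified_equal_area F x v t \<delta> a b) \<and>
        (\<forall>a\<in>ball s1 r. \<forall>b\<in>ball s2 r. modified_equal_area F x v t \<delta> a b \<longrightarrow>
           \<bar>x a (t + \<delta>) - xs (t + \<delta>)\<bar> \<le> C * \<delta>\<^sup>2)))"
proof -
  note U = \<open>open U\<close> \<open>smooth_on U F\<close> and D = \<open>open D\<close> \<open>smooth_on D Q\<close>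
  note shock = \<open>isolated_shock U u {t..<t1} xs uL uR\<close> and cc = \<open>characteristic_curve U F D Q g T x v\<close>
    and about = \<open>equal_area_curve_about x v t (xs t) (uL t) (uR t) s1 s2\<close>
  have F_real_der: "(F has_real_derivative deriv F w) (at w)" if "w \<in> U" for w
    using smooth_on_real_derivatives[OF U] that by metis
  have RH: "rankine_hugoniot F {t..<t1} xs uL uR"
    by (rule weak_solution_imp_rankine_hugoniot[OF \<open>weak_solution U F D Q g T u\<close> \<open>0 \<le> t\<close> \<open>t1 \<le> T\<close> shock])
      (rule DERIV_isCont[OF F_real_der])
  have jump: "uL t \<noteq> uR t" using shock \<open>t < t1\<close> unfolding isolated_shock_def by auto
  have "t < T" using \<open>t < t1\<close> \<open>t1 \<le> T\<close> by simp
  obtain A B M \<delta>0 N where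
    step: "equal_area_step A B s1 s2 M \<delta>0 (xs t) N (\<lambda>s. v s t) (\<lambda>\<delta> s. x s (t + \<delta>)) F (deriv F)"
    and \<delta>0T: "t + \<delta>0 < T"
    by (rule equal_area_curve_imp_equal_area_step[OF U D cc \<open>0 \<le> t\<close> \<open>t < T\<close> about jump])
  interpret equal_area_step A B s1 s2 M \<delta>0 "xs t" N "\<lambda>s. v s t" "\<lambda>\<delta> s. x s (t + \<delta>)" F "deriv F"
    by (rule step)
  have mea: "modified_equal_area F x v t \<delta> a b \<longleftrightarrow> a < b \<and> x a (t + \<delta>) = x b (t + \<delta>) \<and>
     ((\<lambda>s. v s t * deriv (\<lambda>s'. x s' (t + \<delta>)) s) has_integral 0) {a..b}" if "\<delta> \<in> {0..\<delta>0}" for \<delta> a b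
    using modified_equal_area_iff[OF cc \<open>0 \<le> t\<close>, of \<delta>] that \<delta>0T by simp
  have meaD: "a < b" "x a (t + \<delta>) = x b (t + \<delta>)" "J \<delta> a b = 0"
    if "modified_equal_area F x v t \<delta> a b" "\<delta> \<in> {0..\<delta>0}" for \<delta> a b
    using that mea[OF that(2), of a b] by (auto simp: J_def integral_unique)
  have meaI: "modified_equal_area F x v t \<delta> a b"
    if "\<delta> \<in> {0..\<delta>0}" "A \<le> a" "a < b" "b \<le> B" "x a (t + \<delta>) = x b (t + \<delta>)" "J \<delta> a b = 0" for \<delta> a b
    using that mea[OF that(1), of a b] integrable_integral[OF J_integrable[OF that(1,2,4)]] by (simp add: J_def)
  have ev: "\<forall>\<^sub>F \<delta> in at_right 0. \<delta> \<in> {0..\<delta>0} \<and> 0 < \<delta>"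
    using eventually_at_right_less[of 0] \<delta>0(1) by (auto simp: eventually_at_right_field intro!: exI[of _ \<delta>0])
  have "F differentiable (at w)" if "w \<in> U" for w
    using F_real_der[OF that] real_differentiable_def by blast
  from shock_path_expansion[OF \<open>t < t1\<close> shock RH this] obtain Cs where
    "\<forall>\<^sub>F \<delta> in at_right 0. \<bar>xs (t + \<delta>) - (xs t + \<delta> * ((F (uL t) - F (uR t)) / (uL t - uR t)))\<bar> \<le> Cs * \<delta>\<^sup>2"
    by blast
  moreover have "\<sigma> = (F (uL t) - F (uR t)) / (uL t - uR t)"
    using about by (simp add: \<sigma>_def equal_area_curve_about_def)
  ultimately have Cs: "\<forall>\<^sub>F \<delta> in at_right 0. \<bar>xs (t + \<delta>) - (xs t + \<delta> * \<sigma>)\<bar> \<le> Cs * \<delta>\<^sup>2"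
    by simp
  have second_order: "(\<lambda>\<delta>. x (\<sigma>1 \<delta>) (t + \<delta>) - xs (t + \<delta>)) \<in> O[at_right 0](\<lambda>\<delta>. \<delta>\<^sup>2)"
    if \<sigma>: "\<sigma>1 0 = s1" "\<sigma>2 0 = s2" "\<sigma>1 differentiable (at_right 0)" "\<sigma>2 differentiable (at_right 0)"
      and sol: "\<forall>\<^sub>F \<delta> in at_right 0. modified_equal_area F x v t \<delta> (\<sigma>1 \<delta>) (\<sigma>2 \<delta>)" for \<sigma>1 \<sigma>2
  proof -
    obtain K1 where "K1 \<ge> 0" and K1: "\<forall>\<^sub>F \<delta> in at_right 0. \<bar>\<sigma>1 \<delta> - s1\<bar> \<le> K1 * \<delta>"
      using differentiable_at_right_imp_linear_bound[OF \<sigma>(3)] \<sigma>(1) by metis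
    obtain K2 where "K2 \<ge> 0" and K2: "\<forall>\<^sub>F \<delta> in at_right 0. \<bar>\<sigma>2 \<delta> - s2\<bar> \<le> K2 * \<delta>"
      using differentiable_at_right_imp_linear_bound[OF \<sigma>(4)] \<sigma>(2) by metis
    define K where "K = max K1 K2"
    have "K \<ge> 0" using \<open>K1 \<ge> 0\<close> by (simp add: K_def)
    from predicted_position[OF this] obtain C where
      C: "\<And>\<delta> a b. \<lbrakk>\<delta> \<in> {0..\<delta>0}; A \<le> a; a \<le> b; b \<le> B; x a (t + \<delta>) = x b (t + \<delta>); J \<delta> a b = 0;
      \<bar>a - s1\<bar> \<le> K * \<delta>; \<bar>b - s2\<bar> \<le> K * \<delta>\<rbrakk> \<Longrightarrow> \<bar>x a (t + \<delta>) - (xs t + \<delta> * \<sigma>)\<bar> \<le> C * \<delta>\<^sup>2" by metis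
    have "\<forall>\<^sub>F \<delta> in at_right 0. K * \<delta> < min (s1 - A) (B - s2)"
    proof -
      have "((\<lambda>\<delta>. K * \<delta>) \<longlongrightarrow> K * 0) (at_right 0)" by (intro tendsto_intros)
      then show ?thesis using order by (intro order_tendstoD(2)) auto
    qed
    then have "\<forall>\<^sub>F \<delta> in at_right 0. norm (x (\<sigma>1 \<delta>) (t + \<delta>) - xs (t + \<delta>)) \<le> (C + Cs) * norm (\<delta>\<^sup>2)"
      using ev K1 K2 Cs sol
    proof eventually_elim
      case (elim \<delta>)
      have "K1 * \<delta> \<le> K * \<delta>" "K2 * \<delta> \<le> K * \<delta>" using elim by (auto simp: K_def intro!: mult_right_mono)
      then have near: "\<bar>\<sigma>1 \<delta> - s1\<bar> \<le> K * \<delta>" "\<bar>\<sigma>2 \<delta> - s2\<bar> \<le> K * \<delta>" using elim by linarith+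
      have "A \<le> \<sigma>1 \<delta>" "\<sigma>2 \<delta> \<le> B" using near elim(1) by (auto simp: abs_if split: if_splits)
      then have "\<bar>x (\<sigma>1 \<delta>) (t + \<delta>) - (xs t + \<delta> * \<sigma>)\<bar> \<le> C * \<delta>\<^sup>2"
        using meaD[of \<delta> "\<sigma>1 \<delta>" "\<sigma>2 \<delta>"] elim near by (intro C) auto
      then show ?case using elim(5) by (simp add: distrib_right)
    qed
    then show ?thesis by (rule bigoI)
  qed
  have nearby: "\<exists>r>0. \<exists>C. \<forall>\<^sub>F \<delta> in at_right 0.
        (\<exists>a\<in>ball s1 r. \<exists>b\<in>ball s2 r. modified_equal_area F x v t \<delta> a b) \<and>
        (\<forall>a\<in>ball s1 r. \<forall>b\<in>ball s2 r. modified_equal_area F x v t \<delta> a b \<longrightarrow>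
           \<bar>x a (t + \<delta>) - xs (t + \<delta>)\<bar> \<le> C * \<delta>\<^sup>2)"
    if trans: "transversal_at x t s1" "transversal_at x t s2"
  proof -
    obtain c1 r1 where c1: "c1 > 0" "r1 > 0" "\<forall>a\<in>ball s1 r1. \<forall>b\<in>ball s1 r1. c1 * \<bar>a - b\<bar> \<le> \<bar>x a t - x b t\<bar>"
      using trans(1) unfolding transversal_at_def by blast
    obtain c2 r2 where c2: "c2 > 0" "r2 > 0" "\<forall>a\<in>ball s2 r2. \<forall>b\<in>ball s2 r2. c2 * \<bar>a - b\<bar> \<le> \<bar>x a t - x b t\<bar>"
      using trans(2) unfolding transversal_at_def by blast
    have c12: "min c1 c2 * \<bar>a - b\<bar> \<le> c1 * \<bar>a - b\<bar>" "min c1 c2 * \<bar>a - b\<bar> \<le> c2 * \<bar>a - b\<bar>" for a b :: real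
      by (auto intro: mult_right_mono)
    interpret transversal_equal_area_step A B s1 s2 M \<delta>0 "xs t" N "\<lambda>s. v s t" "\<lambda>\<delta> s. x s (t + \<delta>)" F "deriv F"
      "min c1 c2" "min r1 r2"
      by unfold_locales (use c1 c2 order_trans[OF c12(1)] order_trans[OF c12(2)] in auto)
    obtain r K where "r > 0" "K \<ge> 0" and near: "\<forall>\<^sub>F \<delta> in at_right 0. \<forall>a\<in>ball s1 r. \<forall>b\<in>ball s2 r. x a (t + \<delta>) = x b (t + \<delta>) \<and> J \<delta> a b = 0 \<longrightarrow>
       A \<le> a \<and> a \<le> b \<and> b \<le> B \<and> \<bar>a - s1\<bar> \<le> K * \<delta> \<and> \<bar>b - s2\<bar> \<le> K * \<delta>"
      by (rule solutions_near_ends) (rule that, assumption+)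
    from predicted_position[OF \<open>K \<ge> 0\<close>] obtain C where
      C: "\<And>\<delta> a b. \<lbrakk>\<delta> \<in> {0..\<delta>0}; A \<le> a; a \<le> b; b \<le> B; x a (t + \<delta>) = x b (t + \<delta>); J \<delta> a b = 0;
      \<bar>a - s1\<bar> \<le> K * \<delta>; \<bar>b - s2\<bar> \<le> K * \<delta>\<rbrakk> \<Longrightarrow> \<bar>x a (t + \<delta>) - (xs t + \<delta> * \<sigma>)\<bar> \<le> C * \<delta>\<^sup>2" by metis
    have "\<forall>\<^sub>F \<delta> in at_right 0.
        (\<exists>a\<in>ball s1 r. \<exists>b\<in>ball s2 r. modified_equal_area F x v t \<delta> a b) \<and>
        (\<forall>a\<in>ball s1 r. \<forall>b\<in>ball s2 r. modified_equal_area F x v t \<delta> a b \<longrightarrow>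
           \<bar>x a (t + \<delta>) - xs (t + \<delta>)\<bar> \<le> (C + Cs) * \<delta>\<^sup>2)"
      using ev near Cs solution_exists[OF \<open>r > 0\<close>]
    proof eventually_elim
      case (elim \<delta>)
      have "\<exists>a\<in>ball s1 r. \<exists>b\<in>ball s2 r. modified_equal_area F x v t \<delta> a b"
        using elim(1,4) meaI by blast
      moreover have "\<bar>x a (t + \<delta>) - xs (t + \<delta>)\<bar> \<le> (C + Cs) * \<delta>\<^sup>2"
        if "a \<in> ball s1 r" "b \<in> ball s2 r" "modified_equal_area F x v t \<delta> a b" for a b
      proof -
        have "\<bar>x a (t + \<delta>) - (xs t + \<delta> * \<sigma>)\<bar> \<le> C * \<delta>\<^sup>2"
          using meaD[OF that(3)] elim(1,2) that(1,2) by (intro C[of \<delta> a b]) auto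
        then show ?thesis using elim(3) by (simp add: distrib_right)
      qed
      ultimately show ?case by blast
    qed
    then show ?thesis using \<open>r > 0\<close> by blast
  qed
  show ?thesis using RH second_order nearby by blast
qed

end
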